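(* For every integer $s\geq 1$, the Euler characteristic of the moduli space $\widetilde X_s=\mathcal{MHG}_{1,s}$ of holocolored one-loop graphs with $s$ legs is $$\chi(\widetilde X_s)=\sum_{k=1}^{s}\sum_{j=0}^{k}(-1)^{j+1}\,\frac{j^s\,(k-1)!}{2-\delta_{k,1}}\binom{s}{k}\binom{k}{j},$$ where $\delta_{k,1}$ is the Kronecker delta.
   Context: Graphs are finite non-empty multigraphs (self-loops and multiple edges allowed) with a set $E(G)$ of internal edges and $s$ external legs labeled bijectively by $1,\ldots,s$, each leg attached to a vertex. The valency of a vertex is the number of half-edges at it (legs count once, self-loops twice). A graph is admissible if it is connected, stays connected upon removal of any single internal edge, and all vertices have valency $\geq 3$. Its rank is its first Betti number. Hence an admissible graph of rank one with $s$ legs is a cycle with $k$ vertices and $k$ internal edges, $1\leq k\leq s$ ($k=1$: one vertex with a self-loop; $k=2$: two vertices joined by a double edge), each vertex carrying at least one leg. A holocoloring of such a graph is an injective map $c:E(G)\to\{1,\ldots,s\}$. A metric $\lambda:E(G)\to\mathbb{R}_{\geq 0}$ is regular if $Z=\{e:\lambda(e)=0\}$ is (the edge set of) a forest; in rank one this means $\lambda\not\equiv 0$. $G/Z$ denotes $G$ with the edges of $Z$ collapsed. The points of $\widetilde X_s$ are the triples $(G,\lambda,c)$ with $G$ admissible of rank one with $s$ legs, $\lambda$ a regular metric, $c$ a holocoloring, modulo the relation: $(G,\lambda,c)\sim(G',\lambda',c')$ iff, with $Z,Z'$ the zero sets of $\lambda,\lambda'$, there are a graph isomorphism $\varphi:G/Z\to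 G'/Z'$ preserving the leg labels and a constant $a>0$ with $\lambda'\circ\varphi=a\lambda$ and $c'\circ\varphi=c$ on $E(G)\setminus Z$ (so colors of collapsed edges are forgotten). Topology: for each isomorphism class of pairs $(G,c)$ the regular metrics of total length $1$ form a closed simplex of dimension $|E(G)|-1$; $\widetilde X_s$ carries the quotient topology from the disjoint union of these simplices. *)

theory Defs
  imports "HOL-Homology.Homology" "HOL-Library.Multiset"
begin

section \<open>Multigraphs with labelled legs\<close>

text \<open>An edge is an unordered pair of vertices, given as a multiset of size two, so that
  \<open>{#v, v#}\<close> is a self-loop. The leg labelled \<open>i\<close> is attached to the vertex \<open>leg G i\<close>;
  only the labels \<open>1, \<dots>, s\<close> are used, the number \<open>s\<close> being a separate parameter.\<close>

record ('v, 'e) mgraph =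
  verts :: "'v set"
  edges :: "'e set"
  ends :: "'e \<Rightarrow> 'v multiset"
  leg :: "nat \<Rightarrow> 'v"

definition legged_graph :: "nat \<Rightarrow> ('v, 'e) mgraph \<Rightarrow> bool" where
  "legged_graph s G \<longleftrightarrow>
     finite (verts G) \<and> verts G \<noteq> {} \<and> finite (edges G) \<and>
     (\<forall>e\<in>edges G. size (ends G e) = 2 \<and> set_mset (ends G e) \<subseteq> verts G) \<and>
     (\<forall>i\<in>{1..s}. leg G i \<in> verts G)"

definition valency :: "nat \<Rightarrow> ('v, 'e) mgraph \<Rightarrow> 'v \<Rightarrow> nat" where
  "valency s G v = (\<Sum>e\<in>edges G. count (ends G e) v) + card {i\<in>{1..s}. leg G i = v}"

text \<open>Being joined by a path all of whose edges lie in \<open>F\<close>.\<close>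

definition linked :: "('v, 'e) mgraph \<Rightarrow> 'e set \<Rightarrow> ('v \<times> 'v) set" where
  "linked G F = {(u, v). u \<in> verts G \<and> v \<in> verts G \<and>
     (u, v) \<in> {(x, y). \<exists>e\<in>F. ends G e = {#x, y#}}\<^sup>*}"

definition connected_by :: "('v, 'e) mgraph \<Rightarrow> 'e set \<Rightarrow> bool" where
  "connected_by G F \<longleftrightarrow> (\<forall>u\<in>verts G. \<forall>v\<in>verts G. (u, v) \<in> linked G F)"

definition components_by :: "('v, 'e) mgraph \<Rightarrow> 'e set \<Rightarrow> 'v set set" where
  "components_by G F = verts G // linked G F"

definition first_betti :: "('v, 'e) mgraph \<Rightarrow> int" where
  "first_betti G =
     int (card (edges G)) - int (card (verts G)) + int (card (components_by G (edges G)))"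

definition admissible :: "nat \<Rightarrow> ('v, 'e) mgraph \<Rightarrow> bool" where
  "admissible s G \<longleftrightarrow>
     legged_graph s G \<and> connected_by G (edges G) \<and>
     (\<forall>e\<in>edges G. connected_by G (edges G - {e})) \<and>
     (\<forall>v\<in>verts G. 3 \<le> valency s G v)"

text \<open>Cycles of length one (a self-loop) and two (a pair of parallel edges) are included.\<close>

definition is_cycle :: "('v, 'e) mgraph \<Rightarrow> 'v list \<Rightarrow> 'e list \<Rightarrow> bool" where
  "is_cycle G vs es \<longleftrightarrow>
     es \<noteq> [] \<and> length vs = length es \<and> distinct vs \<and> distinct es \<and>
     set vs \<subseteq> verts G \<and> set es \<subseteq> edges G \<and>
     (\<forall>i<length es. ends G (es ! i) = {#vs ! i, vs ! (Suc i mod length es)#})"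

definition forest :: "('v, 'e) mgraph \<Rightarrow> 'e set \<Rightarrow> bool" where
  "forest G F \<longleftrightarrow> F \<subseteq> edges G \<and> (\<nexists>vs es. is_cycle G vs es \<and> set es \<subseteq> F)"

definition collapse :: "('v, 'e) mgraph \<Rightarrow> 'e set \<Rightarrow> ('v set, 'e) mgraph" where
  "collapse G F =
     \<lparr>verts = components_by G F,
      edges = edges G - F,
      ends = (\<lambda>e. image_mset (\<lambda>v. linked G F `` {v}) (ends G e)),
      leg = (\<lambda>i. linked G F `` {leg G i})\<rparr>"

text \<open>A graph isomorphism preserving the leg labels, given by its action \<open>f\<close> on vertices and
  \<open>g\<close> on edges. (Exchanging the two half-edges of a self-loop acts trivially on both.)\<close>

definition graph_iso ::
  "nat \<Rightarrow> ('v, 'e) mgraph \<Rightarrow> ('w, 'd) mgraph \<Rightarrow> ('v \<Rightarrow> 'w) \<Rightarrow> ('e \<Rightarrow> 'd) \<Rightarrow> bool" where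
  "graph_iso s G G' f g \<longleftrightarrow>
     bij_betw f (verts G) (verts G') \<and> bij_betw g (edges G) (edges G') \<and>
     (\<forall>e\<in>edges G. ends G' (g e) = image_mset f (ends G e)) \<and>
     (\<forall>i\<in>{1..s}. leg G' i = f (leg G i))"

section \<open>The moduli space of holocolored one-loop graphs\<close>

text \<open>Vertices and edges are named by natural numbers, which loses no isomorphism type of
  finite graphs.\<close>

type_synonym ngraph = "(nat, nat) mgraph"

definition one_loop_graphs :: "nat \<Rightarrow> ngraph set" where
  "one_loop_graphs s = {G. admissible s G \<and> first_betti G = 1}"

definition holocolorings :: "nat \<Rightarrow> ngraph \<Rightarrow> (nat \<Rightarrow> nat) set" where
  "holocolorings s G = {c \<in> edges G \<rightarrow>\<^sub>E {1..s}. inj_on c (edges G)}"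

definition zero_edges :: "ngraph \<Rightarrow> (nat \<Rightarrow> real) \<Rightarrow> nat set" where
  "zero_edges G l = {e \<in> edges G. l e = 0}"

definition regular_metrics :: "ngraph \<Rightarrow> (nat \<Rightarrow> real) set" where
  "regular_metrics G = {l \<in> edges G \<rightarrow>\<^sub>E {0..}. forest G (zero_edges G l)}"

type_synonym mhg_triple = "ngraph \<times> (nat \<Rightarrow> real) \<times> (nat \<Rightarrow> nat)"

definition mhg_triples :: "nat \<Rightarrow> mhg_triple set" where
  "mhg_triples s =
     {(G, l, c). G \<in> one_loop_graphs s \<and> l \<in> regular_metrics G \<and> c \<in> holocolorings s G}"

definition mhg_rel :: "nat \<Rightarrow> (mhg_triple \<times> mhg_triple) set" where
  "mhg_rel s =
     {((G, l, c), (G', l', c')).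
        (G, l, c) \<in> mhg_triples s \<and> (G', l', c') \<in> mhg_triples s \<and>
        (\<exists>f g a. graph_iso s (collapse G (zero_edges G l)) (collapse G' (zero_edges G' l')) f g \<and>
           0 < a \<and>
           (\<forall>e \<in> edges G - zero_edges G l. l' (g e) = a * l e \<and> c' (g e) = c e))}"

definition mhg_points :: "nat \<Rightarrow> mhg_triple set set" where
  "mhg_points s = mhg_triples s // mhg_rel s"

definition metric_simplex :: "ngraph \<Rightarrow> (nat \<Rightarrow> real) topology" where
  "metric_simplex G =
     subtopology (product_topology (\<lambda>_. euclideanreal) (edges G))
       {l \<in> regular_metrics G. (\<Sum>e\<in>edges G. l e) = 1}"

text \<open>One simplex for every pair \<open>(G, c)\<close>. Isomorphic pairs have simplices identified by a
  homeomorphism over \<open>mhg_points s\<close>, so taking all pairs rather than one from each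
  isomorphism class gives the same quotient topology.\<close>

definition mhg_simplices :: "nat \<Rightarrow> ((ngraph \<times> (nat \<Rightarrow> nat)) \<times> (nat \<Rightarrow> real)) topology" where
  "mhg_simplices s =
     sum_topology (\<lambda>(G, c). metric_simplex G)
       {(G, c). G \<in> one_loop_graphs s \<and> c \<in> holocolorings s G}"

definition mhg_proj ::
  "nat \<Rightarrow> (ngraph \<times> (nat \<Rightarrow> nat)) \<times> (nat \<Rightarrow> real) \<Rightarrow> mhg_triple set" where
  "mhg_proj s = (\<lambda>((G, c), l). mhg_rel s `` {(G, l, c)})"

definition coinduced_topology :: "'b set \<Rightarrow> 'a topology \<Rightarrow> ('a \<Rightarrow> 'b) \<Rightarrow> 'b topology" where
  "coinduced_topology Y X f =
     topology (\<lambda>U. U \<subseteq> Y \<and> openin X {x \<in> topspace X. f x \<in> U})"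

lemma openin_coinduced_topology:
  "openin (coinduced_topology Y X f) U \<longleftrightarrow> U \<subseteq> Y \<and> openin X {x \<in> topspace X. f x \<in> U}"
proof -
  have 1: "{x \<in> topspace X. f x \<in> S \<inter> T} =
      {x \<in> topspace X. f x \<in> S} \<inter> {x \<in> topspace X. f x \<in> T}" for S T
    by auto
  have 2: "{x \<in> topspace X. f x \<in> \<Union>\<K>} = (\<Union>K\<in>\<K>. {x \<in> topspace X. f x \<in> K})" for \<K>
    by auto
  have "istopology (\<lambda>U. U \<subseteq> Y \<and> openin X {x \<in> topspace X. f x \<in> U})"
    unfolding istopology_def 1 2 by blast
  then show ?thesis
    by (simp add: coinduced_topology_def)
qed

definition MHG1 :: "nat \<Rightarrow> mhg_triple set topology" where
  "MHG1 s = coinduced_topology (mhg_points s) (mhg_simplices s) (mhg_proj s)"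

section \<open>Euler characteristic\<close>

definition int_independent :: "('a, 'm) monoid_scheme \<Rightarrow> 'a set \<Rightarrow> bool" where
  "int_independent G B \<longleftrightarrow>
     finite B \<and> B \<subseteq> carrier G \<and>
     (\<forall>n::'a \<Rightarrow> int. finprod G (\<lambda>b. b [^]\<^bsub>G\<^esub> n b) B = \<one>\<^bsub>G\<^esub> \<longrightarrow> (\<forall>b\<in>B. n b = 0))"

definition has_finite_rank :: "('a, 'm) monoid_scheme \<Rightarrow> bool" where
  "has_finite_rank G \<longleftrightarrow> bdd_above (card ` {B. int_independent G B})"

definition abelian_rank :: "('a, 'm) monoid_scheme \<Rightarrow> nat" where
  "abelian_rank G = Sup (card ` {B. int_independent G B})"

definition betti_number :: "nat \<Rightarrow> 'a topology \<Rightarrow> nat" where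
  "betti_number p X = abelian_rank (homology_group (int p) X)"

text \<open>The condition under which the Euler characteristic is a finite sum of finite ranks;
  without it \<open>euler_characteristic\<close> below is a junk value.\<close>

definition has_euler_characteristic :: "'a topology \<Rightarrow> bool" where
  "has_euler_characteristic X \<longleftrightarrow>
     (\<forall>p. has_finite_rank (homology_group (int p) X)) \<and> finite {p. betti_number p X \<noteq> 0}"

definition euler_characteristic :: "'a topology \<Rightarrow> int" where
  "euler_characteristic X = (\<Sum>p | betti_number p X \<noteq> 0. (-1) ^ p * int (betti_number p X))"

end

theory Submission
  imports Defs
begin

text \<open>A coloured one-loop graph has no automorphisms, and distinct edges have distinct colours, so
  the moduli space is glued from simplices each of which embeds: its closed cells are the
  isomorphism classes of pairs \<open>(G, c)\<close>, and contracting edges amounts to restricting the set of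
  colours. Sending a point to the family of functions "smallest length among the edges coloured by
  \<open>J\<close>, provided that contracting all others gives a prescribed class" embeds the space into a
  finite-dimensional real vector space, where radial projection away from the barycentre of a top cell is
  linear up to scaling. Excision and the long exact sequence then add the cells one at a time, giving
  the alternating sum of the numbers of cells. A cell with \<open>k\<close> edges is a surjection from
  the legs onto the vertices of the \<open>k\<close>-cycle together with an injective colouring, up to the action of the
  dihedral group, which is free of order \<open>2 k\<close> for \<open>k \<ge> 2\<close>; for \<open>k = 1\<close> there is nothing to divide by.\<close>

section \<open>Ranks of abelian groups\<close>

text \<open>Cells are not determined by their vertices: for three legs there are three cells with
  one colour but nine with two, three over each pair of colours. Barycentric coordinates would
  identify distinct points, so one coordinate per cell is kept and not only one per vertex. A
  minimum serves as that coordinate because it vanishes as soon as one length does and commutes with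
  increasing affine maps; the second property makes the radial projection continuous in the ambient
  coordinates. The homology of spheres never enters: the boundary of a closed cell is a smaller
  complex of the same kind, so induction supplies its Euler characteristic, and contractibility of
  the closed cell gives that of the pair. The space is a quotient of infinitely many simplices, one
  for every naming of vertices and edges by natural numbers. A code made of relations between legs,
  with no vertex names in it, turns isomorphism into equality and reduces this to finitely many
  cells; the continuous inverse of the embedding is then pasted together from these.\<close>

lemma int_relation:
  fixes M :: "'c \<Rightarrow> 'a \<Rightarrow> int"
  assumes "finite A" "finite C" "card A < card C"
  shows "\<exists>x. (\<exists>c\<in>C. x c \<noteq> 0) \<and> (\<forall>a\<in>A. (\<Sum>c\<in>C. x c * M c a) = 0)"
  using assms
proof (induction A arbitrary: C M rule: finite_induct)
  case empty
  then have "C \<noteq> {}" by auto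
  then show ?case by (intro exI[of _ "\<lambda>_. 1"]) auto
next
  case (insert a A)
  show ?case
  proof (cases "\<forall>c\<in>C. M c a = 0")
    case True
    from insert have "card A < card C" by auto
    then obtain x where "\<exists>c\<in>C. x c \<noteq> 0" "\<forall>a\<in>A. (\<Sum>c\<in>C. x c * M c a) = 0"
      using insert.IH[of C M] insert.prems by auto
    then show ?thesis using True by (intro exI[of _ x]) auto
  next
    case False
    then obtain c0 where c0: "c0 \<in> C" "M c0 a \<noteq> 0" by auto
    \<comment> \<open>Fraction-free elimination with pivot \<open>M c0 a\<close>: the
      cross-multiplied rows have entry 0 at \<open>a\<close>, which leaves one vector and one
      coordinate fewer.\<close>
    define M' where "M' c b = M c0 a * M c b - M c a * M c0 b" for c b
    have "card A < card (C - {c0})" using insert c0 by auto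
    then obtain x where x: "\<exists>c\<in>C - {c0}. x c \<noteq> 0"
      "\<And>b. b \<in> A \<Longrightarrow> (\<Sum>c\<in>C - {c0}. x c * M' c b) = 0"
      using insert.IH[of "C - {c0}" M'] insert.prems by auto
    \<comment> \<open>Scaling by the non-zero pivot keeps some coefficient non-zero; the coefficient
      of \<open>c0\<close> is the one that makes \<open>sum_y\<close> hold.\<close>
    define y where "y c = (if c = c0 then - (\<Sum>c\<in>C - {c0}. x c * M c a) else M c0 a * x c)" for c
    have sum_y: "(\<Sum>c\<in>C. y c * M c b) = (\<Sum>c\<in>C - {c0}. x c * M' c b)" for b
    proof -
      have "(\<Sum>c\<in>C. y c * M c b) = y c0 * M c0 b + (\<Sum>c\<in>C - {c0}. y c * M c b)"
        using c0 insert.prems by (simp add: sum.remove)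
      also have "(\<Sum>c\<in>C - {c0}. y c * M c b) = (\<Sum>c\<in>C - {c0}. M c0 a * x c * M c b)"
        by (rule sum.cong) (auto simp: y_def)
      also have "y c0 * M c0 b = - (\<Sum>c\<in>C - {c0}. x c * M c a * M c0 b)"
        by (simp add: y_def sum_distrib_right)
      finally show ?thesis
        by (simp add: M'_def algebra_simps sum_subtractf)
    qed
    have "M' c a = 0" for c by (simp add: M'_def)
    then have "(\<Sum>c\<in>C. y c * M c a) = 0" by (simp add: sum_y)
    moreover have "(\<Sum>c\<in>C. y c * M c b) = 0" if "b \<in> A" for b
      using x(2)[OF that] by (simp add: sum_y)
    moreover obtain c where "c \<in> C" "c \<noteq> c0" "x c \<noteq> 0" using x(1) by auto
    then have "\<exists>c\<in>C. y c \<noteq> 0"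
      using c0 by (intro bexI[of _ c]) (auto simp: y_def)
    ultimately show ?thesis by (intro exI[of _ y]) simp
  qed
qed

abbreviation lin_comb :: "('a, 'm) monoid_scheme \<Rightarrow> ('a \<Rightarrow> int) \<Rightarrow> 'a set \<Rightarrow> 'a" where
  "lin_comb G n B \<equiv> finprod G (\<lambda>b. b [^]\<^bsub>G\<^esub> n b) B"

context comm_group
begin

lemma lin_comb_closed: "B \<subseteq> carrier G \<Longrightarrow> lin_comb G n B \<in> carrier G"
  by (intro finprod_closed) auto

lemma lin_comb_add:
  assumes "B \<subseteq> carrier G"
  shows "lin_comb G (\<lambda>b. n b + m b) B = lin_comb G n B \<otimes> lin_comb G m B"
proof -
  have "lin_comb G (\<lambda>b. n b + m b) B = finprod G (\<lambda>b. b [^] n b \<otimes> b [^] m b) B"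
    using assms by (intro finprod_cong') (auto simp: int_pow_mult)
  also have "\<dots> = lin_comb G n B \<otimes> lin_comb G m B"
    using assms by (intro finprod_multf) auto
  finally show ?thesis .
qed

lemma finprod_int_pow:
  "f \<in> A \<rightarrow> carrier G \<Longrightarrow> finprod G f A [^] (k::int) = finprod G (\<lambda>a. f a [^] k) A"
proof (induction A rule: infinite_finite_induct)
  case (insert a A)
  then have "f a \<in> carrier G" "f \<in> A \<rightarrow> carrier G" by auto
  with insert show ?case
    by (simp add: int_pow_distrib Pi_def)
qed auto

lemma lin_comb_scale:
  assumes "B \<subseteq> carrier G"
  shows "lin_comb G n B [^] k = lin_comb G (\<lambda>b. n b * k) B"
proof -
  have "lin_comb G n B [^] k = finprod G (\<lambda>b. (b [^] n b) [^] k) B"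
    using assms by (intro finprod_int_pow) auto
  also have "\<dots> = lin_comb G (\<lambda>b. n b * k) B"
    using assms by (intro finprod_cong') (auto simp: int_pow_pow)
  finally show ?thesis .
qed

lemma finprod_lin_comb:
  assumes "finite C" "B \<subseteq> carrier G"
  shows "finprod G (\<lambda>c. lin_comb G (M c) B) C = lin_comb G (\<lambda>b. \<Sum>c\<in>C. M c b) B"
  using assms(1)
proof induction
  case empty
  then show ?case by (simp add: finprod_one_eqI)
next
  case (insert c C)
  have "finprod G (\<lambda>c. lin_comb G (M c) B) (insert c C) =
      lin_comb G (M c) B \<otimes> finprod G (\<lambda>c. lin_comb G (M c) B) C"
    using insert.hyps lin_comb_closed[OF assms(2)] by (intro finprod_insert) auto
  then show ?case
    using insert lin_comb_add[OF assms(2), of "M c" "\<lambda>b. \<Sum>c\<in>C. M c b"] by simp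
qed

lemma int_independentD:
  "\<lbrakk>int_independent G B; lin_comb G n B = \<one>; b \<in> B\<rbrakk> \<Longrightarrow> n b = 0"
  by (auto simp: int_independent_def)

text \<open>Steinitz's bound after inverting integers: the powers \<open>N\<close> play the part of
  denominators. More elements than \<open>card B\<close> would give an integer relation between
  their exponent vectors.\<close>

lemma int_independent_card_le:
  assumes C: "int_independent G C" and B: "finite B" "B \<subseteq> carrier G"
    and span: "\<And>c. c \<in> C \<Longrightarrow> \<exists>N n. N \<noteq> (0::int) \<and> c [^] N = lin_comb G n B"
  shows "card C \<le> card B"
proof (rule ccontr)
  assume "\<not> card C \<le> card B"
  then have less: "card B < card C" by simp
  have C': "finite C" "C \<subseteq> carrier G" using C by (auto simp: int_independent_def)
  obtain N n where Nn: "\<And>c. c \<in> C \<Longrightarrow> N c \<noteq> (0::int)"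
    "\<And>c. c \<in> C \<Longrightarrow> c [^] N c = lin_comb G (n c) B"
    using span by metis
  obtain x where x: "\<exists>c\<in>C. x c \<noteq> 0" "\<forall>b\<in>B. (\<Sum>c\<in>C. x c * n c b) = 0"
    using int_relation[OF B(1) C'(1) less, of n] by blast
  \<comment> \<open>The relation \<open>x\<close> holds between the powers \<open>c [^] N c\<close>,
    so the exponents of the elements themselves are \<open>N c * x c\<close>, still not all
    zero.\<close>
  have "lin_comb G (\<lambda>c. N c * x c) C = finprod G (\<lambda>c. lin_comb G (\<lambda>b. n c b * x c) B) C"
  proof (rule finprod_cong')
    fix c assume c: "c \<in> C"
    then have "c [^] (N c * x c) = (c [^] N c) [^] x c" using C' by (auto simp: int_pow_pow)
    then show "c [^] (N c * x c) = lin_comb G (\<lambda>b. n c b * x c) B"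
      using Nn(2)[OF c] lin_comb_scale[OF B(2)] by simp
  qed (use lin_comb_closed[OF B(2)] in auto)
  also have "\<dots> = lin_comb G (\<lambda>b. \<Sum>c\<in>C. n c b * x c) B"
    by (rule finprod_lin_comb[OF C'(1) B(2)])
  also have "\<dots> = \<one>"
    using x(2) by (intro finprod_one_eqI) (simp add: mult.commute)
  finally have "\<forall>c\<in>C. N c * x c = 0"
    using int_independentD[OF C, of "\<lambda>c. N c * x c"] by auto
  then show False using x(1) Nn(1) by auto
qed

text \<open>Any relation on \<open>insert g B\<close> must involve \<open>g\<close>, as
  \<open>B\<close> alone has none; solving for the power of \<open>g\<close> gives the claim. The
  premise \<open>max\<close> is an implication so that \<open>g\<close> may already lie in
  \<open>B\<close>.\<close>

lemma maximal_independent_spans: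
  assumes B: "int_independent G B" and g: "g \<in> carrier G"
    and max: "int_independent G (insert g B) \<Longrightarrow> g \<in> B"
  shows "\<exists>N n. N \<noteq> (0::int) \<and> g [^] N = lin_comb G n B"
proof -
  have B': "finite B" "B \<subseteq> carrier G" using B by (auto simp: int_independent_def)
  show ?thesis
  proof (cases "g \<in> B")
    case True
    have "lin_comb G (\<lambda>b. if b = g then 1 else 0) B = finprod G (\<lambda>b. if g = b then b else \<one>) B"
      using B' by (intro finprod_cong') auto
    also have "\<dots> = g"
      using finprod_singleton[OF True B'(1), of "\<lambda>b. b"] B' by auto
    finally show ?thesis using g by (intro exI[of _ 1]) (metis int_pow_1 zero_neq_one)
  next
    case False
    then have "\<not> int_independent G (insert g B)" using max by auto
    then obtain n where n: "lin_comb G n (insert g B) = \<one>" "\<exists>b\<in>insert g B. n b \<noteq> (0::int)"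
      using B' g by (auto simp: int_independent_def)
    have eq: "g [^] n g \<otimes> lin_comb G n B = \<one>"
      using n(1) B' g False by (subst (asm) finprod_insert) auto
    have "n g \<noteq> 0"
    proof
      assume "n g = 0"
      then have "lin_comb G n B = \<one>" using eq lin_comb_closed[OF B'(2)] by simp
      then have "\<forall>b\<in>B. n b = 0" using int_independentD[OF B, of n] by simp
      then show False using n(2) \<open>n g = 0\<close> by simp
    qed
    moreover have "g [^] n g = lin_comb G (\<lambda>b. n b * -1) B"
    proof -
      have "g [^] n g = inv (lin_comb G n B)"
        using inv_equality[OF eq lin_comb_closed[OF B'(2)] int_pow_closed[OF g]] by simp
      also have "\<dots> = lin_comb G n B [^] (-1::int)"
        using lin_comb_closed[OF B'(2)] by (simp add: int_pow_neg)
      finally show ?thesis by (simp only: lin_comb_scale[OF B'(2)])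
    qed
    ultimately show ?thesis by iprover
  qed
qed

end

text \<open>The rank of a subset, so that kernels and images need no group structure of their own.\<close>

definition rank_is :: "('a, 'm) monoid_scheme \<Rightarrow> 'a set \<Rightarrow> nat \<Rightarrow> bool" where
  "rank_is G S r \<longleftrightarrow> (\<exists>B\<subseteq>S. int_independent G B \<and> card B = r) \<and>
     (\<forall>B\<subseteq>S. int_independent G B \<longrightarrow> card B \<le> r)"

abbreviation full_rank :: "('a, 'm) monoid_scheme \<Rightarrow> nat \<Rightarrow> bool" where
  "full_rank G r \<equiv> rank_is G (carrier G) r"

lemma rank_is_unique: "rank_is G S r \<Longrightarrow> rank_is G S r' \<Longrightarrow> r = r'"
  unfolding rank_is_def by (meson order_antisym)

lemma int_independent_empty [simp]: "int_independent G {}"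
  by (simp add: int_independent_def)

lemma bounded_imp_rank_is:
  assumes "\<And>B. B \<subseteq> S \<Longrightarrow> int_independent G B \<Longrightarrow> card B \<le> n"
  shows "\<exists>r\<le>n. rank_is G S r"
proof -
  let ?P = "\<lambda>r. \<exists>B\<subseteq>S. int_independent G B \<and> card B = r"
  have "?P 0" by (intro exI[of _ "{}"]) auto
  moreover have le: "\<forall>r. ?P r \<longrightarrow> r \<le> n" using assms by auto
  ultimately have "?P (GREATEST r. ?P r)" "\<forall>r. ?P r \<longrightarrow> r \<le> (GREATEST r. ?P r)"
    using GreatestI_nat[of ?P 0 n] Greatest_le_nat[of ?P _ n] by blast+
  then have "rank_is G S (GREATEST r. ?P r)"
    unfolding rank_is_def by blast
  with le show ?thesis unfolding rank_is_def by blast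
qed

lemma rank_is_subset:
  assumes "rank_is G T r" "S \<subseteq> T"
  shows "\<exists>r'. rank_is G S r'"
  using bounded_imp_rank_is[of S G r] assms unfolding rank_is_def by (meson order_trans)

text \<open>Passes between witnessed maxima and \<open>abelian_rank\<close>: a bounded non-empty set
  of naturals attains its \<open>Sup\<close>, while an unbounded one would give no
  information.\<close>

lemma rank_is_carrier_iff:
  "full_rank G r \<longleftrightarrow> has_finite_rank G \<and> abelian_rank G = r"
proof
  assume r: "full_rank G r"
  then have le: "\<forall>B. int_independent G B \<longrightarrow> card B \<le> r" and "\<exists>B. int_independent G B \<and> card B = r"
    unfolding rank_is_def by (auto simp: int_independent_def)
  then have "Sup (card ` {B. int_independent G B}) = r"
    by (intro cSup_eq_maximum) auto
  then show "has_finite_rank G \<and> abelian_rank G = r"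
    using le unfolding has_finite_rank_def abelian_rank_def bdd_above_def by auto
next
  assume *: "has_finite_rank G \<and> abelian_rank G = r"
  let ?X = "card ` {B. int_independent G B}"
  have "bdd_above ?X" "?X \<noteq> {}" using * by (auto simp: has_finite_rank_def intro: exI[of _ "{}"])
  then have "finite ?X" "?X \<noteq> {}" "Sup ?X = Max ?X"
    by (simp_all add: bdd_above_nat cSup_eq_Max)
  then have "r \<in> ?X" "\<forall>x\<in>?X. x \<le> r"
    using * Max_in[of ?X] unfolding abelian_rank_def by simp_all
  then obtain B where B: "int_independent G B" "card B = r" and le: "\<And>C. int_independent G C \<Longrightarrow> card C \<le> r"
    by auto
  then have "B \<subseteq> carrier G" by (simp add: int_independent_def)
  with B le show "full_rank G r"
    unfolding rank_is_def by (intro conjI exI[of _ B] allI impI)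
qed

section \<open>Homomorphisms and the rank formula\<close>

locale comm_group_hom = G: comm_group G + H: comm_group H
  for G (structure) and H (structure) + fixes f assumes hom: "f \<in> hom G H"
begin

lemma f_closed: "x \<in> carrier G \<Longrightarrow> f x \<in> carrier H"
  using hom by (auto simp: hom_def)

lemma f_inv: "x \<in> carrier G \<Longrightarrow> f (inv x) = inv\<^bsub>H\<^esub> (f x)"
  by (intro group_hom.hom_inv) (auto simp: group_hom_def group_hom_axioms_def hom G.is_group H.is_group)

lemma f_lin_comb:
  assumes "B \<subseteq> carrier G"
  shows "f (lin_comb G n B) = finprod H (\<lambda>b. f b [^]\<^bsub>H\<^esub> n b) B"
  using assms
proof (induction B rule: infinite_finite_induct)
  case (insert b B)
  have "lin_comb G n (insert b B) = b [^] n b \<otimes> lin_comb G n B"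
    using insert by (intro G.finprod_insert) auto
  moreover have "f (b [^] n b \<otimes> lin_comb G n B) = f (b [^] n b) \<otimes>\<^bsub>H\<^esub> f (lin_comb G n B)"
    using insert hom by (intro hom_mult[OF hom]) (auto intro: G.lin_comb_closed)
  moreover have "f (b [^] n b) = f b [^]\<^bsub>H\<^esub> n b"
    using insert by (intro hom_int_pow[OF hom]) (auto simp: G.is_group H.is_group)
  moreover have "finprod H (\<lambda>b. f b [^]\<^bsub>H\<^esub> n b) (insert b B) =
      f b [^]\<^bsub>H\<^esub> n b \<otimes>\<^bsub>H\<^esub> finprod H (\<lambda>b. f b [^]\<^bsub>H\<^esub> n b) B"
    using insert by (intro H.finprod_insert) (auto intro!: H.int_pow_closed f_closed)
  ultimately show ?case using insert by simp
qed (use hom_one[OF hom] in \<open>auto simp: G.is_group H.is_group\<close>)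

text \<open>Applying \<open>f\<close> to a relation kills the part in \<open>K\<close> and leaves a
  relation on \<open>B\<close>, so the coefficients of the lifts vanish first and those on
  \<open>K\<close> afterwards.\<close>

lemma independent_lift:
  assumes K: "int_independent G K" "K \<subseteq> kernel G H f"
    and B: "int_independent H B" "B \<subseteq> f ` carrier G"
  obtains s where "\<forall>b\<in>B. s b \<in> carrier G \<and> f (s b) = b" "inj_on s B"
    "K \<inter> s ` B = {}" "int_independent G (K \<union> s ` B)"
proof -
  define s where "s = inv_into (carrier G) f"
  have s: "s b \<in> carrier G \<and> f (s b) = b" if "b \<in> B" for b
    using B(2) that by (auto simp: s_def inv_into_into f_inv_into_f subset_iff)
  have inj: "inj_on s B" using s by (intro inj_on_inverseI[of _ f]) simp
  have fin: "finite K" "finite B" "K \<subseteq> carrier G" "B \<subseteq> carrier H"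
    using K B by (auto simp: int_independent_def)
  have lift: "f (lin_comb G n (s ` B)) = lin_comb H (\<lambda>b. n (s b)) B" for n
  proof -
    have "f (lin_comb G n (s ` B)) = finprod H (\<lambda>b. f b [^]\<^bsub>H\<^esub> n b) (s ` B)"
      using s by (intro f_lin_comb) auto
    also have "\<dots> = finprod H (\<lambda>b. f (s b) [^]\<^bsub>H\<^esub> n (s b)) B"
      using s inj by (intro H.finprod_reindex) (auto intro!: H.int_pow_closed f_closed)
    also have "\<dots> = lin_comb H (\<lambda>b. n (s b)) B"
      using s fin by (intro H.finprod_cong') auto
    finally show ?thesis .
  qed
  \<comment> \<open>The identity satisfies a relation on its own. Hence no lift of an element of
    \<open>B\<close> lies in the kernel, which separates the lifts from \<open>K\<close>.\<close>
  have one_notin: "\<one>\<^bsub>H\<^esub> \<notin> B"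
  proof
    assume "\<one>\<^bsub>H\<^esub> \<in> B"
    moreover have "lin_comb H (\<lambda>b. if b = \<one>\<^bsub>H\<^esub> then 1 else 0) B = \<one>\<^bsub>H\<^esub>"
      by (intro H.finprod_one_eqI) auto
    ultimately show False using H.int_independentD[OF B(1)] by fastforce
  qed
  have disj: "K \<inter> s ` B = {}"
    using K(2) s one_notin by (force simp: kernel_def)
  have "int_independent G (K \<union> s ` B)"
    unfolding int_independent_def
  proof (intro conjI allI impI)
    show "finite (K \<union> s ` B)" "K \<union> s ` B \<subseteq> carrier G" using fin s by auto
    fix n :: "'a \<Rightarrow> int"
    assume "lin_comb G n (K \<union> s ` B) = \<one>"
    moreover have "lin_comb G n (K \<union> s ` B) = lin_comb G n K \<otimes> lin_comb G n (s ` B)"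
      using fin s disj by (intro G.finprod_Un_disjoint) auto
    ultimately have eq: "lin_comb G n K \<otimes> lin_comb G n (s ` B) = \<one>" by simp
    have cl: "lin_comb G n K \<in> carrier G" "lin_comb G n (s ` B) \<in> carrier G"
      using fin s by (auto intro!: G.lin_comb_closed)
    have "f (lin_comb G n K) = \<one>\<^bsub>H\<^esub>"
    proof -
      have "f (lin_comb G n K) = finprod H (\<lambda>b. f b [^]\<^bsub>H\<^esub> n b) K"
        by (rule f_lin_comb[OF fin(3)])
      also have "\<dots> = \<one>\<^bsub>H\<^esub>" using K(2) by (intro H.finprod_one_eqI) (auto simp: kernel_def)
      finally show ?thesis .
    qed
    moreover have "f (lin_comb G n K) \<otimes>\<^bsub>H\<^esub> f (lin_comb G n (s ` B)) = \<one>\<^bsub>H\<^esub>"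
      using hom_mult[OF hom cl] eq hom_one[OF hom] by (simp add: G.is_group H.is_group)
    ultimately have "lin_comb H (\<lambda>b. n (s b)) B = \<one>\<^bsub>H\<^esub>"
      using H.lin_comb_closed[OF fin(4)] by (simp add: lift)
    then have nB: "\<forall>b\<in>B. n (s b) = 0"
      using H.int_independentD[OF B(1), of "\<lambda>b. n (s b)"] by simp
    then have "lin_comb G n (s ` B) = \<one>" by (intro G.finprod_one_eqI) auto
    then have "lin_comb G n K = \<one>" using eq cl by simp
    then have "\<forall>b\<in>K. n b = 0" using G.int_independentD[OF K(1), of n] by simp
    then show "\<forall>b\<in>K \<union> s ` B. n b = 0" using nB by auto
  qed
  with s inj disj show ?thesis by (intro that[of s]) simp_all
qed

text \<open>Finiteness of the rank of \<open>G\<close> is part of the conclusion, as required for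
  the unknown middle term of an exact sequence. Maximal families of kernel and image together are
  independent; that they span up to multiples gives the upper bound.\<close>

lemma rank_nullity:
  assumes K: "rank_is G (kernel G H f) k" and I: "rank_is H (f ` carrier G) i"
  shows "full_rank G (k + i)"
proof -
  obtain K where K': "K \<subseteq> kernel G H f" "int_independent G K" "card K = k"
    and maxK: "\<And>B. B \<subseteq> kernel G H f \<Longrightarrow> int_independent G B \<Longrightarrow> card B \<le> k"
    using K unfolding rank_is_def by iprover
  obtain I where I': "I \<subseteq> f ` carrier G" "int_independent H I" "card I = i"
    and maxI: "\<And>B. B \<subseteq> f ` carrier G \<Longrightarrow> int_independent H B \<Longrightarrow> card B \<le> i"
    using I unfolding rank_is_def by iprover
  obtain s where s: "\<forall>b\<in>I. s b \<in> carrier G \<and> f (s b) = b" "inj_on s I"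
    "K \<inter> s ` I = {}" and ind: "int_independent G (K \<union> s ` I)"
    by (rule independent_lift[OF K'(2,1) I'(2,1)])
  have fin: "finite K" "finite I" "K \<subseteq> carrier G" "I \<subseteq> carrier H" "s ` I \<subseteq> carrier G"
    using K' I' s by (auto simp: int_independent_def)
  have card: "card (K \<union> s ` I) = k + i"
    using fin s K' I' by (simp add: card_Un_disjoint card_image)
  have "\<exists>N n. N \<noteq> (0::int) \<and> g [^] N = lin_comb G n (K \<union> s ` I)" if g: "g \<in> carrier G" for g
  proof -
    have "f g \<in> I" if *: "int_independent H (insert (f g) I)"
    proof (rule ccontr)
      assume "f g \<notin> I"
      then have "card (insert (f g) I) = Suc i" using fin I' by simp
      moreover have "card (insert (f g) I) \<le> i" using I' g by (intro maxI[OF _ *]) simp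
      ultimately show False by simp
    qed
    then obtain N n where N: "N \<noteq> (0::int)" "f g [^]\<^bsub>H\<^esub> N = lin_comb H n I"
      using H.maximal_independent_spans[OF I'(2) f_closed[OF g]] by iprover
    define m where "m = (\<lambda>b. n (f b))"
    \<comment> \<open>Removing the lift of the combination found for \<open>f g\<close> corrects the
      power of \<open>g\<close> into the kernel, where maximality of \<open>K\<close>
      applies.\<close>
    define h where "h = g [^] N \<otimes> inv (lin_comb G m (s ` I))"
    have cl: "g [^] N \<in> carrier G" "lin_comb G m (s ` I) \<in> carrier G"
      using g fin by (auto intro!: G.lin_comb_closed)
    have fm: "f (lin_comb G m (s ` I)) = lin_comb H n I"
    proof -
      have "f (lin_comb G m (s ` I)) = finprod H (\<lambda>b. f b [^]\<^bsub>H\<^esub> m b) (s ` I)"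
        using fin by (intro f_lin_comb) auto
      also have "\<dots> = finprod H (\<lambda>b. f (s b) [^]\<^bsub>H\<^esub> m (s b)) I"
        using s fin by (intro H.finprod_reindex) (auto intro!: H.int_pow_closed f_closed)
      also have "\<dots> = lin_comb H n I"
        using s fin by (intro H.finprod_cong') (auto simp: m_def)
      finally show ?thesis .
    qed
    have h: "h \<in> carrier G" using cl by (auto simp: h_def)
    have "f h = f (g [^] N) \<otimes>\<^bsub>H\<^esub> f (inv (lin_comb G m (s ` I)))"
      unfolding h_def using cl by (intro hom_mult[OF hom]) auto
    also have "f (inv (lin_comb G m (s ` I))) = inv\<^bsub>H\<^esub> (lin_comb H n I)"
      using fm f_inv[OF cl(2)] by simp
    also have "f (g [^] N) = lin_comb H n I"
      using N hom_int_pow[OF hom g G.is_group H.is_group] by simp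
    also have "lin_comb H n I \<otimes>\<^bsub>H\<^esub> inv\<^bsub>H\<^esub> (lin_comb H n I) = \<one>\<^bsub>H\<^esub>"
      using H.lin_comb_closed[OF fin(4)] by (simp add: H.r_inv)
    finally have hk: "h \<in> kernel G H f" using h by (simp add: kernel_def)
    have "h \<in> K" if *: "int_independent G (insert h K)"
    proof (rule ccontr)
      assume "h \<notin> K"
      then have "card (insert h K) = Suc k" using fin K' by simp
      moreover have "card (insert h K) \<le> k" using K' hk by (intro maxK[OF _ *]) simp
      ultimately show False by simp
    qed
    then obtain M l where M: "M \<noteq> (0::int)" "h [^] M = lin_comb G l K"
      using G.maximal_independent_spans[OF K'(2) h] by iprover
    \<comment> \<open>One exponent function for both families; it has the intended values on the
      lifts because they avoid \<open>K\<close>.\<close>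
    define q where "q b = (if b \<in> K then l b else m b * M)" for b
    have "g [^] N = h \<otimes> lin_comb G m (s ` I)"
      unfolding h_def using cl by (simp add: G.m_assoc)
    then have "g [^] (N * M) = (h \<otimes> lin_comb G m (s ` I)) [^] M"
      using g by (simp flip: G.int_pow_pow)
    also have "\<dots> = lin_comb G l K \<otimes> lin_comb G (\<lambda>b. m b * M) (s ` I)"
      using h cl M G.lin_comb_scale[OF fin(5)] by (simp add: G.int_pow_distrib)
    also have "lin_comb G l K = lin_comb G q K"
      using fin by (intro G.finprod_cong') (auto simp: q_def)
    also have "lin_comb G (\<lambda>b. m b * M) (s ` I) = lin_comb G q (s ` I)"
      using fin s(3) by (intro G.finprod_cong') (auto simp: q_def)
    also have "lin_comb G q K \<otimes> lin_comb G q (s ` I) = lin_comb G q (K \<union> s ` I)"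
      using fin s(3) by (intro G.finprod_Un_disjoint[symmetric]) auto
    finally show ?thesis using N M by (intro exI[of _ "N * M"] exI[of _ q]) auto
  qed
  note span = this
  have sub: "K \<union> s ` I \<subseteq> carrier G" using fin by auto
  have "card C \<le> k + i" if C: "int_independent G C" for C
  proof -
    have "C \<subseteq> carrier G" using C by (simp add: int_independent_def)
    then show ?thesis
      using G.int_independent_card_le[OF C _ sub span] fin card by auto
  qed
  then have "\<forall>C\<subseteq>carrier G. int_independent G C \<longrightarrow> card C \<le> k + i" by iprover
  moreover have "\<exists>B\<subseteq>carrier G. int_independent G B \<and> card B = k + i"
    using ind card sub by (intro exI[of _ "K \<union> s ` I"] conjI)
  ultimately show ?thesis
    unfolding rank_is_def by iprover
qed

text \<open>Independent families of the image lift, with empty kernel part, to families of the same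
  size in \<open>G\<close>.\<close>

lemma rank_image:
  assumes "full_rank G r"
  shows "\<exists>i. rank_is H (f ` carrier G) i"
proof -
  have "card B \<le> r" if B: "B \<subseteq> f ` carrier G" "int_independent H B" for B
  proof -
    obtain s where s: "inj_on s B" "int_independent G ({} \<union> s ` B)"
      by (rule independent_lift[OF int_independent_empty empty_subsetI B(2,1)])
    then have "s ` B \<subseteq> carrier G" by (simp add: int_independent_def)
    then have "card (s ` B) \<le> r" using assms s(2) by (simp add: rank_is_def)
    then show ?thesis using s(1) by (simp add: card_image)
  qed
  then have "\<exists>i\<le>r. rank_is H (f ` carrier G) i" by (rule bounded_imp_rank_is)
  then show ?thesis by iprover
qed

lemma rank_kernel_image:
  assumes "full_rank G r"
  shows "\<exists>k i. rank_is G (kernel G H f) k \<and> rank_is H (f ` carrier G) i \<and> r = k + i"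
proof -
  have "kernel G H f \<subseteq> carrier G" by (auto simp: kernel_def)
  then obtain k where k: "rank_is G (kernel G H f) k" using rank_is_subset[OF assms] by blast
  obtain i where i: "rank_is H (f ` carrier G) i" using rank_image[OF assms] by blast
  show ?thesis using k i rank_is_unique[OF assms rank_nullity[OF k i]] by blast
qed

end

lemma rank_is_singleton_one:
  assumes "comm_group G"
  shows "rank_is G {\<one>\<^bsub>G\<^esub>} 0"
proof -
  interpret comm_group G by fact
  have "B = {}" if B: "B \<subseteq> {\<one>\<^bsub>G\<^esub>}" "int_independent G B" for B
  proof (rule ccontr)
    assume "B \<noteq> {}"
    then have B1: "B = {\<one>\<^bsub>G\<^esub>}" using B by auto
    have "lin_comb G (\<lambda>b. 1) {\<one>\<^bsub>G\<^esub>} = \<one>\<^bsub>G\<^esub>" by (intro finprod_one_eqI) simp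
    then show False using int_independentD[OF B(2), of "\<lambda>_. 1" "\<one>\<^bsub>G\<^esub>"] B1 by simp
  qed
  then have "card B \<le> 0" if "B \<subseteq> {\<one>\<^bsub>G\<^esub>}" "int_independent G B" for B
    by (metis that card.empty order_refl)
  then have "\<exists>r\<le>0. rank_is G {\<one>\<^bsub>G\<^esub>} r" by (rule bounded_imp_rank_is)
  then show ?thesis by simp
qed

lemma rank_is_iso:
  assumes "comm_group G" "comm_group H" "G \<cong> H" "full_rank G r"
  shows "full_rank H r"
proof -
  obtain f where f: "f \<in> iso G H" using assms by (auto simp: is_iso_def)
  interpret comm_group_hom G H f
    by (intro comm_group_hom.intro comm_group_hom_axioms.intro assms(1,2)) (use f in \<open>simp add: iso_def\<close>)
  have bij: "inj_on f (carrier G)" "f ` carrier G = carrier H"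
    using f by (simp_all add: iso_def bij_betw_def)
  have one: "f \<one>\<^bsub>G\<^esub> = \<one>\<^bsub>H\<^esub>" using hom_one[OF hom G.is_group H.is_group] .
  have "x = \<one>\<^bsub>G\<^esub>" if "x \<in> carrier G" "f x = \<one>\<^bsub>H\<^esub>" for x
    using inj_onD[OF bij(1) _ that(1) G.one_closed] that(2) one by simp
  then have "kernel G H f = {\<one>\<^bsub>G\<^esub>}"
    using one G.one_closed by (auto simp: kernel_def)
  moreover obtain k i where "rank_is G (kernel G H f) k" and i: "rank_is H (f ` carrier G) i" "r = k + i"
    using rank_kernel_image[OF assms(4)] by blast
  ultimately have "k = 0"
    using rank_is_unique[OF _ rank_is_singleton_one[OF assms(1)]] by simp
  then show ?thesis using i bij(2) by simp
qed

section \<open>Additivity of the Euler characteristic\<close>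

abbreviation alt_sum :: "(nat \<Rightarrow> nat) \<Rightarrow> nat \<Rightarrow> int" where
  "alt_sum r M \<equiv> \<Sum>p<M. (-1) ^ p * int (r p)"

text \<open>In use \<open>a\<close>, \<open>b\<close>, \<open>c\<close> are the ranks of the
  homology of the subspace, the space and the pair, and \<open>g p\<close> is the rank of the
  connecting map out of degree \<open>p\<close> of the pair. The premise is then three rank formulas
  combined; the \<open>g\<close> terms of neighbouring degrees cancel.\<close>

lemma euler_sum_telescope:
  fixes a b c g :: "nat \<Rightarrow> nat"
  assumes "\<And>p. a p + c p = b p + g p + g (Suc p)"
  shows "alt_sum a M + alt_sum c M =
    alt_sum b M + int (g 0) - (-1) ^ M * int (g M)"
proof (induction M)
  case (Suc M)
  have "int (a M) + int (c M) = int (b M) + int (g M) + int (g (Suc M))"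
    using assms[of M] by linarith
  then have "(-1) ^ M * int (a M) + (-1) ^ M * int (c M) =
      (-1) ^ M * int (b M) + (-1) ^ M * int (g M) + (-1) ^ M * int (g (Suc M))"
    by (metis distrib_left)
  with Suc show ?case by simp
qed simp

text \<open>Rational homology of the pair \<open>(X, S)\<close> is finite, with alternating sum of dimensions \<open>e\<close>.\<close>

definition euler_is :: "'a topology \<Rightarrow> 'a set \<Rightarrow> int \<Rightarrow> bool" where
  "euler_is X S e \<longleftrightarrow> (\<exists>r N.
     (\<forall>p. full_rank (relative_homology_group (int p) X S) (r p)) \<and>
     (\<forall>p\<ge>N. r p = 0) \<and> e = alt_sum r N)"

lemma euler_isI:
  assumes "\<And>p. full_rank (relative_homology_group (int p) X S) (r p)"
    and "\<And>p. p \<ge> N \<Longrightarrow> r p = 0"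
  shows "euler_is X S (alt_sum r N)"
  unfolding euler_is_def using assms by (intro exI[of _ r] exI[of _ N]) simp

lemma sum_vanishing:
  fixes r :: "nat \<Rightarrow> nat"
  assumes "\<And>p. p \<ge> N \<Longrightarrow> r p = 0" "N \<le> M"
  shows "alt_sum r N = alt_sum r M"
  using assms by (intro sum.mono_neutral_left) auto

text \<open>The value is delivered for every later cut-off, so that two pairs can be compared at a
  common one.\<close>

lemma euler_isE:
  assumes "euler_is X S e"
  obtains r N where "\<forall>p. full_rank (relative_homology_group (int p) X S) (r p)"
    "\<forall>p\<ge>N. r p = 0" "\<forall>M\<ge>N. e = alt_sum r M"
proof -
  obtain r N where *: "\<forall>p. full_rank (relative_homology_group (int p) X S) (r p)"
    "\<forall>p\<ge>N. r p = 0" "e = alt_sum r N"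
    using assms unfolding euler_is_def by iprover
  moreover have "\<forall>M\<ge>N. e = alt_sum r M"
    using *(2) sum_vanishing[of N r] unfolding *(3) by simp
  ultimately show ?thesis by (intro that)
qed

lemma euler_is_iso:
  assumes "euler_is X S e"
    and iso: "\<And>p. relative_homology_group p X S \<cong> relative_homology_group p Y T"
  shows "euler_is Y T e"
proof -
  obtain r N where r: "\<forall>p. full_rank (relative_homology_group (int p) X S) (r p)"
    "\<forall>p\<ge>N. r p = 0" "\<forall>M\<ge>N. e = alt_sum r M"
    using assms(1) by (rule euler_isE)
  have "full_rank (relative_homology_group (int p) Y T) (r p)" for p
    using r(1) by (intro rank_is_iso[OF _ _ iso]) simp_all
  then have "euler_is Y T (alt_sum r N)"
    using r(2) by (intro euler_isI) simp_all
  then show ?thesis using r(3)[rule_format, of N] by simp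
qed

lemma euler_is_imp_euler_characteristic:
  assumes "euler_is X {} e"
  shows "has_euler_characteristic X \<and> euler_characteristic X = e"
proof -
  obtain r N where r: "\<forall>p. full_rank (homology_group (int p) X) (r p)"
    "\<forall>p\<ge>N. r p = 0" "\<forall>M\<ge>N. e = alt_sum r M"
    using assms by (rule euler_isE)
  have b: "has_finite_rank (homology_group (int p) X)" "betti_number p X = r p" for p
    using r(1)[rule_format, of p] by (simp_all add: rank_is_carrier_iff betti_number_def)
  have "p < N" if "r p \<noteq> 0" for p using r(2)[rule_format, of p] that by (cases "p < N") simp_all
  then have sub: "{p. r p \<noteq> 0} \<subseteq> {..<N}" by blast
  have "euler_characteristic X = alt_sum r N"
    unfolding euler_characteristic_def b(2) using sub by (intro sum.mono_neutral_left) auto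
  then show ?thesis
    using r(3)[rule_format, of N] finite_subset[OF sub] by (simp add: has_euler_characteristic_def b)
qed

subsection \<open>The long exact sequence of a pair\<close>

context
  fixes X :: "'a topology" and S :: "'a set"
begin

private abbreviation "HA p \<equiv> homology_group p (subtopology X S)"
private abbreviation "HX p \<equiv> homology_group p X"
private abbreviation "HP p \<equiv> relative_homology_group p X S"
private abbreviation "incl p \<equiv> hom_induced p (subtopology X S) {} X {} id"
private abbreviation "rel p \<equiv> hom_induced p X {} X S id"
private abbreviation "bd p \<equiv> hom_boundary p X S"

lemma exactness:
  "kernel (HA (p - 1)) (HX (p - 1)) (incl (p - 1)) = bd p ` carrier (HP p)"
  "kernel (HX p) (HP p) (rel p) = incl p ` carrier (HA p)"
  "kernel (HP p) (HA (p - 1)) (bd p) = rel p ` carrier (HX p)"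
  using homology_exactness_axiom_1[of p X S] homology_exactness_axiom_2[of p X S]
    homology_exactness_axiom_3[of p X S] by simp_all

lemma exactness_Suc:
  "kernel (HA p) (HX p) (incl p) = bd (p + 1) ` carrier (HP (p + 1))"
  using exactness(1)[of "p + 1"] by simp

lemma homs:
  "comm_group_hom (HA p) (HX p) (incl p)"
  "comm_group_hom (HX p) (HP p) (rel p)"
  "comm_group_hom (HP p) (HA (p - 1)) (bd p)"
  by (simp_all add: comm_group_hom_def comm_group_hom_axioms_def hom_induced_hom hom_boundary_hom)

text \<open>Homology in degree -1 is trivial, so the long exact sequence ends with
  \<open>g 0 = 0\<close> in the telescoping sum.\<close>

lemma boundary_0_rank: "rank_is (HA (-1)) (bd 0 ` carrier (HP 0)) 0"
proof -
  have "trivial_group (HA (-1))" by simp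
  then have triv: "carrier (HA (-1)) = {\<one>\<^bsub>HA (-1)\<^esub>}" by (simp add: trivial_group_def)
  interpret comm_group_hom "HP 0" "HA (-1)" "bd 0" using homs(3)[of 0] by simp
  have "bd 0 ` carrier (HP 0) \<subseteq> {\<one>\<^bsub>HA (-1)\<^esub>}" using f_closed triv by blast
  moreover have "carrier (HP 0) \<noteq> {}" using G.one_closed by blast
  ultimately have "bd 0 ` carrier (HP 0) = {\<one>\<^bsub>HA (-1)\<^esub>}" by blast
  then show ?thesis using rank_is_singleton_one[OF H.comm_group_axioms] by simp
qed

text \<open>Exactness identifies the kernel of the inclusion map in degree \<open>p\<close> with the
  image of the boundary from degree \<open>p + 1\<close>. Both additivity lemmas below share this
  half.\<close>

lemma ranks_incl:
  assumes a: "\<forall>p. full_rank (HA (int p)) (a p)"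
  obtains g' al where "\<forall>p. rank_is (HA (int p)) (bd (int p + 1) ` carrier (HP (int p + 1))) (g' p)"
    "\<forall>p. rank_is (HX (int p)) (incl (int p) ` carrier (HA (int p))) (al p)" "\<forall>p. a p = g' p + al p"
proof -
  have "\<forall>p. \<exists>g' al. rank_is (HA (int p)) (bd (int p + 1) ` carrier (HP (int p + 1))) g' \<and>
      rank_is (HX (int p)) (incl (int p) ` carrier (HA (int p))) al \<and> a p = g' + al"
    using comm_group_hom.rank_kernel_image[OF homs(1)] a exactness_Suc by simp
  then obtain g' al where "\<forall>p. rank_is (HA (int p)) (bd (int p + 1) ` carrier (HP (int p + 1))) (g' p) \<and>
      rank_is (HX (int p)) (incl (int p) ` carrier (HA (int p))) (al p) \<and> a p = g' p + al p" by metis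
  then show ?thesis by (intro that[of g' al]) simp_all
qed

text \<open>The unknown group is the middle one: by exactness its rank is that of the image of the
  inclusion plus that of its own image in the pair.\<close>

lemma euler_is_total:
  assumes A: "euler_is (subtopology X S) {} e1" and P: "euler_is X S e2"
  shows "euler_is X {} (e1 + e2)"
proof -
  obtain a N1 where a: "\<forall>p. full_rank (HA (int p)) (a p)"
    "\<forall>p\<ge>N1. a p = 0" "\<forall>M\<ge>N1. e1 = alt_sum a M"
    using A by (rule euler_isE)
  obtain c N2 where c: "\<forall>p. full_rank (HP (int p)) (c p)"
    "\<forall>p\<ge>N2. c p = 0" "\<forall>M\<ge>N2. e2 = alt_sum c M"
    using P by (rule euler_isE)
  obtain g' al where g': "\<forall>p. rank_is (HA (int p)) (bd (int p + 1) ` carrier (HP (int p + 1))) (g' p)"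
    and al: "\<forall>p. rank_is (HX (int p)) (incl (int p) ` carrier (HA (int p))) (al p)"
    and a_eq: "\<forall>p. a p = g' p + al p" using ranks_incl[OF a(1)] .
  have "\<forall>p. \<exists>be g. rank_is (HP (int p)) (rel (int p) ` carrier (HX (int p))) be \<and>
      rank_is (HA (int p - 1)) (bd (int p) ` carrier (HP (int p))) g \<and> c p = be + g"
    using comm_group_hom.rank_kernel_image[OF homs(3)] c(1) exactness(3) by simp
  then obtain be g where be: "\<forall>p. rank_is (HP (int p)) (rel (int p) ` carrier (HX (int p))) (be p)"
    and g: "\<forall>p. rank_is (HA (int p - 1)) (bd (int p) ` carrier (HP (int p))) (g p)"
    and c_eq: "\<forall>p. c p = be p + g p" by metis
  have g0: "g 0 = 0"
    using g[rule_format, of 0] boundary_0_rank rank_is_unique by fastforce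
  have gS: "g (Suc p) = g' p" for p
    using g[rule_format, of "Suc p"] g'[rule_format, of p] rank_is_unique
    by (simp add: add.commute) blast
  have b: "full_rank (HX (int p)) (al p + be p)" for p
    using comm_group_hom.rank_nullity[OF homs(2), of "int p" "al p" "be p"] al be exactness(2) by simp
  define M where "M = max N1 N2"
  have z: "a p = 0 \<and> c p = 0" if "p \<ge> M" for p using that a(2) c(2) by (simp add: M_def)
  have "euler_is X {} (\<Sum>p<M. (-1) ^ p * int (al p + be p))"
    using b
  proof (rule euler_isI)
    show "al p + be p = 0" if "p \<ge> M" for p using z[OF that] a_eq c_eq by simp
  qed
  moreover have "g M = 0" using z[of M] c_eq by simp
  then have "alt_sum a M + alt_sum c M =
      (\<Sum>p<M. (-1) ^ p * int (al p + be p))"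
    using euler_sum_telescope[of a c "\<lambda>p. al p + be p" g M] a_eq c_eq gS g0 by simp
  moreover have "e1 = alt_sum a M" "e2 = alt_sum c M"
    using a(3)[rule_format, of M] c(3)[rule_format, of M] by (simp_all add: M_def)
  ultimately show ?thesis by simp
qed

text \<open>Here the relative group is unknown: its rank is that of the image of \<open>HX\<close>
  plus that of the image of the boundary, which is the kernel of the inclusion one degree
  lower.\<close>

lemma euler_is_pair:
  assumes A: "euler_is (subtopology X S) {} e1" and X: "euler_is X {} e2"
  shows "euler_is X S (e2 - e1)"
proof -
  obtain a N1 where a: "\<forall>p. full_rank (HA (int p)) (a p)"
    "\<forall>p\<ge>N1. a p = 0" "\<forall>M\<ge>N1. e1 = alt_sum a M"
    using A by (rule euler_isE)
  obtain b N2 where b: "\<forall>p. full_rank (HX (int p)) (b p)"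
    "\<forall>p\<ge>N2. b p = 0" "\<forall>M\<ge>N2. e2 = alt_sum b M"
    using X by (rule euler_isE)
  obtain g' al where g': "\<forall>p. rank_is (HA (int p)) (bd (int p + 1) ` carrier (HP (int p + 1))) (g' p)"
    and al: "\<forall>p. rank_is (HX (int p)) (incl (int p) ` carrier (HA (int p))) (al p)"
    and a_eq: "\<forall>p. a p = g' p + al p" using ranks_incl[OF a(1)] .
  have "\<forall>p. \<exists>al' be. rank_is (HX (int p)) (incl (int p) ` carrier (HA (int p))) al' \<and>
      rank_is (HP (int p)) (rel (int p) ` carrier (HX (int p))) be \<and> b p = al' + be"
    using comm_group_hom.rank_kernel_image[OF homs(2)] b(1) exactness(2) by simp
  then obtain al' be where al': "\<forall>p. rank_is (HX (int p)) (incl (int p) ` carrier (HA (int p))) (al' p)"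
    and be: "\<forall>p. rank_is (HP (int p)) (rel (int p) ` carrier (HX (int p))) (be p)"
    and b_eq': "\<forall>p. b p = al' p + be p" by metis
  have "al' p = al p" for p using al al' rank_is_unique by blast
  then have b_eq: "\<forall>p. b p = al p + be p" using b_eq' by simp
  \<comment> \<open>Shifted by one degree, as the boundary lowers the degree; the value in degree 0
    comes from \<open>boundary_0_rank\<close>.\<close>
  define g where "g p = (case p of 0 \<Rightarrow> 0 | Suc q \<Rightarrow> g' q)" for p
  have g: "rank_is (HA (int p - 1)) (bd (int p) ` carrier (HP (int p))) (g p)" for p
    using g'[rule_format, of "p - 1"] boundary_0_rank by (cases p) (simp_all add: g_def add.commute)
  have c: "full_rank (HP (int p)) (be p + g p)" for p
    using comm_group_hom.rank_nullity[OF homs(3), of "int p" "be p" "g p"] g be exactness(3) by simp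
  \<comment> \<open>One more than the two bounds: relative homology may survive one degree above
    that of the subspace.\<close>
  define M where "M = Suc (max N1 N2)"
  have z: "a p = 0 \<and> b p = 0" if "p \<ge> M - 1" for p using that a(2) b(2) by (simp add: M_def)
  have gz: "g p = 0" if "p \<ge> M" for p
    using z[of "p - 1"] that a_eq by (cases p) (auto simp: g_def)
  have "euler_is X S (\<Sum>p<M. (-1) ^ p * int (be p + g p))"
    using c
  proof (rule euler_isI)
    show "be p + g p = 0" if "p \<ge> M" for p using z[of p] gz[OF that] that b_eq by simp
  qed
  moreover have "alt_sum a M + (\<Sum>p<M. (-1) ^ p * int (be p + g p)) =
      alt_sum b M"
    using euler_sum_telescope[of a "\<lambda>p. be p + g p" b g M] a_eq b_eq gz[of M] by (simp add: g_def)
  moreover have "e1 = alt_sum a M" "e2 = alt_sum b M"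
    using a(3)[rule_format, of M] b(3)[rule_format, of M] by (simp_all add: M_def)
  ultimately show ?thesis by (metis add_diff_cancel_left')
qed

end

section \<open>Spaces with known homology\<close>

lemma rank_integer_group: "rank_is integer_group (carrier integer_group) 1"
proof -
  interpret comm_group integer_group by (rule abelian_integer_group)
  have lc: "lin_comb integer_group n {1} = n 1" for n
    using finprod_insert[of "{}" 1 "\<lambda>b. b [^]\<^bsub>integer_group\<^esub> n b"] by simp
  have "int_independent integer_group {1}"
    by (simp add: int_independent_def lc)
  moreover have "card B \<le> card {1::int}" if "int_independent integer_group B" for B
    using that
  proof (rule int_independent_card_le)
    fix c :: int
    show "\<exists>N n. N \<noteq> (0::int) \<and> c [^]\<^bsub>integer_group\<^esub> N = lin_comb integer_group n {1}"
      by (intro exI[of _ 1] exI[of _ "\<lambda>_. c"]) (simp add: lc)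
  qed auto
  ultimately show ?thesis
    unfolding rank_is_def by (intro conjI exI[of _ "{1}"]) auto
qed

lemma rank_trivial_group:
  assumes "comm_group G" "trivial_group G"
  shows "full_rank G 0"
  using rank_is_singleton_one[OF assms(1)] assms(2) by (simp add: trivial_group_def)

lemma euler_is_empty:
  assumes "topspace X = {}"
  shows "euler_is X {} 0"
proof -
  have "full_rank (homology_group (int p) X) 0" for p
    by (intro rank_trivial_group trivial_homology_group_empty[OF assms] abelian_homology_group)
  then have "euler_is X {} (\<Sum>p<0. (-1) ^ p * int 0)" by (rule euler_isI) simp
  then show ?thesis by simp
qed

lemma euler_is_contractible:
  assumes "contractible_space X" "topspace X \<noteq> {}"
  shows "euler_is X {} 1"
proof -
  have "homology_group 0 X \<cong> integer_group"
    using assms by (intro isomorphic_integer_zeroth_homology_group contractible_imp_path_connected_space)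
  then have "integer_group \<cong> homology_group 0 X"
    by (rule group.iso_sym[OF group_relative_homology_group])
  then have 0: "rank_is (homology_group 0 X) (carrier (homology_group 0 X)) 1"
    by (rule rank_is_iso[OF abelian_integer_group abelian_homology_group _ rank_integer_group])
  have "full_rank (homology_group (int p) X) 0" if "p \<noteq> 0" for p
  proof (rule rank_trivial_group)
    show "trivial_group (homology_group (int p) X)"
      using trivial_reduced_homology_group_contractible_space[OF assms(1), of "int p"] that
      by (simp add: un_reduced_homology_group)
  qed simp
  with 0 have "full_rank (homology_group (int p) X) (if p = 0 then 1 else 0)" for p
    by simp
  then have "euler_is X {} (\<Sum>p<1. (-1) ^ p * int (if p = 0 then 1 else 0))"
    by (rule euler_isI) simp
  then show ?thesis by simp
qed

section \<open>Regular cell complexes of simplices\<close>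

text \<open>Coordinates off \<open>I\<close> are 0 and not undefined, so that the simplex on a
  subset of \<open>I\<close> is literally a subset: passing to a face does not change the
  function.\<close>

definition bary_simplex :: "'c set \<Rightarrow> ('c \<Rightarrow> real) set" where
  "bary_simplex I = {t. (\<forall>i. 0 \<le> t i) \<and> (\<forall>i. i \<notin> I \<longrightarrow> t i = 0) \<and> sum t I = 1}"

lemma bary_simplex_mono:
  assumes "I \<subseteq> J" "finite J"
  shows "bary_simplex I \<subseteq> bary_simplex J"
proof
  fix t assume t: "t \<in> bary_simplex I"
  then have "sum t I = sum t J"
    using assms by (intro sum.mono_neutral_left) (auto simp: bary_simplex_def)
  with t assms show "t \<in> bary_simplex J" by (auto simp: bary_simplex_def)
qed

lemma continuous_map_Min_image:
  assumes "finite I" "I \<noteq> {}" "\<And>i. i \<in> I \<Longrightarrow> continuous_map X euclideanreal (f i)"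
  shows "continuous_map X euclideanreal (\<lambda>x. Min ((\<lambda>i. f i x) ` I))"
  using assms
proof (induction I rule: finite_ne_induct)
  case (insert i I)
  then have "(\<lambda>x. Min ((\<lambda>j. f j x) ` insert i I)) = (\<lambda>x. min (f i x) (Min ((\<lambda>j. f j x) ` I)))"
    by auto
  with insert show ?case by (auto intro!: continuous_map_real_min)
qed simp

lemma continuous_on_Min_image:
  fixes f :: "'i \<Rightarrow> 'a::topological_space \<Rightarrow> real"
  assumes "finite I" "I \<noteq> {}" "\<And>i. i \<in> I \<Longrightarrow> continuous_on S (f i)"
  shows "continuous_on S (\<lambda>x. Min ((\<lambda>i. f i x) ` I))"
  using continuous_map_Min_image[of I "top_of_set S" f] assms by simp

lemma sum_Pow_alternating:
  assumes "finite A" "A \<noteq> {}"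
  shows "(\<Sum>J\<in>Pow A. (-1) ^ card J) = (0::int)"
  using assms
proof (induction A rule: finite_ne_induct)
  case (insert a A)
  have "(\<Sum>J\<in>Pow (insert a A). (-1) ^ card J) =
      (\<Sum>J\<in>Pow A. (-1) ^ card J) + (\<Sum>J\<in>insert a ` Pow A. (-1::int) ^ card J)"
    unfolding Pow_insert using insert by (intro sum.union_disjoint) auto
  also have "(\<Sum>J\<in>insert a ` Pow A. (-1::int) ^ card J) = (\<Sum>J\<in>Pow A. (-1) ^ card (insert a J))"
    using insert by (intro sum.reindex_cong[of "insert a"]) (auto simp: inj_on_def)
  also have "\<dots> = (\<Sum>J\<in>Pow A. (-1) * (-1) ^ card J)"
  proof (rule sum.cong[OF refl])
    fix J assume "J \<in> Pow A"
    then have "finite J" "a \<notin> J" using insert finite_subset by auto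
    then show "(-1::int) ^ card (insert a J) = (-1) * (-1) ^ card J" by simp
  qed
  also have "\<dots> = - (\<Sum>J\<in>Pow A. (-1) ^ card J)" by (simp add: sum_negf)
  finally show ?case by simp
qed (simp add: Pow_insert)

text \<open>A finite coloured simplicial poset without its least element: the faces of a cell
  correspond to the non-empty subsets of its colours through \<open>restr\<close>. Several cells may
  have the same colours, so it need not be a simplicial complex.\<close>

locale simplex_complex =
  fixes P :: "'d set" and col :: "'d \<Rightarrow> 'c set" and restr :: "'d \<Rightarrow> 'c set \<Rightarrow> 'd"
  assumes fin_P: "finite P"
    and fin_col: "d \<in> P \<Longrightarrow> finite (col d)"
    and col_ne: "d \<in> P \<Longrightarrow> col d \<noteq> {}"
    and restr_in: "d \<in> P \<Longrightarrow> J \<subseteq> col d \<Longrightarrow> J \<noteq> {} \<Longrightarrow> restr d J \<in> P"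
    and col_restr: "d \<in> P \<Longrightarrow> J \<subseteq> col d \<Longrightarrow> J \<noteq> {} \<Longrightarrow> col (restr d J) = J"
    and restr_col: "d \<in> P \<Longrightarrow> restr d (col d) = d"
    and restr_restr: "d \<in> P \<Longrightarrow> J \<subseteq> col d \<Longrightarrow> K \<subseteq> J \<Longrightarrow> K \<noteq> {} \<Longrightarrow>
      restr (restr d J) K = restr d K"
begin

definition face :: "'d \<Rightarrow> 'd \<Rightarrow> bool" where
  "face b d \<longleftrightarrow> b \<in> P \<and> d \<in> P \<and> col b \<subseteq> col d \<and> restr d (col b) = b"

text \<open>The coordinate of a point at a cell \<open>b\<close> is positive exactly on the open star of \<open>b\<close>.\<close>

definition point :: "'d \<Rightarrow> ('c \<Rightarrow> real) \<Rightarrow> 'd \<Rightarrow> real" where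
  "point d t = (\<lambda>b. if face b d then Min (t ` col b) else 0)"

definition space :: "'d set \<Rightarrow> ('d \<Rightarrow> real) set" where
  "space L = (\<Union>d\<in>L. point d ` bary_simplex (col d))"

definition down_closed :: "'d set \<Rightarrow> bool" where
  "down_closed L \<longleftrightarrow> L \<subseteq> P \<and> (\<forall>d\<in>L. \<forall>b. face b d \<longrightarrow> b \<in> L)"

definition faces :: "'d \<Rightarrow> 'd set" where
  "faces d = {b. face b d}"

lemma face_refl: "d \<in> P \<Longrightarrow> face d d"
  by (simp add: face_def restr_col)

lemma face_restr: "d \<in> P \<Longrightarrow> J \<subseteq> col d \<Longrightarrow> J \<noteq> {} \<Longrightarrow> face (restr d J) d"
  by (simp add: face_def restr_in col_restr)

lemma face_trans:
  assumes "face \<rho> b" "face b d"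
  shows "face \<rho> d"
proof -
  have "restr (restr d (col b)) (col \<rho>) = restr d (col \<rho>)"
    using assms by (intro restr_restr) (auto simp: face_def col_ne)
  with assms show ?thesis unfolding face_def by fastforce
qed

lemma face_antisym: "face b d \<Longrightarrow> face d b \<Longrightarrow> b = d"
  by (metis face_def restr_col subset_antisym)

lemma down_closed_faces: "down_closed (faces d)"
proof -
  have "faces d \<subseteq> P" by (auto simp: faces_def face_def)
  then show ?thesis
    unfolding down_closed_def faces_def by (blast intro: face_trans)
qed

text \<open>This is the gluing rule. If the coordinates outside \<open>J\<close> vanish, so does
  every minimum over a set not inside \<open>J\<close>; the remaining faces are those of
  \<open>restr d J\<close>.\<close>

lemma point_restr:
  assumes "d \<in> P" "J \<subseteq> col d" "t \<in> bary_simplex J"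
  shows "point d t = point (restr d J) t"
proof
  fix b
  have J: "J \<noteq> {}" using assms(3) by (auto simp: bary_simplex_def)
  have 1: "face b (restr d J) \<longleftrightarrow> face b d \<and> col b \<subseteq> J"
    unfolding face_def using assms J restr_restr[OF assms(1,2), of "col b"]
    by (auto simp: restr_in col_restr col_ne)
  have 2: "Min (t ` col b) = 0" if b: "face b d" "\<not> col b \<subseteq> J"
  proof -
    obtain i where i: "i \<in> col b" "i \<notin> J" using b by auto
    have "finite (col b)" using b by (simp add: face_def fin_col)
    moreover have "t i = 0" "\<forall>i. 0 \<le> t i" using i assms(3) by (auto simp: bary_simplex_def)
    ultimately show ?thesis using i by (intro Min_eqI) force+
  qed
  show "point d t b = point (restr d J) t b"
    using 1 2 by (auto simp: point_def)
qed

lemma space_faces: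
  assumes "d \<in> P"
  shows "space (faces d) = point d ` bary_simplex (col d)"
proof (intro equalityI subsetI)
  fix y assume "y \<in> space (faces d)"
  then obtain b t where b: "face b d" "t \<in> bary_simplex (col b)" "y = point b t"
    by (auto simp: space_def faces_def)
  then have "y = point d t" using point_restr[OF assms, of "col b" t] by (simp add: face_def)
  moreover have "t \<in> bary_simplex (col d)"
    using b bary_simplex_mono[of "col b" "col d"] fin_col[OF assms] by (auto simp: face_def)
  ultimately show "y \<in> point d ` bary_simplex (col d)" by blast
next
  fix y assume "y \<in> point d ` bary_simplex (col d)"
  then show "y \<in> space (faces d)"
    using face_refl[OF assms] by (auto simp: space_def faces_def)
qed

text \<open>The cell is cut down to the face spanned by the non-zero coordinates of the point, in
  whose interior the point lies.\<close>

lemma space_open_cell: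
  assumes L: "down_closed L" and y: "y \<in> space L"
  obtains d t where "d \<in> L" "t \<in> bary_simplex (col d)" "\<forall>i\<in>col d. 0 < t i" "y = point d t"
proof -
  obtain d t where d: "d \<in> L" "t \<in> bary_simplex (col d)" "y = point d t"
    using y by (auto simp: space_def)
  then have P: "d \<in> P" using L by (auto simp: down_closed_def)
  define J where "J = {i\<in>col d. t i \<noteq> 0}"
  have "sum t J = sum t (col d)"
    unfolding J_def using fin_col[OF P] by (intro sum.mono_neutral_left) auto
  then have sum: "sum t J = 1" using d(2) by (simp add: bary_simplex_def)
  then have "J \<noteq> {}" by auto
  then have J: "J \<noteq> {}" "J \<subseteq> col d" by (auto simp: J_def)
  have t: "t \<in> bary_simplex J" using d(2) sum by (auto simp: bary_simplex_def J_def)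
  have "restr d J \<in> L"
    using L d(1) face_restr[OF P J(2,1)] by (auto simp: down_closed_def)
  moreover have "\<forall>i\<in>J. 0 < t i" using t by (auto simp: bary_simplex_def J_def less_le)
  ultimately show ?thesis
    using that[of "restr d J" t] t d(3) point_restr[OF P J(2) t] by (simp add: col_restr[OF P J(2,1)])
qed

lemma point_pos:
  assumes "face b d" "\<forall>i\<in>col d. 0 < t i"
  shows "0 < point d t b"
  using assms fin_col[of b] col_ne[of b] by (auto simp: point_def face_def)

lemma point_pos_imp_face: "0 < point d t b \<Longrightarrow> face b d"
  by (auto simp: point_def split: if_splits)

lemma point_nonneg:
  assumes "t \<in> bary_simplex I"
  shows "0 \<le> point d t b"
  using assms fin_col[of b] col_ne[of b] by (auto simp: point_def face_def bary_simplex_def)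

lemma space_nonneg: "y \<in> space L \<Longrightarrow> 0 \<le> y b"
  by (auto simp: space_def intro: point_nonneg)

lemma point_vertex:
  assumes "d \<in> P" "i \<in> col d"
  shows "point d t (restr d {i}) = t i"
  using assms face_restr[of d "{i}"] by (simp add: point_def col_restr)

text \<open>Open cells are embedded and disjoint: the positive coordinates of an interior point are
  indexed by the faces of its cell, so two such cells are faces of each other, and the vertex
  coordinates return the barycentric ones.\<close>

lemma point_eq_imp_eq:
  assumes d: "d \<in> P" "t \<in> bary_simplex (col d)" "\<forall>i\<in>col d. 0 < t i"
    and b: "b \<in> P" "u \<in> bary_simplex (col b)" "\<forall>i\<in>col b. 0 < u i"
    and eq: "point d t = point b u"
  shows "d = b \<and> t = u"
proof -
  have "face d b" "face b d"
    using point_pos[OF face_refl[OF d(1)] d(3)] point_pos[OF face_refl[OF b(1)] b(3)]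
    by (auto simp: eq intro: point_pos_imp_face) (auto simp flip: eq intro: point_pos_imp_face)
  then have st: "d = b" by (rule face_antisym)
  have "t i = u i" for i
  proof (cases "i \<in> col d")
    case True
    then show ?thesis using point_vertex[OF d(1) True] eq st by metis
  next
    case False
    then show ?thesis using d(2) b(2) st by (simp add: bary_simplex_def)
  qed
  then show ?thesis using st by auto
qed

text \<open>A subcomplex is cut out by equations because a point is positive at the cell whose
  interior contains it. Closedness follows from this.\<close>

lemma space_subcomplex:
  assumes L: "down_closed L" and M: "down_closed M" and sub: "L \<subseteq> M"
  shows "space L = {y \<in> space M. \<forall>b\<in>M - L. y b = 0}"
proof (intro equalityI subsetI CollectI conjI ballI)
  fix y assume y: "y \<in> space L"
  then show "y \<in> space M" using sub by (auto simp: space_def)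
  fix b assume b: "b \<in> M - L"
  obtain d t where "d \<in> L" "y = point d t" using y by (auto simp: space_def)
  then show "y b = 0" using b L by (auto simp: point_def down_closed_def)
next
  fix y assume y: "y \<in> {y \<in> space M. \<forall>b\<in>M - L. y b = 0}"
  then obtain d t where d: "d \<in> M" "t \<in> bary_simplex (col d)" "\<forall>i\<in>col d. 0 < t i" "y = point d t"
    using space_open_cell[OF M, of y] by auto
  have "0 < y d" using point_pos[OF face_refl d(3)] d M by (auto simp: down_closed_def)
  then have "d \<in> L" using y d(1) by force
  then show "y \<in> space L" using d by (auto simp: space_def)
qed

lemma closedin_space:
  assumes "down_closed L" "down_closed M" "L \<subseteq> M"
  shows "closedin (top_of_set (space M)) (space L)"
proof -
  have "closed (\<Inter>b\<in>M - L. {y::'d \<Rightarrow> real. y b = 0})"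
    by (intro closed_INT ballI closed_Collect_eq continuous_on_product_coordinates continuous_on_const)
  moreover have "space L = space M \<inter> (\<Inter>b\<in>M - L. {y. y b = 0})"
    using space_subcomplex[OF assms] by auto
  ultimately show ?thesis by (metis closedin_closed_Int)
qed

text \<open>The straight-line contraction to the barycentre. It is continuous because barycentric
  coordinates are among the ambient ones: \<open>y (restr d {i})\<close> is the one at
  \<open>i\<close>.\<close>

lemma contractible_faces:
  assumes P: "d \<in> P"
  shows "contractible (space (faces d))"
proof -
  let ?S = "space (faces d)" and ?k = "real (card (col d))"
  define u where "u = (\<lambda>(s, y) i. if i \<in> col d then (1 - s) * y (restr d {i}) + s / ?k else 0)"
  define h where "h = (\<lambda>z. point d (u z))"
  have k: "?k > 0" using fin_col[OF P] col_ne[OF P] by (simp add: card_gt_0_iff)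
  have u_point: "u (s, point d t) = (\<lambda>i. if i \<in> col d then (1 - s) * t i + s / ?k else 0)" for s t
    by (auto simp: u_def point_vertex[OF P])
  have u_in: "u (s, y) \<in> bary_simplex (col d)" if s: "s \<in> {0..1}" and y: "y \<in> ?S" for s y
  proof -
    obtain t where t: "t \<in> bary_simplex (col d)" "y = point d t"
      using y space_faces[OF P] by auto
    have "(\<Sum>i\<in>col d. (1 - s) * t i + s / ?k) = 1"
      using t(1) k by (simp add: sum.distrib bary_simplex_def flip: sum_distrib_left)
    then show ?thesis
      using t s k by (auto simp: u_point bary_simplex_def)
  qed
  have "continuous_on ({0..1} \<times> ?S) h"
  proof (rule continuous_on_coordinatewise_then_product)
    fix b
    show "continuous_on ({0..1} \<times> ?S) (\<lambda>z. h z b)"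
    proof (cases "face b d")
      case True
      have "continuous_on ({0..1} \<times> ?S) (\<lambda>z. u z i)" if "i \<in> col b" for i
      proof -
        have "i \<in> col d" using that True by (auto simp: face_def)
        then have eq: "(\<lambda>z. u z i) = (\<lambda>z. (1 - fst z) * snd z (restr d {i}) + fst z / ?k)"
          by (auto simp: u_def)
        have "continuous_on ({0..1} \<times> ?S) (\<lambda>z. snd z (restr d {i}))"
          by (rule continuous_on_product_then_coordinatewise[OF continuous_on_snd[OF continuous_on_id]])
        then show ?thesis unfolding eq using k by (intro continuous_intros) auto
      qed
      then have "continuous_on ({0..1} \<times> ?S) (\<lambda>z. Min ((\<lambda>i. u z i) ` col b))"
        using True by (intro continuous_on_Min_image) (auto simp: face_def fin_col col_ne)
      then show ?thesis using True by (simp add: h_def point_def)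
    qed (simp add: h_def point_def)
  qed
  moreover have "h ` ({0..1} \<times> ?S) \<subseteq> ?S"
    using u_in space_faces[OF P] by (auto simp: h_def)
  moreover have "h (0, y) = y" if y: "y \<in> ?S" for y
  proof -
    obtain t where t: "t \<in> bary_simplex (col d)" "y = point d t"
      using y space_faces[OF P] by auto
    then have "u (0, y) = t" by (auto simp: u_point bary_simplex_def)
    then show ?thesis by (simp add: h_def t)
  qed
  moreover have "h (1, y) = point d (\<lambda>i. if i \<in> col d then 1 / ?k else 0)" for y
    by (simp add: h_def u_def cong: if_cong)
  ultimately have "homotopic_with_canon (\<lambda>_. True) ?S ?S id (\<lambda>_. point d (\<lambda>i. if i \<in> col d then 1 / ?k else 0))"
    by (subst homotopic_with) (auto intro!: exI[of _ h])
  then show ?thesis unfolding contractible_def by blast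
qed

text \<open>The smallest of \<open>card (col d)\<close> barycentric coordinates is at most the
  reciprocal of that number, with equality only at the barycentre. For a top cell this is thus
  \<open>space L\<close> without one point, and open in it.\<close>

definition near_boundary :: "'d \<Rightarrow> 'd set \<Rightarrow> ('d \<Rightarrow> real) set" where
  "near_boundary d L = {y \<in> space L. real (card (col d)) * y d < 1}"

section \<open>Removing a top cell\<close>

context
  fixes L d
  assumes L: "down_closed L" and d: "d \<in> L" and top: "\<forall>b\<in>L. face d b \<longrightarrow> b = d"
begin

lemma top_in_P: "d \<in> P"
  using L d by (auto simp: down_closed_def)

lemma down_closed_remove: "down_closed (L - {d})"
  using L top by (auto simp: down_closed_def)

lemma space_remove: "space (L - {d}) = {y \<in> space L. y d = 0}"
proof -
  have "L - (L - {d}) = {d}" using d by auto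
  then show ?thesis using space_subcomplex[OF down_closed_remove L] by auto
qed

lemma open_top_cell:
  assumes "y \<in> space L" "y d \<noteq> 0"
  obtains t where "t \<in> bary_simplex (col d)" "\<forall>i\<in>col d. 0 < t i" "y = point d t"
proof -
  obtain b t where t: "b \<in> L" "t \<in> bary_simplex (col b)" "\<forall>i\<in>col b. 0 < t i" "y = point b t"
    using space_open_cell[OF L assms(1)] by blast
  then have "face d b" using assms(2) by (auto simp: point_def split: if_splits)
  then have "b = d" using top t(1) by blast
  then show ?thesis using that t by blast
qed

text \<open>Radial projection of the open top cell away from its barycentre. Subtracting the same
  multiple of the smallest barycentric coordinate from all of them is linear in the
  coordinates \<open>y b\<close>.\<close>

definition push :: "real \<times> ('d \<Rightarrow> real) \<Rightarrow> 'd \<Rightarrow> real" where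
  "push = (\<lambda>(s, y) b. (y b - (if face b d then s * y d else 0)) / (1 - s * (real (card (col d)) * y d)))"

lemma push_denominator:
  assumes "s \<in> {0..1}" "y \<in> near_boundary d L"
  shows "0 < 1 - s * (real (card (col d)) * y d)"
proof -
  have "0 \<le> real (card (col d)) * y d" "real (card (col d)) * y d < 1"
    using assms space_nonneg[of y L d] by (auto simp: near_boundary_def)
  then have "s * (real (card (col d)) * y d) < 1"
    using assms(1) mult_left_le_one_le[of "real (card (col d)) * y d" s] by auto
  then show ?thesis by simp
qed

lemma push_fixed: "y d = 0 \<Longrightarrow> push (s, y) = y"
  by (auto simp: push_def)

lemma push_0: "push (0, y) = y"
  by (auto simp: push_def)

lemma push_in:
  assumes s: "s \<in> {0..1}" and y: "y \<in> near_boundary d L"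
  shows "push (s, y) \<in> space L"
proof (cases "y d = 0")
  case True
  then show ?thesis using y by (simp add: push_fixed near_boundary_def)
next
  case False
  have yL: "y \<in> space L" using y by (simp add: near_boundary_def)
  obtain t where t: "t \<in> bary_simplex (col d)" "\<forall>i\<in>col d. 0 < t i" "y = point d t"
    using open_top_cell[OF yL False] by blast
  let ?k = "real (card (col d))"
  define D where "D = 1 - s * (?k * y d)"
  have D: "D > 0" using push_denominator[OF s y] by (simp add: D_def)
  have m: "y d = Min (t ` col d)" using t(3) face_refl[OF top_in_P] by (simp add: point_def)
  note fin = fin_col[OF top_in_P] col_ne[OF top_in_P]
  have le: "s * y d \<le> t i" if "i \<in> col d" for i
  proof -
    have "s * y d \<le> y d" using s space_nonneg[OF yL, of d] by (simp add: mult_left_le_one_le)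
    also have "\<dots> \<le> t i" unfolding m using fin that by simp
    finally show ?thesis .
  qed
  \<comment> \<open>\<open>D\<close> is the sum of the lowered coordinates
    \<open>t i - s * y d\<close>, so dividing by it returns to the simplex.\<close>
  define u where "u i = (if i \<in> col d then (t i - s * y d) / D else 0)" for i
  have "(\<Sum>i\<in>col d. (t i - s * y d) / D) = ((\<Sum>i\<in>col d. t i) - ?k * (s * y d)) / D"
    by (simp add: sum_subtractf flip: sum_divide_distrib)
  also have "\<dots> = 1" using t(1) D by (simp add: bary_simplex_def D_def algebra_simps)
  finally have "u \<in> bary_simplex (col d)"
    using le D by (auto simp: bary_simplex_def u_def)
  moreover have "push (s, y) = point d u"
  proof
    fix b
    show "push (s, y) b = point d u b"
    proof (cases "face b d")
      case True
      then have b: "finite (col b)" "col b \<noteq> {}" "col b \<subseteq> col d"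
        by (auto simp: face_def fin_col col_ne)
      have "u ` col b = (\<lambda>x. (x - s * y d) / D) ` t ` col b"
        using b by (auto simp: u_def image_image)
      \<comment> \<open>An increasing affine map commutes with \<open>Min\<close>, so the formula
        for \<open>push\<close> is right at every face and not only at the vertices.\<close>
      moreover have "mono (\<lambda>x. (x - s * y d) / D)"
        using D by (auto intro!: monoI divide_right_mono)
      ultimately have "Min (u ` col b) = (Min (t ` col b) - s * y d) / D"
        using mono_Min_commute[of "\<lambda>x. (x - s * y d) / D" "t ` col b"] b by simp
      moreover have "y b = Min (t ` col b)" using True t(3) by (simp add: point_def)
      ultimately show ?thesis using True by (simp add: push_def D_def point_def)
    next
      case False
      then have "y b = 0" using t(3) by (simp add: point_def)
      then show ?thesis using False by (simp add: push_def point_def)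
    qed
  qed
  ultimately show ?thesis using d by (auto simp: space_def)
qed

lemma push_top: "push (s, y) d = (1 - s) * y d / (1 - s * (real (card (col d)) * y d))"
  using face_refl[OF top_in_P] by (simp add: push_def algebra_simps)

lemma push_near:
  assumes s: "s \<in> {0..1}" and y: "y \<in> near_boundary d L"
  shows "push (s, y) \<in> near_boundary d L"
proof -
  let ?m = "real (card (col d)) * y d"
  have "?m < 1" using y by (simp add: near_boundary_def)
  then have "(1 - s) * ?m < 1 - s * ?m" by (simp add: algebra_simps)
  then have "(1 - s) * ?m / (1 - s * ?m) < 1"
    using push_denominator[OF s y] by simp
  then show ?thesis using push_in[OF s y] by (simp add: near_boundary_def push_top mult.left_commute)
qed

lemma push_1: "y \<in> near_boundary d L \<Longrightarrow> push (1, y) \<in> space (L - {d})"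
  using push_in[of 1 y] by (simp add: space_remove push_top)

lemma push_continuous: "continuous_on ({0..1} \<times> near_boundary d L) push"
proof (rule continuous_on_coordinatewise_then_product)
  fix b
  have eq: "(\<lambda>z. push z b) = (\<lambda>z. (snd z b - (if face b d then fst z * snd z d else 0)) /
      (1 - fst z * (real (card (col d)) * snd z d)))"
    by (auto simp: push_def)
  have c: "continuous_on ({0..1} \<times> near_boundary d L) (\<lambda>z::real \<times> ('d \<Rightarrow> real). snd z \<rho>)" for \<rho>
    by (rule continuous_on_product_then_coordinatewise[OF continuous_on_snd[OF continuous_on_id]])
  have nz: "\<forall>z\<in>{0..1} \<times> near_boundary d L. 1 - fst z * (real (card (col d)) * snd z d) \<noteq> 0"
    using push_denominator by (auto simp: less_le)
  show "continuous_on ({0..1} \<times> near_boundary d L) (\<lambda>z. push z b)"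
    unfolding eq by (cases "face b d") (auto intro!: continuous_intros c nz[rule_format])
qed

lemma space_remove_subset: "space (L - {d}) \<subseteq> near_boundary d L"
  by (auto simp: space_remove near_boundary_def)

text \<open>At time 1 the coordinate at \<open>d\<close> becomes 0, that is, the point has reached
  the remaining cells; points already there stay fixed throughout.\<close>

lemma near_boundary_homology:
  "homology_group p (top_of_set (near_boundary d L)) \<cong> homology_group p (top_of_set (space (L - {d})))"
proof (rule deformation_retract_imp_isomorphic_homology_groups)
  let ?V = "near_boundary d L"
  have slice: "continuous_on ?V (\<lambda>y. push (1, y))"
    by (rule continuous_on_compose2[OF push_continuous, of ?V "\<lambda>y. (1, y)"]) (auto intro!: continuous_intros)
  show "retraction_maps (top_of_set ?V) (top_of_set (space (L - {d}))) (\<lambda>y. push (1, y)) id"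
    using slice push_1 space_remove_subset
    by (auto simp: retraction_maps_def push_fixed space_remove image_subset_iff)
  have "homotopic_with_canon (\<lambda>_. True) ?V ?V id (\<lambda>y. push (1, y))"
    using push_continuous push_near
    by (subst homotopic_with) (auto simp: push_0 intro!: exI[of _ push])
  then show "homotopic_with_canon (\<lambda>_. True) ?V ?V (\<lambda>y. push (1, y)) id"
    by (rule homotopic_with_symD)
qed

text \<open>The excised set is everything outside the closed cell \<open>d\<close>. Its closure
  stays in the closed set \<open>space (L - {d})\<close>, which lies inside the open set
  \<open>near_boundary d L\<close>; excision needs this slack, hence the thickening.\<close>

lemma excise_top_cell:
  "relative_homology_group p (top_of_set (space (faces d))) (near_boundary d (faces d)) \<cong>
    relative_homology_group p (top_of_set (space L)) (near_boundary d L)"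
proof -
  let ?X = "top_of_set (space L)" and ?U = "space L - space (faces d)" and ?V = "near_boundary d L"
  have "faces d \<subseteq> L" using L d by (auto simp: faces_def down_closed_def)
  then have sub: "space (faces d) \<subseteq> space L" by (auto simp: space_def)
  have "y d = 0" if "y \<in> ?U" for y
  proof (rule ccontr)
    assume "y d \<noteq> 0"
    then obtain t where "t \<in> bary_simplex (col d)" "y = point d t"
      using open_top_cell[of y] \<open>y \<in> ?U\<close> by blast
    then show False using \<open>y \<in> ?U\<close> space_faces[OF top_in_P] by auto
  qed
  then have "?U \<subseteq> space (L - {d})" by (auto simp: space_remove)
  moreover have "closedin ?X (space (L - {d}))"
    using L down_closed_remove by (intro closedin_space) auto
  ultimately have "?X closure_of ?U \<subseteq> space (L - {d})" by (rule closure_of_minimal)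
  moreover have "openin ?X ?V"
  proof -
    have "open {y::'d \<Rightarrow> real. real (card (col d)) * y d < 1}"
      by (intro open_Collect_less continuous_intros continuous_on_product_coordinates)
    moreover have "?V = space L \<inter> {y. real (card (col d)) * y d < 1}"
      by (auto simp: near_boundary_def)
    ultimately show ?thesis by (metis openin_open_Int)
  qed
  ultimately have "?X closure_of ?U \<subseteq> ?X interior_of ?V"
    using space_remove_subset by (simp add: interior_of_openin)
  moreover have "?V \<subseteq> space L" by (auto simp: near_boundary_def)
  ultimately have "hom_induced p (subtopology ?X (space L - ?U)) (?V - ?U) (subtopology ?X (space L)) ?V id
      \<in> iso (relative_homology_group p (subtopology ?X (space L - ?U)) (?V - ?U))
          (relative_homology_group p (subtopology ?X (space L)) ?V)"
    by (rule homology_excision_axiom)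
  moreover have "space L - ?U = space (faces d)" using sub by auto
  moreover have "?V - ?U = near_boundary d (faces d)" using sub by (auto simp: near_boundary_def)
  moreover have "subtopology ?X (space (faces d)) = top_of_set (space (faces d))"
    using sub by (simp add: subtopology_subtopology Int_absorb1)
  moreover have "subtopology ?X (space L) = ?X" by (simp add: subtopology_subtopology)
  ultimately show ?thesis unfolding is_iso_def by auto
qed

end

lemma faces_top: "\<forall>b\<in>faces d. face d b \<longrightarrow> b = d"
  unfolding faces_def by (blast intro: face_antisym)

lemma euler_is_near_boundary:
  assumes "down_closed L" "d \<in> L" "\<forall>b\<in>L. face d b \<longrightarrow> b = d"
    and "euler_is (top_of_set (space (L - {d}))) {} e"
  shows "euler_is (subtopology (top_of_set (space L)) (near_boundary d L)) {} e"
proof -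
  have "space L \<inter> near_boundary d L = near_boundary d L" by (auto simp: near_boundary_def)
  then show ?thesis
    using euler_is_iso[OF assms(4) group.iso_sym[OF _ near_boundary_homology[OF assms(1-3)]]]
    by (simp add: subtopology_subtopology)
qed

lemma euler_is_faces:
  assumes "d \<in> P"
  shows "euler_is (top_of_set (space (faces d))) {} 1"
proof (rule euler_is_contractible)
  show "contractible_space (top_of_set (space (faces d)))"
    using contractible_faces[OF assms] by simp
  have "finite (col d)" "col d \<noteq> {}" using assms by (auto simp: fin_col col_ne)
  then have "(\<lambda>i. if i \<in> col d then 1 / real (card (col d)) else 0) \<in> bary_simplex (col d)"
    by (auto simp: bary_simplex_def)
  then show "topspace (top_of_set (space (faces d))) \<noteq> {}"
    using space_faces[OF assms] by auto
qed

text \<open>Faces are the non-empty subsets of \<open>col d\<close>; the alternating sum over all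
  subsets vanishes, so the missing empty one accounts for the value 1.\<close>

lemma sum_faces:
  assumes "d \<in> P"
  shows "(\<Sum>b\<in>faces d. (-1) ^ (card (col b) + 1)) = (1::int)"
proof -
  have "bij_betw col (faces d) (Pow (col d) - {{}})"
  proof (rule bij_betw_byWitness[where f' = "restr d"])
    show "\<forall>b\<in>faces d. restr d (col b) = b" by (simp add: faces_def face_def)
    show "\<forall>J\<in>Pow (col d) - {{}}. col (restr d J) = J" using assms by (simp add: col_restr)
    show "col ` faces d \<subseteq> Pow (col d) - {{}}" using col_ne by (auto simp: faces_def face_def)
    show "restr d ` (Pow (col d) - {{}}) \<subseteq> faces d"
      using assms by (auto simp: faces_def intro!: face_restr)
  qed
  then have "(\<Sum>b\<in>faces d. (-1) ^ (card (col b) + 1)) = (\<Sum>J\<in>Pow (col d) - {{}}. (-1::int) ^ (card J + 1))"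
    by (rule sum.reindex_bij_betw)
  also have "\<dots> = - (\<Sum>J\<in>Pow (col d) - {{}}. (-1) ^ card J)" by (simp add: sum_negf)
  also have "(\<Sum>J\<in>Pow (col d) - {{}}. (-1::int) ^ card J) = (\<Sum>J\<in>Pow (col d). (-1) ^ card J) - (-1) ^ card ({}::'c set)"
    using fin_col[OF assms] by (subst sum_diff1) auto
  finally show ?thesis using sum_Pow_alternating[OF fin_col col_ne] assms by simp
qed

text \<open>The relative term of a top cell is computed inside its own closed simplex, whose proper
  faces form a complex with fewer cells than \<open>L\<close>, and is carried over by
  excision.\<close>

theorem euler_is_space:
  assumes "down_closed L"
  shows "euler_is (top_of_set (space L)) {} (\<Sum>d\<in>L. (-1) ^ (card (col d) + 1))"
  using assms
proof (induction "card L" arbitrary: L rule: less_induct)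
  case less
  have finL: "finite L" using less.prems fin_P finite_subset by (auto simp: down_closed_def)
  show ?case
  proof (cases "L = {}")
    case True
    then show ?thesis using euler_is_empty[of "top_of_set (space L)"] by (simp add: space_def)
  next
    case False
    \<comment> \<open>A cell with the most colours is a proper face of no other, so it may be
      removed.\<close>
    let ?C = "(\<lambda>d. card (col d)) ` L"
    have "Max ?C \<in> ?C" using finL False by (intro Max_in) auto
    then obtain d where dL: "d \<in> L" "card (col d) = Max ?C" by auto
    then have d: "d \<in> L" "\<And>b. b \<in> L \<Longrightarrow> card (col b) \<le> card (col d)"
      using finL by simp_all
    have P: "d \<in> P" using d less.prems by (auto simp: down_closed_def)
    have top: "\<forall>b\<in>L. face d b \<longrightarrow> b = d"
    proof (intro ballI impI)
      fix b assume b: "b \<in> L" "face d b"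
      then have "col d = col b"
        using d(2)[OF b(1)] fin_col[of b] by (intro card_seteq) (auto simp: face_def)
      then show "b = d" using b(2) by (metis face_def restr_col)
    qed
    have sub: "faces d \<subseteq> L" using less.prems d(1) by (auto simp: down_closed_def faces_def)
    have dF: "d \<in> faces d" using face_refl[OF P] by (simp add: faces_def)
    let ?e = "\<lambda>L. \<Sum>d\<in>L. (-1::int) ^ (card (col d) + 1)"
    have remove: "?e M = ?e (M - {d}) + (-1) ^ (card (col d) + 1)" if "M \<subseteq> L" "d \<in> M" for M
      using that finite_subset[OF that(1) finL] by (simp add: sum.remove)
    \<comment> \<open>Used twice: for \<open>M = faces d\<close> to find the relative term, and for
      \<open>M = L\<close> to assemble the result.\<close>
    have IH: "euler_is (top_of_set (space (M - {d}))) {} (?e (M - {d}))"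
      if "M \<subseteq> L" "d \<in> M" "down_closed M" for M
    proof (rule less.hyps)
      show "card (M - {d}) < card L" using that finL by (intro psubset_card_mono) auto
      show "down_closed (M - {d})" using that top by (intro down_closed_remove) auto
    qed
    \<comment> \<open>The closed simplex contributes 1 by contractibility; with its barycentre
      removed it has the homology of its proper faces.\<close>
    have "euler_is (top_of_set (space (faces d))) (near_boundary d (faces d)) (1 - ?e (faces d - {d}))"
      by (intro euler_is_pair euler_is_near_boundary faces_top down_closed_faces dF IH sub euler_is_faces P)
    then have "euler_is (top_of_set (space L)) (near_boundary d L) (1 - ?e (faces d - {d}))"
      by (rule euler_is_iso) (rule excise_top_cell[OF less.prems d(1) top])
    moreover have "1 - ?e (faces d - {d}) = (-1) ^ (card (col d) + 1)"
      using remove[OF sub dF] sum_faces[OF P] by simp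
    ultimately have "euler_is (top_of_set (space L)) (near_boundary d L) ((-1) ^ (card (col d) + 1))"
      by simp
    moreover have "euler_is (subtopology (top_of_set (space L)) (near_boundary d L)) {} (?e (L - {d}))"
      using IH[OF order_refl d(1) less.prems] by (rule euler_is_near_boundary[OF less.prems d(1) top])
    ultimately have "euler_is (top_of_set (space L)) {} (?e (L - {d}) + (-1) ^ (card (col d) + 1))"
      by (intro euler_is_total)
    then show ?thesis using remove[OF order_refl d(1)] by simp
  qed
qed

end

section \<open>Connectivity and contraction\<close>

definition adj :: "('v, 'e) mgraph \<Rightarrow> 'e set \<Rightarrow> ('v \<times> 'v) set" where
  "adj G F = {(x, y). \<exists>e\<in>F. ends G e = {#x, y#}}"

lemma linked_iff: "(u, v) \<in> linked G F \<longleftrightarrow> u \<in> verts G \<and> v \<in> verts G \<and> (u, v) \<in> (adj G F)\<^sup>*"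
  by (simp add: linked_def adj_def)

lemma adj_sym: "(x, y) \<in> adj G F \<Longrightarrow> (y, x) \<in> adj G F"
  by (auto simp: adj_def add_mset_commute)

lemma adj_mono: "F \<subseteq> F' \<Longrightarrow> adj G F \<subseteq> adj G F'"
  by (auto simp: adj_def)

lemma linked_mono: "F \<subseteq> F' \<Longrightarrow> linked G F \<subseteq> linked G F'"
proof (rule subrelI)
  fix u v assume "F \<subseteq> F'" "(u, v) \<in> linked G F"
  then show "(u, v) \<in> linked G F'"
    using rtrancl_mono[OF adj_mono[of F F' G]] by (simp add: linked_iff subset_iff)
qed

lemma equiv_linked: "equiv (verts G) (linked G F)"
proof (intro equivI)
  have "sym (adj G F)" by (auto intro: symI adj_sym)
  then have "sym ((adj G F)\<^sup>*)" by (rule sym_rtrancl)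
  then show "sym (linked G F)"
    by (intro symI) (simp add: linked_iff, blast dest: symD)
  show "trans (linked G F)" by (auto simp: linked_iff intro!: transI)
qed (auto simp: linked_iff refl_on_def)

lemma linked_refl: "v \<in> verts G \<Longrightarrow> (v, v) \<in> linked G F"
  by (simp add: linked_iff)

lemma linked_sym: "(u, v) \<in> linked G F \<Longrightarrow> (v, u) \<in> linked G F"
  using equiv_linked[of G F] by (auto simp: equiv_def dest: symD)

lemma linked_trans: "(u, v) \<in> linked G F \<Longrightarrow> (v, w) \<in> linked G F \<Longrightarrow> (u, w) \<in> linked G F"
  using equiv_linked[of G F] unfolding equiv_def by (blast dest: transD)

lemma linked_class_eq_iff:
  "u \<in> verts G \<Longrightarrow> v \<in> verts G \<Longrightarrow>
    linked G F ``{u} = linked G F ``{v} \<longleftrightarrow> (u, v) \<in> linked G F"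
  by (rule eq_equiv_class_iff[OF equiv_linked])

lemma two_element_mset:
  assumes "size M = 2"
  obtains x y where "M = {#x, y#}"
proof -
  obtain x N where "M = add_mset x N" "size N = 1"
    using assms by (metis One_nat_def Suc_1 size_eq_Suc_imp_eq_union size_Suc_Diff1 add_diff_cancel_left' diff_Suc_1 size_add_mset)
  then show ?thesis using that by (metis size_1_singleton_mset)
qed

lemma pair_mset_eq_iff:
  "{#x, y#} = {#a, b#} \<longleftrightarrow> (x = a \<and> y = b) \<or> (x = b \<and> y = a)"
  by (auto simp: add_eq_conv_ex)

lemma legged_graph_ends:
  assumes "legged_graph s G" "e \<in> edges G"
  obtains x y where "ends G e = {#x, y#}" "x \<in> verts G" "y \<in> verts G"
proof -
  have *: "size (ends G e) = 2" "set_mset (ends G e) \<subseteq> verts G"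
    using assms by (auto simp: legged_graph_def)
  then obtain x y where "ends G e = {#x, y#}" using two_element_mset by blast
  then show ?thesis using that * by auto
qed

lemma crossing_edge:
  assumes "(u, w) \<in> (adj G F)\<^sup>*" "u \<in> A" "w \<notin> A"
  shows "\<exists>e\<in>F. \<exists>x\<in>A. \<exists>y. y \<notin> A \<and> ends G e = {#x, y#}"
  using assms
proof (induction rule: rtrancl_induct)
  case (step y z)
  then show ?case by (cases "y \<in> A") (auto simp: adj_def)
qed simp

section \<open>Counting components\<close>

definition num_components :: "('v, 'e) mgraph \<Rightarrow> 'e set \<Rightarrow> nat" where
  "num_components G F = card (components_by G F)"

lemma components_connected:
  assumes "connected_by G F" "verts G \<noteq> {}"
  shows "components_by G F = {verts G}"
proof -
  have "linked G F ``{v} = verts G" if "v \<in> verts G" for v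
    using that assms(1) by (auto simp: connected_by_def linked_iff)
  then show ?thesis using assms(2) by (auto simp: components_by_def quotient_def)
qed

lemma num_components_empty: "num_components G {} = card (verts G)"
proof -
  have "linked G {} ``{v} = {v}" if "v \<in> verts G" for v
    using that by (auto simp: linked_iff adj_def)
  then have "components_by G {} = (\<lambda>v. {v}) ` verts G" by (auto simp: components_by_def quotient_def)
  then show ?thesis by (simp add: num_components_def card_image)
qed

text \<open>Outside the class of \<open>x\<close> no two classes become joined by the new edge, so
  the map from old to new classes is injective there.\<close>

lemma num_components_insert:
  assumes G: "legged_graph s G" and e: "e \<in> edges G"
  shows "num_components G F \<le> num_components G (insert e F) + 1"
proof -
  obtain x y where xy: "ends G e = {#x, y#}" "x \<in> verts G" "y \<in> verts G"
    using legged_graph_ends[OF G e] .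
  have fin: "finite (verts G)" using G by (simp add: legged_graph_def)
  have adj: "adj G (insert e F) = insert (x, y) (insert (y, x) (adj G F))"
    using xy by (auto simp: adj_def pair_mset_eq_iff)
  have split: "(u, v) \<in> linked G F"
    if uv: "(u, v) \<in> linked G (insert e F)" "(x, u) \<notin> linked G F" "(x, v) \<notin> linked G F" for u v
  proof -
    have V: "u \<in> verts G" "v \<in> verts G" using uv(1) by (auto simp: linked_iff)
    have nx: "(u, x) \<notin> (adj G F)\<^sup>*" "(x, v) \<notin> (adj G F)\<^sup>*"
      using uv V xy linked_sym[of u x G F] by (auto simp: linked_iff)
    have "(u, v) \<in> (adj G (insert e F))\<^sup>*" using uv(1) by (simp add: linked_iff)
    then have "(u, v) \<in> (adj G F)\<^sup>*"
      unfolding adj rtrancl_insert using nx by auto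
    then show ?thesis using V by (simp add: linked_iff)
  qed
  let ?q = "\<lambda>C. linked G (insert e F) `` C"
  let ?D = "components_by G F - {linked G F ``{x}}"
  have cls: "?q (linked G F ``{u}) = linked G (insert e F) ``{u}" if "u \<in> verts G" for u
    using linked_mono[of F "insert e F" G] linked_trans[of _ _ G "insert e F"] linked_refl[OF that]
    by blast
  have "inj_on ?q ?D"
  proof (rule inj_onI)
    fix C C' assume C: "C \<in> ?D" "C' \<in> ?D" and eq: "?q C = ?q C'"
    obtain u v where uv: "u \<in> verts G" "v \<in> verts G" "C = linked G F ``{u}" "C' = linked G F ``{v}"
      using C by (auto simp: components_by_def elim!: quotientE)
    then have "(u, v) \<in> linked G (insert e F)"
      using eq by (simp add: cls linked_class_eq_iff)
    moreover have "(x, u) \<notin> linked G F" "(x, v) \<notin> linked G F"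
      using C uv xy by (auto simp: linked_class_eq_iff[symmetric])
    ultimately have "(u, v) \<in> linked G F" by (rule split)
    then show "C = C'" using uv by (simp add: linked_class_eq_iff)
  qed
  moreover have "?q ` ?D \<subseteq> components_by G (insert e F)"
    using cls by (auto simp: components_by_def quotient_def)
  moreover have fins: "finite (components_by G F')" for F'
    using fin by (simp add: components_by_def quotient_def)
  ultimately have "card ?D \<le> num_components G (insert e F)"
    unfolding num_components_def by (intro card_inj_on_le)
  moreover have "num_components G F \<le> card ?D + 1"
    unfolding num_components_def using fins[of F] by (auto simp: card_Diff_singleton_if)
  ultimately show ?thesis by simp
qed

lemma num_components_Un:
  assumes G: "legged_graph s G" and D: "D \<subseteq> edges G"
  shows "num_components G F \<le> num_components G (F \<union> D) + card D"
proof -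
  have "finite D" using G D finite_subset by (auto simp: legged_graph_def)
  then show ?thesis using D
  proof (induction D rule: finite_induct)
    case (insert e D)
    then have "num_components G (F \<union> D) \<le> num_components G (F \<union> insert e D) + 1"
      using num_components_insert[OF G, of e "F \<union> D"] by simp
    with insert show ?case by simp
  qed simp
qed

text \<open>An intrinsic form of the one-loop condition: here bridgelessness and the edge count make
  every vertex bivalent (up to legs).\<close>

definition core :: "nat \<Rightarrow> ('v, 'e) mgraph \<Rightarrow> bool" where
  "core s G \<longleftrightarrow> legged_graph s G \<and> (\<forall>e\<in>edges G. connected_by G (edges G - {e})) \<and>
     card (edges G) = card (verts G) \<and> verts G = leg G ` {1..s}"

lemma connected_by_mono: "connected_by G F \<Longrightarrow> F \<subseteq> F' \<Longrightarrow> connected_by G F'"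
  using linked_mono unfolding connected_by_def by blast

lemma core_edges_ne:
  assumes "core s G"
  shows "edges G \<noteq> {}"
proof -
  have "card (verts G) \<noteq> 0" using assms by (auto simp: core_def legged_graph_def)
  then show ?thesis using assms by (auto simp: core_def)
qed

lemma core_connected:
  assumes "core s G"
  shows "connected_by G (edges G)"
proof -
  obtain e where "e \<in> edges G" using core_edges_ne[OF assms] by blast
  then show ?thesis using assms connected_by_mono[of G "edges G - {e}" "edges G"] by (auto simp: core_def)
qed

text \<open>A squeeze. Each added edge lowers the number of components by at most one: from no edges
  up to \<open>Z\<close> this bounds it below, and from \<open>Z\<close> up to
  \<open>edges G - {e}\<close>, which is connected, above. The bounds agree because there are as
  many edges as vertices.\<close>

lemma num_components_core:
  assumes G: "core s G" and Z: "Z \<subseteq> edges G" "Z \<noteq> edges G"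
  shows "num_components G Z + card Z = card (verts G)"
proof -
  have lg: "legged_graph s G" using G by (simp add: core_def)
  have fin: "finite (edges G)" using lg by (simp add: legged_graph_def)
  obtain e where e: "e \<in> edges G" "e \<notin> Z" using Z by blast
  have "card (verts G) \<le> num_components G Z + card Z"
    using num_components_Un[OF lg Z(1), of "{}"] by (simp add: num_components_empty)
  moreover have "num_components G Z \<le> 1 + card (edges G - {e} - Z)"
  proof -
    have "num_components G (edges G - {e}) = 1"
      using components_connected[of G "edges G - {e}"] G e lg
      unfolding num_components_def core_def legged_graph_def by (metis One_nat_def card_1_singleton_iff)
    moreover have "Z \<union> (edges G - {e} - Z) = edges G - {e}" using e Z by auto
    ultimately show ?thesis
      using num_components_Un[OF lg, of "edges G - {e} - Z" Z] by auto
  qed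
  moreover have "card (edges G - {e} - Z) + card Z + 1 = card (edges G)"
  proof -
    have "card (edges G - {e} - Z) = card (edges G - {e}) - card Z"
      using Z e by (intro card_Diff_subset finite_subset[OF Z(1) fin]) auto
    moreover have "card Z \<le> card (edges G - {e})" using Z e fin by (intro card_mono) auto
    moreover have "card (edges G - {e}) + 1 = card (edges G)"
      using e fin by (metis Suc_eq_plus1 card_Suc_Diff1)
    ultimately show ?thesis by linarith
  qed
  moreover have "card (edges G) = card (verts G)" using G by (simp add: core_def)
  ultimately show ?thesis by linarith
qed

lemma collapse_simps [simp]:
  "verts (collapse G Z) = components_by G Z"
  "edges (collapse G Z) = edges G - Z"
  "ends (collapse G Z) e = image_mset (\<lambda>v. linked G Z ``{v}) (ends G e)"
  "leg (collapse G Z) i = linked G Z ``{leg G i}"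
  by (simp_all add: collapse_def)

text \<open>A step along an edge of \<open>Z\<close> becomes stationary after the collapse; every
  other edge survives.\<close>

lemma linked_collapse:
  assumes "legged_graph s G" "F \<subseteq> edges G" "(u, v) \<in> linked G F"
  shows "(linked G Z ``{u}, linked G Z ``{v}) \<in> linked (collapse G Z) (F - Z)"
proof -
  let ?c = "\<lambda>v. linked G Z ``{v}"
  have V: "u \<in> verts G" "v \<in> verts G" "(u, v) \<in> (adj G F)\<^sup>*" using assms(3) by (auto simp: linked_iff)
  from V(3) have "(?c u, ?c v) \<in> (adj (collapse G Z) (F - Z))\<^sup>*"
  proof (induction rule: rtrancl_induct)
    case (step x y)
    then obtain e where e: "e \<in> F" "ends G e = {#x, y#}" by (auto simp: adj_def)
    then have xy: "x \<in> verts G" "y \<in> verts G"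
      using assms(1,2) by (force simp: legged_graph_def)+
    show ?case
    proof (cases "e \<in> Z")
      case True
      then have "(x, y) \<in> linked G Z" using e xy by (auto simp: linked_iff adj_def)
      then have "?c x = ?c y" using xy by (simp add: linked_class_eq_iff)
      then show ?thesis using step.IH by simp
    next
      case False
      then have "(?c x, ?c y) \<in> adj (collapse G Z) (F - Z)"
        using e by (auto simp: adj_def intro!: bexI[of _ e])
      then show ?thesis using step.IH by (rule rtrancl_into_rtrancl[rotated])
    qed
  qed simp
  then show ?thesis using V by (auto simp: linked_iff components_by_def quotient_def)
qed

lemma connected_by_collapse:
  assumes "legged_graph s G" "F \<subseteq> edges G" "connected_by G F"
  shows "connected_by (collapse G Z) (F - Z)"
  unfolding connected_by_def
proof (intro ballI)
  fix C D assume "C \<in> verts (collapse G Z)" "D \<in> verts (collapse G Z)"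
  then obtain u v where "u \<in> verts G" "v \<in> verts G" "C = linked G Z ``{u}" "D = linked G Z ``{v}"
    by (auto simp: components_by_def quotient_def)
  then show "(C, D) \<in> linked (collapse G Z) (F - Z)"
    using linked_collapse[OF assms(1,2)] assms(3) by (simp add: connected_by_def)
qed

text \<open>Connectedness and the legs descend to the quotient; that edges and vertices remain equal
  in number is the content of \<open>num_components_core\<close>.\<close>

lemma core_collapse:
  assumes G: "core s G" and Z: "Z \<subseteq> edges G" "Z \<noteq> edges G"
  shows "core s (collapse G Z)"
proof -
  let ?c = "\<lambda>v. linked G Z ``{v}"
  have lg: "legged_graph s G" using G by (simp add: core_def)
  have V: "components_by G Z = ?c ` verts G" by (auto simp: components_by_def quotient_def)
  have "legged_graph s (collapse G Z)"
    using lg by (auto simp: legged_graph_def V)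
  moreover have "connected_by (collapse G Z) (edges G - Z - {e})" if "e \<in> edges G - Z" for e
  proof -
    have "edges G - {e} - Z = edges G - Z - {e}" by auto
    then show ?thesis
      using connected_by_collapse[OF lg, of "edges G - {e}" Z] G that by (simp add: core_def)
  qed
  moreover have "card (edges G - Z) = card (components_by G Z)"
  proof -
    have "finite Z" using Z lg finite_subset by (auto simp: legged_graph_def)
    then show ?thesis
      using num_components_core[OF assms] Z G by (simp add: card_Diff_subset num_components_def core_def)
  qed
  moreover have "components_by G Z = (\<lambda>i. ?c (leg G i)) ` {1..s}"
    using G unfolding V by (simp add: core_def image_image)
  ultimately show ?thesis by (simp add: core_def)
qed

subsection \<open>Degrees\<close>

definition edge_degree :: "('v, 'e) mgraph \<Rightarrow> 'v \<Rightarrow> nat" where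
  "edge_degree G v = (\<Sum>e\<in>edges G. count (ends G e) v)"

text \<open>Stated for a part of the graph, since it is applied both to the whole graph and to the
  vertices and edges of one cycle.\<close>

lemma handshake_on:
  assumes "finite A" "finite F" "\<And>e. e \<in> F \<Longrightarrow> size (ends G e) = 2 \<and> set_mset (ends G e) \<subseteq> A"
  shows "(\<Sum>v\<in>A. \<Sum>e\<in>F. count (ends G e) v) = 2 * card F"
proof -
  have "(\<Sum>v\<in>A. \<Sum>e\<in>F. count (ends G e) v) = (\<Sum>e\<in>F. \<Sum>v\<in>A. count (ends G e) v)"
    by (rule sum.swap)
  also have "\<dots> = (\<Sum>e\<in>F. 2)"
  proof (rule sum.cong[OF refl])
    fix e assume e: "e \<in> F"
    have "(\<Sum>v\<in>A. count (ends G e) v) = (\<Sum>v\<in>set_mset (ends G e). count (ends G e) v)"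
      using assms(1) assms(3)[OF e] by (intro sum.mono_neutral_right) (auto simp: not_in_iff)
    then show "(\<Sum>v\<in>A. count (ends G e) v) = 2"
      using assms(3)[OF e] by (simp add: size_multiset_overloaded_eq)
  qed
  finally show ?thesis by simp
qed

text \<open>With a second vertex present, connectedness after deleting one edge at \<open>v\<close>
  produces another one. A single vertex has a single edge, a loop, which counts twice.\<close>

lemma two_le_edge_degree:
  assumes G: "legged_graph s G" and conn: "\<forall>e\<in>edges G. connected_by G (edges G - {e})"
    and card: "card (edges G) = card (verts G)" and v: "v \<in> verts G"
  shows "2 \<le> edge_degree G v"
proof -
  have fin: "finite (edges G)" "finite (verts G)" using G by (simp_all add: legged_graph_def)
  show ?thesis
  proof (cases "verts G = {v}")
    case True
    then obtain e where e: "edges G = {e}" using card by (metis card_1_singletonE is_singletonI is_singleton_altdef)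
    then obtain x y where "ends G e = {#x, y#}" "x \<in> verts G" "y \<in> verts G"
      using legged_graph_ends[OF G, of e] by auto
    then show ?thesis using True e by (simp add: edge_degree_def)
  next
    case False
    then obtain w where w: "w \<in> verts G" "w \<noteq> v" using v by blast
    have cross: "\<exists>e\<in>F. 1 \<le> count (ends G e) v" if "connected_by G F" for F
    proof -
      have "(v, w) \<in> (adj G F)\<^sup>*" using that v w by (auto simp: connected_by_def linked_iff)
      then obtain e y where "e \<in> F" "ends G e = {#v, y#}"
        using crossing_edge[of v w G F "{v}"] w by auto
      then show ?thesis by (intro bexI[of _ e]) simp_all
    qed
    have "card (verts G) \<noteq> 0" using fin v by auto
    then obtain e0 where "e0 \<in> edges G" using card fin by force
    then obtain e1 where e1: "e1 \<in> edges G" "1 \<le> count (ends G e1) v"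
      using conn cross by blast
    obtain e2 where e2: "e2 \<in> edges G - {e1}" "1 \<le> count (ends G e2) v"
      using conn cross e1 by blast
    have "(\<Sum>e\<in>{e1, e2}. count (ends G e) v) \<le> edge_degree G v"
      unfolding edge_degree_def using fin e1 e2 by (intro sum_mono2) auto
    moreover have "e1 \<noteq> e2" using e2(1) by blast
    then have "(\<Sum>e\<in>{e1, e2}. count (ends G e) v) = count (ends G e1) v + count (ends G e2) v"
      by simp
    ultimately show ?thesis using e1(2) e2(2) by linarith
  qed
qed

text \<open>The handshake lemma makes the average degree exactly 2, which is also a lower bound at
  each vertex.\<close>

lemma edge_degree_eq_2:
  assumes G: "legged_graph s G" and conn: "\<forall>e\<in>edges G. connected_by G (edges G - {e})"
    and card: "card (edges G) = card (verts G)" and v: "v \<in> verts G"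
  shows "edge_degree G v = 2"
proof (rule ccontr)
  assume "edge_degree G v \<noteq> 2"
  then have "2 < edge_degree G v" using two_le_edge_degree[OF assms] by simp
  moreover have fin: "finite (edges G)" "finite (verts G)" using G by (simp_all add: legged_graph_def)
  ultimately have "(\<Sum>v\<in>verts G. 2) < (\<Sum>v\<in>verts G. edge_degree G v)"
    using v two_le_edge_degree[OF G conn card] by (intro sum_strict_mono_ex1) auto
  moreover have "(\<Sum>v\<in>verts G. edge_degree G v) = 2 * card (edges G)"
    unfolding edge_degree_def using G fin by (intro handshake_on) (auto simp: legged_graph_def)
  ultimately show False using card by simp
qed

lemma valency_eq: "valency s G v = edge_degree G v + card {i\<in>{1..s}. leg G i = v}"
  by (simp add: valency_def edge_degree_def)

lemma first_betti_connected:
  assumes "connected_by G (edges G)" "verts G \<noteq> {}"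
  shows "first_betti G = int (card (edges G)) - int (card (verts G)) + 1"
  by (simp add: first_betti_def components_connected[OF assms])

text \<open>Both sides force edge degree 2 at every vertex, so valency at least 3 says exactly that
  a leg is attached.\<close>

lemma one_loop_iff_core:
  "admissible s G \<and> first_betti G = 1 \<longleftrightarrow> core s G"
proof
  assume *: "admissible s G \<and> first_betti G = 1"
  then have G: "legged_graph s G" and conn: "\<forall>e\<in>edges G. connected_by G (edges G - {e})"
    and val: "\<forall>v\<in>verts G. 3 \<le> valency s G v"
    by (auto simp: admissible_def)
  have card: "card (edges G) = card (verts G)"
    using * first_betti_connected[of G] by (simp add: admissible_def legged_graph_def)
  have "v \<in> leg G ` {1..s}" if v: "v \<in> verts G" for v
  proof -
    have "3 \<le> 2 + card {i\<in>{1..s}. leg G i = v}"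
      using val[rule_format, OF v] edge_degree_eq_2[OF G conn card v] unfolding valency_eq by simp
    then have "card {i\<in>{1..s}. leg G i = v} \<noteq> 0" by linarith
    then have "{i\<in>{1..s}. leg G i = v} \<noteq> {}" by (metis card.empty)
    then show ?thesis by auto
  qed
  moreover have "leg G ` {1..s} \<subseteq> verts G" using G by (auto simp: legged_graph_def)
  ultimately have "verts G = leg G ` {1..s}" by blast
  then show "core s G" using G conn card by (simp add: core_def)
next
  assume G: "core s G"
  have "3 \<le> valency s G v" if v: "v \<in> verts G" for v
  proof -
    have "v \<in> leg G ` {1..s}" using G v by (simp add: core_def)
    then have "{i\<in>{1..s}. leg G i = v} \<noteq> {}" by blast
    then have "0 < card {i\<in>{1..s}. leg G i = v}" by (simp add: card_gt_0_iff)
    moreover have "edge_degree G v = 2" using G v by (intro edge_degree_eq_2) (auto simp: core_def)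
    ultimately show ?thesis unfolding valency_eq by linarith
  qed
  moreover have lg: "legged_graph s G" and "\<forall>e\<in>edges G. connected_by G (edges G - {e})"
    and card: "card (edges G) = card (verts G)"
    using G by (simp_all add: core_def)
  ultimately have "admissible s G" using core_connected[OF G] by (simp add: admissible_def)
  moreover have "first_betti G = 1"
    using first_betti_connected[OF core_connected[OF G]] lg card by (simp add: legged_graph_def)
  ultimately show "admissible s G \<and> first_betti G = 1" ..
qed

lemma one_loop_graphs_eq: "one_loop_graphs s = {G. core s G}"
  by (simp add: one_loop_graphs_def one_loop_iff_core)

subsection \<open>The cycle\<close>

definition is_path :: "('v, 'e) mgraph \<Rightarrow> 'v list \<Rightarrow> 'e list \<Rightarrow> bool" where
  "is_path G vs es \<longleftrightarrow> length vs = Suc (length es) \<and> distinct vs \<and>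
     set vs \<subseteq> verts G \<and> set es \<subseteq> edges G \<and>
     (\<forall>i<length es. ends G (es ! i) = {#vs ! i, vs ! Suc i#})"

lemma is_path_edge_eq:
  assumes "is_path G vs es" "i < length es" "j < length es" "es ! i = es ! j"
  shows "i = j"
proof -
  have "{#vs ! i, vs ! Suc i#} = {#vs ! j, vs ! Suc j#}"
    using assms by (metis is_path_def)
  moreover have "vs ! a = vs ! b \<longleftrightarrow> a = b" if "a \<le> length es" "b \<le> length es" for a b
    using assms(1) that by (simp add: is_path_def nth_eq_iff_index_eq)
  ultimately show ?thesis using assms(2,3) by (auto simp: pair_mset_eq_iff)
qed

text \<open>Take a longest path. Its last vertex has degree 2, so a further edge leaves it, and by
  maximality that edge returns to the path.\<close>

lemma core_has_cycle:
  assumes G: "core s G"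
  shows "\<exists>vs es. is_cycle G vs es"
proof -
  have lg: "legged_graph s G" using G by (simp add: core_def)
  have fin: "finite (edges G)" "finite (verts G)" using lg by (simp_all add: legged_graph_def)
  obtain v0 where "v0 \<in> verts G" using lg by (auto simp: legged_graph_def)
  then have "is_path G [v0] []" by (simp add: is_path_def)
  moreover have bound: "length es \<le> card (verts G)" if "is_path G vs es" for vs es
  proof -
    have "length vs \<le> card (verts G)"
      using that fin by (metis card_mono distinct_card is_path_def)
    then show ?thesis using that by (simp add: is_path_def)
  qed
  ultimately obtain p where p: "is_path G (fst p) (snd p)"
    and pmax: "\<forall>q. is_path G (fst q) (snd q) \<longrightarrow> length (snd q) \<le> length (snd p)"
    using ex_has_greatest_nat[of "\<lambda>q. is_path G (fst q) (snd q)" "([v0], [])" "\<lambda>q. length (snd q)" "Suc (card (verts G))"]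
    by (auto simp: less_Suc_eq_le)
  define vs es m v where "vs = fst p" and "es = snd p" and "m = length es" and "v = vs ! m"
  have path: "is_path G vs es" using p by (simp add: vs_def es_def)
  have maxi: "length es' \<le> m" if "is_path G vs' es'" for vs' es'
    using pmax[rule_format, of "(vs', es')"] that by (simp add: m_def es_def)
  have P: "length vs = Suc m" "distinct vs" "set vs \<subseteq> verts G" "set es \<subseteq> edges G"
    "\<And>i. i < m \<Longrightarrow> ends G (es ! i) = {#vs ! i, vs ! Suc i#}"
    using path by (auto simp: is_path_def m_def)
  have idx: "vs ! a = vs ! b \<longleftrightarrow> a = b" if "a \<le> m" "b \<le> m" for a b
    using P that by (simp add: nth_eq_iff_index_eq)
  have v: "v \<in> verts G" using P by (auto simp: v_def)
  have deg: "edge_degree G v = 2"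
    using G v by (intro edge_degree_eq_2) (auto simp: core_def)
  \<comment> \<open>If the path has edges, the last of them uses one of the two half-edges at
    \<open>v\<close>, and \<open>e\<close> owns the other. On the trivial path any edge at
    \<open>v\<close> will do, for instance a loop.\<close>
  obtain e where e: "e \<in> edges G" "0 < count (ends G e) v" "0 < m \<longrightarrow> e \<noteq> es ! (m - 1)"
  proof (cases "m = 0")
    case True
    have "\<exists>e\<in>edges G. count (ends G e) v \<noteq> 0"
      using deg unfolding edge_degree_def by (metis sum.neutral zero_neq_numeral)
    then show ?thesis using that True by auto
  next
    case False
    let ?l = "es ! (m - 1)"
    have l: "?l \<in> edges G" using P False by (auto simp: m_def)
    have "vs ! (m - 1) \<noteq> vs ! m" using False idx by auto
    then have "count (ends G ?l) v = 1" using P(5)[of "m - 1"] False by (simp add: v_def)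
    then have "(\<Sum>e\<in>edges G - {?l}. count (ends G e) v) = 1"
      using deg fin l by (simp add: edge_degree_def sum.remove)
    then have "\<exists>e\<in>edges G - {?l}. count (ends G e) v \<noteq> 0"
      by (metis sum.neutral zero_neq_one)
    then show ?thesis using that by auto
  qed
  obtain x y where xy: "ends G e = {#x, y#}" "x \<in> verts G" "y \<in> verts G"
    using legged_graph_ends[OF lg e(1)] .
  obtain w where w: "ends G e = {#v, w#}" "w \<in> verts G"
  proof (cases "x = v")
    case False
    then have "y = v" using e(2) xy by (auto split: if_splits)
    then show ?thesis using that xy by (metis add_mset_commute)
  qed (use that xy in blast)
  have "w \<in> set vs"
  proof (rule ccontr)
    assume "w \<notin> set vs"
    then have "is_path G (vs @ [w]) (es @ [e])"
      using P w e(1) by (auto simp: is_path_def nth_append m_def v_def less_Suc_eq)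
    then show False using maxi by (force simp: m_def)
  qed
  then obtain i where i: "i \<le> m" "w = vs ! i" using P(1) by (auto simp: in_set_conv_nth less_Suc_eq_le)
  \<comment> \<open>The cycle runs from position \<open>i\<close> to position \<open>m\<close> and
    closes up by \<open>e\<close>; \<open>i = m\<close> gives a loop and \<open>i = m - 1\<close> a
    double edge.\<close>
  define n where "n = Suc (m - i)"
  have len: "length (drop i vs) = n" "length (drop i es @ [e]) = n"
    using P(1) i by (auto simp: n_def m_def Suc_diff_le)
  \<comment> \<open>Of the path edges only the last one touches \<open>v\<close>, and
    \<open>e\<close> was chosen different from it.\<close>
  have "e \<noteq> es ! j" if "j < m" for j
  proof
    assume "e = es ! j"
    then have "{#v, w#} = {#vs ! j, vs ! Suc j#}" using P(5)[OF that] w by simp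
    then have "v = vs ! j \<or> v = vs ! Suc j" by (auto simp: pair_mset_eq_iff)
    then have "Suc j = m" using idx[of m j] idx[of m "Suc j"] that by (auto simp: v_def)
    then show False using e(3) \<open>e = es ! j\<close> by auto
  qed
  then have "e \<notin> set (drop i es)" by (metis in_set_conv_nth in_set_dropD m_def)
  moreover have "distinct es"
    using is_path_edge_eq[OF path] by (auto simp: distinct_conv_nth)
  ultimately have dist: "distinct (drop i es @ [e])" by (simp add: distinct_drop)
  have cyc: "ends G ((drop i es @ [e]) ! j) = {#drop i vs ! j, drop i vs ! (Suc j mod n)#}" if j: "j < n" for j
  proof (cases "j < m - i")
    case True
    then have "Suc j mod n = Suc j" by (simp add: n_def)
    moreover have "(drop i es @ [e]) ! j = es ! (i + j)" using True i by (simp add: nth_append m_def)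
    ultimately show ?thesis using True i P(1) P(5)[of "i + j"] by simp
  next
    case False
    then have jm: "j = m - i" using j by (simp add: n_def)
    then have "(drop i es @ [e]) ! j = e" using i by (simp add: nth_append m_def)
    moreover have "Suc j mod n = 0" using jm by (simp add: n_def)
    ultimately show ?thesis using w i jm P(1) by (simp add: v_def)
  qed
  have "is_cycle G (drop i vs) (drop i es @ [e])"
    unfolding is_cycle_def using len dist cyc P e(1) set_drop_subset[of i vs] set_drop_subset[of i es]
    by (auto simp del: drop_append nth_drop simp: distinct_drop)
  then show ?thesis by blast
qed

text \<open>The edges of the cycle already use up degree 2 at each of its vertices, so no other edge
  touches it, and connectedness leaves no other vertex.\<close>

lemma core_cycle_exhausts:
  assumes G: "core s G" and cyc: "is_cycle G vs es"
  shows "set vs = verts G" "set es = edges G"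
proof -
  have lg: "legged_graph s G" using G by (simp add: core_def)
  have fin: "finite (edges G)" "finite (verts G)" using lg by (simp_all add: legged_graph_def)
  define n where "n = length es"
  have C: "n > 0" "length vs = n" "distinct vs" "distinct es" "set vs \<subseteq> verts G" "set es \<subseteq> edges G"
    "\<And>i. i < n \<Longrightarrow> ends G (es ! i) = {#vs ! i, vs ! (Suc i mod n)#}"
    using cyc by (auto simp: is_cycle_def n_def)
  have ends: "size (ends G e) = 2 \<and> set_mset (ends G e) \<subseteq> set vs" if "e \<in> set es" for e
  proof -
    obtain i where "i < n" "e = es ! i" using \<open>e \<in> set es\<close> by (metis in_set_conv_nth n_def)
    then show ?thesis using C(7)[of i] C(1,2) by auto
  qed
  have "(\<Sum>v\<in>set vs. \<Sum>e\<in>set es. count (ends G e) v) = 2 * n"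
    using handshake_on[of "set vs" "set es" G] ends C(4) by (simp add: n_def distinct_card)
  moreover have "(\<Sum>v\<in>set vs. edge_degree G v) = 2 * n"
  proof -
    have "(\<Sum>v\<in>set vs. edge_degree G v) = (\<Sum>v\<in>set vs. 2)"
      using G C(5) by (intro sum.cong refl edge_degree_eq_2) (auto simp: core_def)
    then show ?thesis using C(2,3) by (simp add: distinct_card)
  qed
  moreover have "edge_degree G v = (\<Sum>e\<in>set es. count (ends G e) v) + (\<Sum>e\<in>edges G - set es. count (ends G e) v)" for v
    unfolding edge_degree_def using fin C(6) by (metis add.commute sum.subset_diff)
  ultimately have "(\<Sum>v\<in>set vs. \<Sum>e\<in>edges G - set es. count (ends G e) v) = 0"
    by (simp add: sum.distrib)
  then have none: "count (ends G e) v = 0" if "v \<in> set vs" "e \<in> edges G - set es" for v e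
    using that fin by simp
  have touch: "e \<in> set es" if "e \<in> edges G" "v \<in> set vs" "v \<in># ends G e" for e v
    using none[of v e] that by (cases "e \<in> set es") (auto simp: count_eq_zero_iff)
  show V: "set vs = verts G"
  proof (rule ccontr)
    assume "set vs \<noteq> verts G"
    then obtain w where w: "w \<in> verts G" "w \<notin> set vs" using C(5) by blast
    have u: "vs ! 0 \<in> set vs" using C by simp
    have "(vs ! 0, w) \<in> (adj G (edges G))\<^sup>*"
      using core_connected[OF G] w u C(5) by (auto simp: connected_by_def linked_iff)
    then obtain e x y where e: "e \<in> edges G" "x \<in> set vs" "y \<notin> set vs" "ends G e = {#x, y#}"
      using crossing_edge[OF _ u w(2)] by blast
    then show False using touch[OF e(1,2)] ends[of e] by auto
  qed
  have "e \<in> set es" if e: "e \<in> edges G" for e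
  proof -
    obtain x y where "ends G e = {#x, y#}" "x \<in> verts G"
      using legged_graph_ends[OF lg e] by metis
    then show ?thesis using touch[OF e, of x] V by simp
  qed
  then show "set es = edges G" using C(6) by blast
qed

text \<open>A core graph contains a cycle, and every cycle in it uses all edges. Regularity of a
  metric thus means that some length is non-zero.\<close>

lemma forest_core_iff:
  assumes G: "core s G" and Z: "Z \<subseteq> edges G"
  shows "forest G Z \<longleftrightarrow> Z \<noteq> edges G"
proof -
  obtain vs es where "is_cycle G vs es" using core_has_cycle[OF G] by blast
  then have "\<not> forest G (edges G)" unfolding forest_def is_cycle_def by blast
  moreover have "forest G Z" if "Z \<noteq> edges G"
    unfolding forest_def using Z that core_cycle_exhausts(2)[OF G] by blast
  ultimately show ?thesis by blast
qed

section \<open>Codes of coloured graphs\<close>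

text \<open>A coloured one-loop graph is recorded up to isomorphism by relations on its legs: which
  legs share a vertex, and which are attached to the two ends of the edge of colour \<open>i\<close>.
  Contracting edges then becomes relational algebra.\<close>

type_synonym code = "(nat \<times> nat) set \<times> (nat \<Rightarrow> (nat \<times> nat) set)"

text \<open>Every vertex of a core graph carries a leg, so legs can stand for vertices. Labels are
  confined to \<open>{1..s}\<close> because \<open>leg G\<close> is arbitrary elsewhere.\<close>

definition gcode :: "nat \<Rightarrow> ('v, 'e) mgraph \<Rightarrow> ('e \<Rightarrow> nat) \<Rightarrow> code" where
  "gcode s G c =
    ({(a, b). a \<in> {1..s} \<and> b \<in> {1..s} \<and> leg G a = leg G b},
     \<lambda>i. {(a, b). a \<in> {1..s} \<and> b \<in> {1..s} \<and>
       (\<exists>e\<in>edges G. c e = i \<and> ends G e = {#leg G a, leg G b#})})"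

definition code_colors :: "code \<Rightarrow> nat set" where
  "code_colors d = {i. snd d i \<noteq> {}}"

text \<open>The relation of sharing a vertex once all colours outside \<open>J\<close> are
  contracted. On codes of graphs the generators are symmetric and reflexive on
  \<open>{1..s}\<close>, so the transitive closure is the equivalence they generate.\<close>

definition merge :: "code \<Rightarrow> nat set \<Rightarrow> (nat \<times> nat) set" where
  "merge d J = (fst d \<union> (\<Union>i\<in>- J. snd d i))\<^sup>+"

definition code_restrict :: "code \<Rightarrow> nat set \<Rightarrow> code" where
  "code_restrict d J =
    (merge d J, \<lambda>i. if i \<in> J then merge d J O snd d i O merge d J else {})"

lemma fst_gcode: "(a, b) \<in> fst (gcode s G c) \<longleftrightarrow> a \<in> {1..s} \<and> b \<in> {1..s} \<and> leg G a = leg G b"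
  by (simp add: gcode_def)

lemma snd_gcode: "(a, b) \<in> snd (gcode s G c) i \<longleftrightarrow> a \<in> {1..s} \<and> b \<in> {1..s} \<and>
    (\<exists>e\<in>edges G. c e = i \<and> ends G e = {#leg G a, leg G b#})"
  by (simp add: gcode_def)

lemma core_vertex_leg:
  assumes "core s G" "v \<in> verts G"
  obtains a where "a \<in> {1..s}" "v = leg G a"
  using assms unfolding core_def by blast

lemma core_legged: "core s G \<Longrightarrow> legged_graph s G"
  by (simp add: core_def)

lemma leg_in_verts: "legged_graph s G \<Longrightarrow> a \<in> {1..s} \<Longrightarrow> leg G a \<in> verts G"
  by (simp add: legged_graph_def)

lemma core_edge_legs:
  assumes "core s G" "e \<in> edges G"
  obtains a b where "a \<in> {1..s}" "b \<in> {1..s}" "ends G e = {#leg G a, leg G b#}"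
proof -
  obtain x y where xy: "ends G e = {#x, y#}" "x \<in> verts G" "y \<in> verts G"
    using legged_graph_ends[OF core_legged[OF assms(1)] assms(2)] .
  obtain a where a: "a \<in> {1..s}" "x = leg G a" using core_vertex_leg[OF assms(1) xy(2)] .
  obtain b where b: "b \<in> {1..s}" "y = leg G b" using core_vertex_leg[OF assms(1) xy(3)] .
  show ?thesis using that a b xy(1) by simp
qed

lemma code_colors_gcode:
  assumes "core s G"
  shows "code_colors (gcode s G c) = c ` edges G"
proof (intro equalityI subsetI)
  fix i assume "i \<in> code_colors (gcode s G c)"
  then obtain a b where "(a, b) \<in> snd (gcode s G c) i" by (auto simp: code_colors_def)
  then show "i \<in> c ` edges G" by (auto simp: snd_gcode)
next
  fix i assume "i \<in> c ` edges G"
  then obtain e where e: "e \<in> edges G" "c e = i" by blast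
  obtain a b where "a \<in> {1..s}" "b \<in> {1..s}" "ends G e = {#leg G a, leg G b#}"
    using core_edge_legs[OF assms e(1)] .
  then have "(a, b) \<in> snd (gcode s G c) i" using e by (auto simp: snd_gcode)
  then show "i \<in> code_colors (gcode s G c)" by (auto simp: code_colors_def)
qed

lemma code_eqI:
  assumes "\<And>a b. (a, b) \<in> fst d \<longleftrightarrow> (a, b) \<in> fst d'"
    and "\<And>i a b. (a, b) \<in> snd d i \<longleftrightarrow> (a, b) \<in> snd d' i"
  shows "d = (d'::code)"
proof (rule prod_eqI)
  show "fst d = fst d'" using assms(1) by auto
  show "snd d = snd d'" using assms(2) by (intro ext) auto
qed

lemma gcode_iso:
  assumes G: "legged_graph s G" and iso: "graph_iso s G G' f g"
    and col: "\<And>e. e \<in> edges G \<Longrightarrow> c' (g e) = c e"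
  shows "gcode s G' c' = gcode s G c"
proof (rule code_eqI)
  have inj: "inj_on f (verts G)" and E': "edges G' = g ` edges G"
    and ends: "\<And>e. e \<in> edges G \<Longrightarrow> ends G' (g e) = image_mset f (ends G e)"
    and leg: "\<And>i. i \<in> {1..s} \<Longrightarrow> leg G' i = f (leg G i)"
    using iso by (auto simp: graph_iso_def bij_betw_def)
  fix a b
  show "(a, b) \<in> fst (gcode s G' c') \<longleftrightarrow> (a, b) \<in> fst (gcode s G c)"
    using leg leg_in_verts[OF G] inj_on_eq_iff[OF inj] by (auto simp: fst_gcode)
  fix i
  have "c' (g e) = i \<and> ends G' (g e) = {#leg G' a, leg G' b#} \<longleftrightarrow>
      c e = i \<and> ends G e = {#leg G a, leg G b#}"
    if e: "e \<in> edges G" and ab: "a \<in> {1..s}" "b \<in> {1..s}" for e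
  proof -
    obtain x y where xy: "ends G e = {#x, y#}" "x \<in> verts G" "y \<in> verts G"
      using legged_graph_ends[OF G e] .
    have "leg G a \<in> verts G" "leg G b \<in> verts G" using leg_in_verts[OF G] ab by auto
    then show ?thesis
      using xy ends[OF e] leg ab col[OF e] inj_on_eq_iff[OF inj] by (simp add: pair_mset_eq_iff)
  qed
  then show "(a, b) \<in> snd (gcode s G' c') i \<longleftrightarrow> (a, b) \<in> snd (gcode s G c) i"
    unfolding snd_gcode E' by blast
qed

text \<open>Both maps are forced: a vertex goes where its legs go and an edge where its colour goes.
  The same rigidity excludes non-trivial automorphisms.\<close>

lemma gcode_eq_imp_iso:
  assumes G: "core s G" and G': "core s G'"
    and c: "inj_on c (edges G)" and c': "inj_on c' (edges G')"
    and eq: "gcode s G c = gcode s G' c'"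
  shows "\<exists>f g. graph_iso s G G' f g \<and> (\<forall>e\<in>edges G. c' (g e) = c e)"
proof -
  define f where "f v = leg G' (SOME a. a \<in> {1..s} \<and> leg G a = v)" for v
  define g where "g e = inv_into (edges G') c' (c e)" for e
  have legs: "leg G a = leg G b \<longleftrightarrow> leg G' a = leg G' b" if "a \<in> {1..s}" "b \<in> {1..s}" for a b
    using that fst_gcode[of a b s G c] fst_gcode[of a b s G' c'] by (simp add: eq)
  have f: "f (leg G a) = leg G' a" if a: "a \<in> {1..s}" for a
  proof -
    have "(SOME b. b \<in> {1..s} \<and> leg G b = leg G a) \<in> {1..s} \<and> leg G (SOME b. b \<in> {1..s} \<and> leg G b = leg G a) = leg G a"
      by (rule someI[of _ a]) (use a in simp)
    then show ?thesis unfolding f_def using legs a by blast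
  qed
  have V: "verts G = leg G ` {1..s}" "verts G' = leg G' ` {1..s}"
    using G G' by (simp_all add: core_def)
  have "inj_on f (verts G)"
    unfolding V(1) by (auto intro!: inj_onI simp: f legs)
  moreover have "f ` verts G = verts G'"
    unfolding V image_image by (intro image_cong) (auto simp: f)
  ultimately have bij_f: "bij_betw f (verts G) (verts G')" by (simp add: bij_betw_def)
  have cols: "c ` edges G = c' ` edges G'"
    using code_colors_gcode[OF G, of c] code_colors_gcode[OF G', of c'] eq by simp
  have g: "g e \<in> edges G'" "c' (g e) = c e" if "e \<in> edges G" for e
    using that cols by (auto simp: g_def intro!: inv_into_into f_inv_into_f)
  have "inj_on g (edges G)"
    using g(2) c by (auto intro!: inj_onI dest: inj_onD) (metis inj_onD)
  moreover have "e' \<in> g ` edges G" if e': "e' \<in> edges G'" for e'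
  proof -
    obtain e where e: "e \<in> edges G" "c e = c' e'" using cols e' by (metis imageE imageI)
    then have "g e = e'" using g[OF e(1)] inj_onD[OF c'] e' by metis
    then show ?thesis using e(1) by blast
  qed
  ultimately have bij_g: "bij_betw g (edges G) (edges G')"
    using g(1) by (auto simp: bij_betw_def)
  have "ends G' (g e) = image_mset f (ends G e)" if e: "e \<in> edges G" for e
  proof -
    obtain a b where ab: "a \<in> {1..s}" "b \<in> {1..s}" "ends G e = {#leg G a, leg G b#}"
      using core_edge_legs[OF G e] .
    then have "(a, b) \<in> snd (gcode s G' c') (c e)"
      using e unfolding eq[symmetric] snd_gcode by blast
    then obtain e' where e': "e' \<in> edges G'" "c' e' = c e" "ends G' e' = {#leg G' a, leg G' b#}"
      by (auto simp: snd_gcode)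
    then have "e' = g e" using g[OF e] inj_onD[OF c'] by metis
    then show ?thesis using e' ab f by simp
  qed
  then have "graph_iso s G G' f g"
    using bij_f bij_g f by (simp add: graph_iso_def)
  then show ?thesis using g(2) by blast
qed

text \<open>Being linked through \<open>Z\<close> is, read on legs, the transitive closure that
  defines \<open>merge\<close>; injectivity of \<open>c\<close> lets colours stand for edges, so
  keeping the edges outside \<open>Z\<close> and keeping their colours agree.\<close>

lemma gcode_collapse:
  assumes G: "core s G" and Z: "Z \<subseteq> edges G" and c: "inj_on c (edges G)"
  shows "gcode s (collapse G Z) c = code_restrict (gcode s G c) (c ` (edges G - Z))"
proof -
  note lg = core_legged[OF G]
  let ?d = "gcode s G c" and ?J = "c ` (edges G - Z)"
  let ?R = "fst ?d \<union> (\<Union>i\<in>- ?J. snd ?d i)"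
  have R: "(a, b) \<in> ?R \<longleftrightarrow> a \<in> {1..s} \<and> b \<in> {1..s} \<and>
      (leg G a = leg G b \<or> (\<exists>e\<in>Z. ends G e = {#leg G a, leg G b#}))" for a b
  proof -
    have "(\<exists>i\<in>- ?J. \<exists>e\<in>edges G. c e = i \<and> Q e) \<longleftrightarrow> (\<exists>e\<in>Z. Q e)" for Q
      using Z inj_on_eq_iff[OF c] by (auto 4 3)
    from this[of "\<lambda>e. ends G e = {#leg G a, leg G b#}"] show ?thesis
      by (auto simp: fst_gcode snd_gcode)
  qed
  have merge: "(a, b) \<in> merge ?d ?J \<longleftrightarrow> a \<in> {1..s} \<and> b \<in> {1..s} \<and> (leg G a, leg G b) \<in> linked G Z" for a b
  proof
    assume "(a, b) \<in> merge ?d ?J"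
    then have "(a, b) \<in> ?R\<^sup>+" by (simp add: merge_def)
    then show "a \<in> {1..s} \<and> b \<in> {1..s} \<and> (leg G a, leg G b) \<in> linked G Z"
    proof (induction rule: trancl_induct)
      case (base b)
      then show ?case
        using leg_in_verts[OF lg] unfolding R by (auto simp: linked_iff adj_def)
    next
      case (step b b')
      then have "b' \<in> {1..s}" "(leg G b, leg G b') \<in> linked G Z"
        using leg_in_verts[OF lg] unfolding R by (auto simp: linked_iff adj_def)
      with step.IH show ?case
        using linked_trans[of "leg G a" "leg G b" G Z "leg G b'"] by simp
    qed
  next
    assume *: "a \<in> {1..s} \<and> b \<in> {1..s} \<and> (leg G a, leg G b) \<in> linked G Z"
    then have "(leg G a, leg G b) \<in> (adj G Z)\<^sup>*" by (simp add: linked_iff)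
    \<comment> \<open>Strengthened to all legs at the end vertex: a path moves between vertices, and
      an intermediate vertex may carry several legs.\<close>
    then have "\<forall>b'\<in>{1..s}. leg G b' = leg G b \<longrightarrow> (a, b') \<in> ?R\<^sup>+"
    proof (induction rule: rtrancl_induct)
      case base
      have "(a, b') \<in> ?R" if "b' \<in> {1..s}" "leg G b' = leg G a" for b'
        unfolding R using that * by simp
      then show ?case by blast
    next
      case (step x y)
      obtain e where e: "e \<in> Z" "ends G e = {#x, y#}" using step.hyps(2) by (auto simp: adj_def)
      then have "x \<in> verts G" using lg Z by (force simp: legged_graph_def)
      then obtain a' where a': "a' \<in> {1..s}" "x = leg G a'" using core_vertex_leg[OF G] by metis
      have "(a', b') \<in> ?R" if "b' \<in> {1..s}" "leg G b' = y" for b'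
        unfolding R using that a' e by auto
      moreover have "(a, a') \<in> ?R\<^sup>+" using step.IH a' by blast
      ultimately show ?case by (metis trancl.trancl_into_trancl)
    qed
    then show "(a, b) \<in> merge ?d ?J" using * by (simp add: merge_def)
  qed
  define C where "C a = linked G Z ``{leg G a}" for a
  have merge_iff: "(a, b) \<in> merge ?d ?J \<longleftrightarrow> a \<in> {1..s} \<and> b \<in> {1..s} \<and> C a = C b" for a b
    using linked_class_eq_iff[of "leg G a" G "leg G b" Z] leg_in_verts[OF lg, of a] leg_in_verts[OF lg, of b]
    unfolding merge C_def by auto
  show ?thesis
  proof (rule code_eqI)
    fix a b
    show "(a, b) \<in> fst (gcode s (collapse G Z) c) \<longleftrightarrow> (a, b) \<in> fst (code_restrict ?d ?J)"
      by (simp add: fst_gcode code_restrict_def merge_iff C_def)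
    fix i
    show "(a, b) \<in> snd (gcode s (collapse G Z) c) i \<longleftrightarrow> (a, b) \<in> snd (code_restrict ?d ?J) i"
    proof
      assume "(a, b) \<in> snd (gcode s (collapse G Z) c) i"
      then obtain e where ab: "a \<in> {1..s}" "b \<in> {1..s}" and e: "e \<in> edges G" "e \<notin> Z" "c e = i"
        and ends: "image_mset (\<lambda>v. linked G Z ``{v}) (ends G e) = {#C a, C b#}"
        by (auto simp: snd_gcode C_def)
      obtain a' b' where ab': "a' \<in> {1..s}" "b' \<in> {1..s}" "ends G e = {#leg G a', leg G b'#}"
        using core_edge_legs[OF G e(1)] .
      have R: "(a', b') \<in> snd ?d i" "(b', a') \<in> snd ?d i"
        using ab' e by (auto simp: snd_gcode add_mset_commute)
      have i: "i \<in> ?J" using e by blast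
      have "{#C a', C b'#} = {#C a, C b#}" using ends ab'(3) by (simp add: C_def)
      then consider "C a = C a'" "C b' = C b" | "C a = C b'" "C a' = C b"
        by (auto simp: pair_mset_eq_iff)
      then show "(a, b) \<in> snd (code_restrict ?d ?J) i"
      proof cases
        case 1
        then have "(a, a') \<in> merge ?d ?J" "(b', b) \<in> merge ?d ?J" using ab ab' by (simp_all add: merge_iff)
        then show ?thesis using R(1) i unfolding code_restrict_def by auto
      next
        case 2
        then have "(a, b') \<in> merge ?d ?J" "(a', b) \<in> merge ?d ?J" using ab ab' by (simp_all add: merge_iff)
        then show ?thesis using R(2) i unfolding code_restrict_def by auto
      qed
    next
      assume "(a, b) \<in> snd (code_restrict ?d ?J) i"
      then obtain a' b' where i: "i \<in> ?J" and m: "(a, a') \<in> merge ?d ?J" "(b', b) \<in> merge ?d ?J"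
        and R: "(a', b') \<in> snd ?d i"
        by (auto simp: code_restrict_def split: if_splits)
      obtain e where e: "e \<in> edges G" "c e = i" "ends G e = {#leg G a', leg G b'#}"
        using R by (auto simp: snd_gcode)
      obtain e' where "e' \<in> edges G - Z" "c e' = i" using i by blast
      then have eZ: "e \<in> edges G - Z" using e inj_onD[OF c, of e e'] by auto
      have "image_mset (\<lambda>v. linked G Z ``{v}) (ends G e) = {#C a, C b#}"
        using m e(3) by (simp add: merge_iff C_def)
      then show "(a, b) \<in> snd (gcode s (collapse G Z) c) i"
        using m e(2) eZ unfolding snd_gcode merge_iff by (auto simp: C_def)
    qed
  qed
qed

text \<open>Reflexivity on the labels, transitivity, and edge relations saturated under sharing a
  vertex: from these the two identities for \<open>code_restrict\<close> below follow by relation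
  algebra, without choosing a graph.\<close>

definition wf_code :: "nat \<Rightarrow> code \<Rightarrow> bool" where
  "wf_code s d \<longleftrightarrow> fst d \<subseteq> {1..s} \<times> {1..s} \<and> Id_on {1..s} \<subseteq> fst d \<and> trans (fst d) \<and>
     (\<forall>i. snd d i \<subseteq> {1..s} \<times> {1..s}) \<and> (\<forall>i. fst d O snd d i O fst d \<subseteq> snd d i)"

lemma wf_code_gcode: "wf_code s (gcode s G c)"
  unfolding wf_code_def trans_def by (auto simp: fst_gcode snd_gcode)

lemma trancl_least: "r \<subseteq> t \<Longrightarrow> trans t \<Longrightarrow> r\<^sup>+ \<subseteq> t"
  by (metis trancl_id trancl_mono_subset)

lemma relcomp_Id_on:
  assumes "Id_on A \<subseteq> T" "r \<subseteq> A \<times> A"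
  shows "r \<subseteq> T O r O T"
  using assms by (auto simp: Id_on_def) blast

lemma trans_relcomp: "trans T \<Longrightarrow> A \<subseteq> T \<Longrightarrow> B \<subseteq> T \<Longrightarrow> A O B \<subseteq> T"
  by (auto dest: transD)

lemma code_restrict_colors:
  assumes d: "wf_code s d"
  shows "code_restrict d (code_colors d) = d"
proof -
  have "(\<Union>i\<in>- code_colors d. snd d i) = {}" by (auto simp: code_colors_def)
  then have m: "merge d (code_colors d) = fst d" using d by (simp add: merge_def wf_code_def)
  have "fst d O snd d i O fst d = snd d i" for i
    using relcomp_Id_on[of "{1..s}" "fst d" "snd d i"] d unfolding wf_code_def by blast
  then have "(if i \<in> code_colors d then fst d O snd d i O fst d else {}) = snd d i" for i
    by (auto simp: code_colors_def)
  then have "(\<lambda>i. if i \<in> code_colors d then fst d O snd d i O fst d else {}) = snd d" by (rule ext)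
  then show ?thesis unfolding code_restrict_def m by simp
qed

lemma fst_subset_merge: "fst d \<subseteq> merge d J"
  by (auto simp: merge_def)

lemma snd_subset_merge: "i \<notin> J \<Longrightarrow> snd d i \<subseteq> merge d J"
  by (auto simp: merge_def)

text \<open>Contracting in two stages. Each transitive closure contains the generators of the other,
  so \<open>?T'\<close> and \<open>?U\<close> coincide, and the inner factors \<open>?T\<close> are
  absorbed by \<open>?U\<close>.\<close>

lemma code_restrict_restrict:
  assumes d: "wf_code s d" and KJ: "K \<subseteq> J"
  shows "code_restrict (code_restrict d J) K = code_restrict d K"
proof -
  let ?T = "merge d J" and ?U = "merge d K" and ?T' = "merge (code_restrict d J) K"
  have d': "Id_on {1..s} \<subseteq> fst d" "\<And>i. snd d i \<subseteq> {1..s} \<times> {1..s}"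
    using d by (simp_all add: wf_code_def)
  have tr: "trans ?T" "trans ?U" "trans ?T'" by (simp_all add: merge_def)
  have T: "fst d \<subseteq> ?T" "\<And>i. i \<notin> J \<Longrightarrow> snd d i \<subseteq> ?T"
    and U: "fst d \<subseteq> ?U" "\<And>i. i \<notin> K \<Longrightarrow> snd d i \<subseteq> ?U"
    by (simp_all add: fst_subset_merge snd_subset_merge)
  have fst1: "fst (code_restrict d J) = ?T"
    and snd1: "\<And>i. i \<in> J \<Longrightarrow> snd (code_restrict d J) i = ?T O snd d i O ?T"
    by (simp_all add: code_restrict_def)
  have TU: "?T \<subseteq> ?U" unfolding merge_def using KJ by (intro trancl_mono_subset) auto
  \<comment> \<open>\<open>?T\<close> is reflexive on the labels, so saturating only
    enlarges.\<close>
  have expand: "snd d i \<subseteq> ?T O snd d i O ?T" for i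
    by (rule relcomp_Id_on[OF subset_trans[OF d'(1) T(1)] d'(2)])
  have "?T' \<subseteq> ?U"
  proof -
    have "?T O snd d i O ?T \<subseteq> ?U" if "i \<notin> K" for i
      using TU U(2)[OF that] tr(2) by (intro trans_relcomp)
    then have "fst (code_restrict d J) \<union> (\<Union>i\<in>- K. snd (code_restrict d J) i) \<subseteq> ?U"
      using TU by (auto simp: code_restrict_def split: if_splits)
    then show ?thesis unfolding merge_def[of "code_restrict d J"] using tr(2) by (rule trancl_least)
  qed
  moreover have "?U \<subseteq> ?T'"
  proof -
    have T'1: "?T \<subseteq> ?T'" using fst_subset_merge[of "code_restrict d J" K] by (simp add: fst1)
    have "snd d i \<subseteq> ?T'" if "i \<notin> K" for i
    proof (cases "i \<in> J")
      case True
      then show ?thesis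
        using snd_subset_merge[OF that, of "code_restrict d J"] expand[of i] by (simp add: snd1)
    next
      case False
      then show ?thesis using T(2)[OF False] T'1 by simp
    qed
    then have "fst d \<union> (\<Union>i\<in>- K. snd d i) \<subseteq> ?T'" using T(1) T'1 by blast
    then show ?thesis unfolding merge_def[of d K] using tr(3) by (rule trancl_least)
  qed
  ultimately have eq: "?T' = ?U" by blast
  have "?U O (?T O snd d i O ?T) O ?U = ?U O snd d i O ?U" for i
  proof
    have "?U O ?T \<subseteq> ?U" "?T O ?U \<subseteq> ?U" by (simp_all add: trans_relcomp[OF tr(2)] TU)
    then show "?U O (?T O snd d i O ?T) O ?U \<subseteq> ?U O snd d i O ?U" by blast
    show "?U O snd d i O ?U \<subseteq> ?U O (?T O snd d i O ?T) O ?U" using expand[of i] by blast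
  qed
  then have "(\<lambda>i. if i \<in> K then ?T' O snd (code_restrict d J) i O ?T' else {}) =
      (\<lambda>i. if i \<in> K then ?U O snd d i O ?U else {})"
    using KJ by (intro ext) (simp add: eq snd1 subset_iff)
  then show ?thesis
    unfolding code_restrict_def[of "code_restrict d J" K] code_restrict_def[of d K] eq by simp
qed

subsection \<open>Standard cycles\<close>

text \<open>Since \<open>1 mod 1 = 0\<close>, the case \<open>k = 1\<close> is a self-loop;
  \<open>k = 2\<close> gives a double edge.\<close>

definition std_cycle :: "nat \<Rightarrow> (nat \<Rightarrow> nat) \<Rightarrow> ngraph" where
  "std_cycle k L = \<lparr>verts = {..<k}, edges = {..<k}, ends = (\<lambda>j. {#j, Suc j mod k#}), leg = L\<rparr>"

lemma std_cycle_simps [simp]: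
  "verts (std_cycle k L) = {..<k}" "edges (std_cycle k L) = {..<k}"
  "ends (std_cycle k L) j = {#j, Suc j mod k#}" "leg (std_cycle k L) = L"
  by (simp_all add: std_cycle_def)

lemma core_std_cycle:
  assumes k: "0 < k" and L: "L ` {1..s} = {..<k}"
  shows "core s (std_cycle k L)"
proof -
  let ?G = "std_cycle k L"
  have "connected_by ?G (edges ?G - {e})" if e: "e < k" for e
  proof -
    let ?r = "Suc e mod k"
    have reach: "(?r, (Suc e + j) mod k) \<in> (adj ?G ({..<k} - {e}))\<^sup>*" if "j < k" for j
      using that
    proof (induction j)
      case (Suc j)
      let ?x = "(Suc e + j) mod k"
      have "?x \<noteq> e"
      proof (cases "Suc e + j < k")
        case False
        then have "?x = Suc e + j - k" using e Suc.prems by (simp add: mod_if)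
        then show ?thesis using e Suc.prems False by simp
      qed simp
      then have "(?x, Suc ?x mod k) \<in> adj ?G ({..<k} - {e})" using k by (auto simp: adj_def)
      moreover have "Suc ?x mod k = (Suc e + Suc j) mod k" by (simp add: mod_Suc_eq)
      ultimately have "(?x, (Suc e + Suc j) mod k) \<in> adj ?G ({..<k} - {e})" by simp
      with Suc show ?case by (meson Suc_lessD rtrancl.rtrancl_into_rtrancl)
    qed simp
    have "(?r, v) \<in> linked ?G (edges ?G - {e})" if "v < k" for v
    proof -
      \<comment> \<open>The number of steps from \<open>Suc e\<close> to \<open>v\<close>; adding
        \<open>k - Suc e\<close> replaces a subtraction that could be negative.\<close>
      let ?j = "(v + (k - Suc e)) mod k"
      have "(Suc e + ?j) mod k = (Suc e + (v + (k - Suc e))) mod k" by (rule mod_add_right_eq)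
      also have "Suc e + (v + (k - Suc e)) = v + k" using e by simp
      also have "(v + k) mod k = v" using that by simp
      finally show ?thesis using reach[of ?j] that k by (simp add: linked_iff)
    qed
    then show ?thesis
      unfolding connected_by_def using linked_sym linked_trans by (metis lessThan_iff std_cycle_simps(1))
  qed
  moreover have "legged_graph s ?G" using k L by (auto simp: legged_graph_def)
  ultimately show ?thesis using L by (simp add: core_def)
qed

text \<open>A marked cycle: starting vertex and direction are still part of the data, so in general
  a code arises from several pairs.\<close>

definition cycle_data :: "nat \<Rightarrow> nat \<Rightarrow> ((nat \<Rightarrow> nat) \<times> (nat \<Rightarrow> nat)) set" where
  "cycle_data s k = {(L, e). L \<in> {1..s} \<rightarrow>\<^sub>E {..<k} \<and> L ` {1..s} = {..<k} \<and>
     e \<in> {..<k} \<rightarrow>\<^sub>E {1..s} \<and> inj_on e {..<k}}"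

definition cells :: "nat \<Rightarrow> nat \<Rightarrow> code set" where
  "cells s k = (\<lambda>(L, e). gcode s (std_cycle k L) e) ` cycle_data s k"

definition all_cells :: "nat \<Rightarrow> code set" where
  "all_cells s = (\<Union>k\<in>{1..s}. cells s k)"

lemma finite_cycle_data: "finite (cycle_data s k)"
proof (rule finite_subset)
  show "cycle_data s k \<subseteq> ({1..s} \<rightarrow>\<^sub>E {..<k}) \<times> ({..<k} \<rightarrow>\<^sub>E {1..s})" by (auto simp: cycle_data_def)
qed (intro finite_cartesian_product finite_PiE finite_lessThan finite_atLeastAtMost)

lemma finite_cells: "finite (cells s k)"
  by (simp add: cells_def finite_cycle_data)

lemma all_cells_obtain:
  assumes "d \<in> all_cells s"
  obtains G c where "core s G" "c \<in> holocolorings s G" "d = gcode s G c"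
proof -
  obtain k L e where k: "k \<in> {1..s}" "(L, e) \<in> cycle_data s k" "d = gcode s (std_cycle k L) e"
    using assms by (auto simp: all_cells_def cells_def)
  then have "core s (std_cycle k L)" by (intro core_std_cycle) (auto simp: cycle_data_def)
  moreover have "e \<in> holocolorings s (std_cycle k L)"
    using k by (auto simp: cycle_data_def holocolorings_def)
  ultimately show ?thesis using that k by blast
qed

text \<open>A cycle through all of \<open>G\<close> numbers vertices and edges by position, which
  transports \<open>G\<close> and \<open>c\<close> to a standard cycle.\<close>

lemma gcode_in_all_cells:
  fixes G :: "('v, 'e) mgraph"
  assumes G: "core s G" and c: "inj_on c (edges G)" "c ` edges G \<subseteq> {1..s}"
  shows "gcode s G c \<in> all_cells s"
proof -
  obtain vs es where cyc: "is_cycle G vs es" using core_has_cycle[OF G] by blast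
  note ex = core_cycle_exhausts[OF G cyc]
  define k where "k = length es"
  have C: "k > 0" "length vs = k" "distinct vs" "distinct es"
    "\<And>i. i < k \<Longrightarrow> ends G (es ! i) = {#vs ! i, vs ! (Suc i mod k)#}"
    using cyc by (auto simp: is_cycle_def k_def)
  have bij: "bij_betw ((!) vs) {..<k} (verts G)" "bij_betw ((!) es) {..<k} (edges G)"
    using C ex by (auto simp: k_def intro!: bij_betw_nth)
  define L where "L = (\<lambda>a\<in>{1..s}. inv_into {..<k} ((!) vs) (leg G a))"
  define e where "e = (\<lambda>i\<in>{..<k}. c (es ! i))"
  have inv: "bij_betw (inv_into {..<k} ((!) vs)) (verts G) {..<k}"
    using bij(1) by (rule bij_betw_inv_into)
  have V: "verts G = leg G ` {1..s}" using G by (simp add: core_def)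
  have L_image: "L ` {1..s} = {..<k}"
  proof -
    have "L ` {1..s} = inv_into {..<k} ((!) vs) ` verts G"
      unfolding V image_image by (intro image_cong) (auto simp: L_def)
    then show ?thesis using inv by (simp add: bij_betw_def)
  qed
  have vs_L: "vs ! L a = leg G a" if "a \<in> {1..s}" for a
  proof -
    have "leg G a \<in> (!) vs ` {..<k}" using that V bij(1) by (auto simp: bij_betw_def)
    then show ?thesis using that by (simp add: L_def f_inv_into_f)
  qed
  have e_img: "e ` {..<k} = c ` edges G"
  proof -
    have "e ` {..<k} = c ` (!) es ` {..<k}" unfolding image_image by (intro image_cong) (auto simp: e_def)
    then show ?thesis using bij(2) by (simp add: bij_betw_def)
  qed
  have "inj_on (c \<circ> (!) es) {..<k}"
    using bij(2) c(1) by (intro comp_inj_on) (auto simp: bij_betw_def)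
  then have e_inj: "inj_on e {..<k}" by (simp add: e_def inj_on_def)
  have data: "(L, e) \<in> cycle_data s k"
    using L_image e_img e_inj c(2) unfolding cycle_data_def by (auto simp: L_def e_def)
  have eq: "gcode s G c = gcode s (std_cycle k L) e"
  proof (rule gcode_iso)
    show "legged_graph s (std_cycle k L)" using core_std_cycle[OF C(1) L_image] by (rule core_legged)
    show "graph_iso s (std_cycle k L) G ((!) vs) ((!) es)"
      using bij C(5) vs_L by (simp add: graph_iso_def)
    show "c (es ! i) = e i" if "i \<in> edges (std_cycle k L)" for i
      using that by (simp add: e_def)
  qed
  \<comment> \<open>Distinct edges have distinct colours among \<open>{1..s}\<close>, which bounds
    the length of the cycle.\<close>
  have k: "k \<in> {1..s}"
  proof -
    have "card (e ` {..<k}) = k" using e_inj by (simp add: card_image)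
    moreover have "card (e ` {..<k}) \<le> card {1..s}" using e_img c(2) by (intro card_mono) auto
    ultimately show ?thesis using C(1) by simp
  qed
  have "gcode s G c \<in> cells s k"
    unfolding cells_def eq by (rule image_eqI[OF _ data]) simp
  then show ?thesis unfolding all_cells_def using k by (rule UN_I[rotated])
qed

lemma code_restrict_gcode:
  assumes G: "core s G" and c: "c \<in> holocolorings s G"
    and J: "J \<subseteq> code_colors (gcode s G c)" "J \<noteq> {}"
  shows "code_restrict (gcode s G c) J \<in> all_cells s"
    and "code_colors (code_restrict (gcode s G c) J) = J"
proof -
  have inj: "inj_on c (edges G)" "c ` edges G \<subseteq> {1..s}" using c by (auto simp: holocolorings_def)
  define Z where "Z = {e\<in>edges G. c e \<notin> J}"
  have JE: "J \<subseteq> c ` edges G" using J(1) code_colors_gcode[OF G] by simp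
  have Z: "Z \<subseteq> edges G" "c ` (edges G - Z) = J" using JE by (auto simp: Z_def)
  then have "Z \<noteq> edges G" using J(2) by auto
  then have core: "core s (collapse G Z)" by (rule core_collapse[OF G Z(1)])
  have eq: "code_restrict (gcode s G c) J = gcode s (collapse G Z) c"
    using gcode_collapse[OF G Z(1) inj(1)] Z(2) by simp
  show "code_restrict (gcode s G c) J \<in> all_cells s"
    unfolding eq using core inj by (intro gcode_in_all_cells) (auto intro: inj_on_subset)
  show "code_colors (code_restrict (gcode s G c) J) = J"
    unfolding eq code_colors_gcode[OF core] using Z(2) by simp
qed

lemma simplex_complex_cells: "simplex_complex (all_cells s) code_colors code_restrict"
proof
  show "finite (all_cells s)" by (simp add: all_cells_def finite_cells)
next
  fix d assume d: "d \<in> all_cells s"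
  obtain G c where G: "core s G" "c \<in> holocolorings s G" "d = gcode s G c"
    using all_cells_obtain[OF d] by blast
  then show "finite (code_colors d)" "code_colors d \<noteq> {}"
    using core_edges_ne[OF G(1)] core_legged[OF G(1)] by (simp_all add: code_colors_gcode legged_graph_def)
  show "code_restrict d (code_colors d) = d" using code_restrict_colors G wf_code_gcode by blast
  fix J :: "nat set" assume J: "J \<subseteq> code_colors d" "J \<noteq> {}"
  then show "code_restrict d J \<in> all_cells s" "code_colors (code_restrict d J) = J"
    using code_restrict_gcode G by simp_all
next
  fix d and J K :: "nat set" assume "d \<in> all_cells s" "K \<subseteq> J"
  then show "code_restrict (code_restrict d J) K = code_restrict d K"
    using code_restrict_restrict wf_code_gcode by (metis all_cells_obtain)
qed

section \<open>The moduli space as a simplex complex\<close>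

text \<open>Under an injective colouring the sum has at most one term; it is a way of giving absent
  colours the length 0.\<close>

definition color_length :: "('v, 'e) mgraph \<Rightarrow> ('e \<Rightarrow> nat) \<Rightarrow> ('e \<Rightarrow> real) \<Rightarrow> nat \<Rightarrow> real" where
  "color_length G c l i = (\<Sum>e\<in>{e\<in>edges G. c e = i}. l e)"

definition norm_length :: "('v, 'e) mgraph \<Rightarrow> ('e \<Rightarrow> nat) \<Rightarrow> ('e \<Rightarrow> real) \<Rightarrow> nat \<Rightarrow> real" where
  "norm_length G c l i = color_length G c l i / (\<Sum>e\<in>edges G. l e)"

abbreviation reduce :: "ngraph \<Rightarrow> (nat \<Rightarrow> real) \<Rightarrow> (nat set, nat) mgraph" where
  "reduce G l \<equiv> collapse G (zero_edges G l)"

abbreviation live :: "ngraph \<Rightarrow> (nat \<Rightarrow> real) \<Rightarrow> nat set" where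
  "live G l \<equiv> edges G - zero_edges G l"

lemma color_length_color:
  assumes "inj_on c (edges G)" "e \<in> edges G"
  shows "color_length G c l (c e) = l e"
proof -
  have "{e'\<in>edges G. c e' = c e} = {e}" using assms inj_onD by fastforce
  then show ?thesis by (simp add: color_length_def)
qed

lemma color_length_other: "i \<notin> c ` edges G \<Longrightarrow> color_length G c l i = 0"
  unfolding color_length_def by (rule sum.neutral) blast

section \<open>The moduli space in coordinates\<close>

context
  fixes s :: nat
begin

interpretation C: simplex_complex "all_cells s" code_colors code_restrict
  by (rule simplex_complex_cells)

private abbreviation "pt \<equiv> simplex_complex.point (all_cells s) code_colors code_restrict"
private abbreviation "S \<equiv> simplex_complex.space (all_cells s) code_colors code_restrict (all_cells s)"

definition encode :: "mhg_triple \<Rightarrow> code \<Rightarrow> real" where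
  "encode = (\<lambda>(G, l, c). pt (gcode s G c) (norm_length G c l))"

lemma mhg_triples_iff:
  "(G, l, c) \<in> mhg_triples s \<longleftrightarrow> core s G \<and> c \<in> holocolorings s G \<and>
    l \<in> edges G \<rightarrow>\<^sub>E {0..} \<and> zero_edges G l \<noteq> edges G"
  using forest_core_iff[of s G "zero_edges G l"]
  by (auto simp: mhg_triples_def one_loop_graphs_eq regular_metrics_def zero_edges_def)

lemma down_closed_all: "C.down_closed (all_cells s)"
  by (auto simp: C.down_closed_def C.face_def)

context
  fixes G :: ngraph and l :: "nat \<Rightarrow> real" and c :: "nat \<Rightarrow> nat"
  assumes triple: "(G, l, c) \<in> mhg_triples s"
begin

lemma triple_core: "core s G" and triple_color: "c \<in> holocolorings s G"
  and triple_metric: "l \<in> edges G \<rightarrow>\<^sub>E {0..}" and triple_zero: "zero_edges G l \<noteq> edges G"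
  using triple by (simp_all add: mhg_triples_iff)

lemma triple_inj: "inj_on c (edges G)" and triple_colors: "c ` edges G \<subseteq> {1..s}"
  using triple_color by (auto simp: holocolorings_def)

lemma triple_finite: "finite (edges G)"
  using core_legged[OF triple_core] by (simp add: legged_graph_def)

lemma triple_nonneg: "e \<in> edges G \<Longrightarrow> 0 \<le> l e"
  using triple_metric by auto

lemma triple_pos: "e \<in> live G l \<Longrightarrow> 0 < l e"
  using triple_nonneg[of e] by (auto simp: zero_edges_def less_le)

lemma total_pos: "0 < (\<Sum>e\<in>edges G. l e)"
proof -
  obtain e where e: "e \<in> live G l" using triple_zero by (auto simp: zero_edges_def)
  then have "l e \<le> (\<Sum>e\<in>edges G. l e)"
    using triple_finite triple_nonneg by (intro member_le_sum) auto
  then show ?thesis using triple_pos[OF e] by simp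
qed

lemma norm_length_color: "e \<in> edges G \<Longrightarrow> norm_length G c l (c e) = l e / (\<Sum>e\<in>edges G. l e)"
  by (simp add: norm_length_def color_length_color[OF triple_inj])

lemma norm_length_zero:
  assumes "i \<notin> c ` (live G l)"
  shows "norm_length G c l i = 0"
proof (cases "i \<in> c ` edges G")
  case True
  then obtain e where "e \<in> edges G" "i = c e" by blast
  then show ?thesis using assms norm_length_color[of e] by (auto simp: zero_edges_def)
qed (simp add: norm_length_def color_length_other)

lemma norm_length_pos:
  "i \<in> c ` (live G l) \<Longrightarrow> 0 < norm_length G c l i"
  using triple_pos total_pos norm_length_color by auto

lemma norm_length_simplex: "norm_length G c l \<in> bary_simplex (c ` (live G l))"
proof -
  let ?E = "live G l"
  have "sum (norm_length G c l) (c ` ?E) = (\<Sum>e\<in>?E. norm_length G c l (c e))"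
    using triple_inj by (intro sum.reindex_cong[of c]) (auto intro: inj_on_subset)
  also have "\<dots> = (\<Sum>e\<in>?E. l e) / (\<Sum>e\<in>edges G. l e)"
    by (simp add: norm_length_color sum_divide_distrib)
  also have "(\<Sum>e\<in>?E. l e) = (\<Sum>e\<in>edges G. l e)"
    using triple_finite by (intro sum.mono_neutral_left) (auto simp: zero_edges_def)
  finally have "sum (norm_length G c l) (c ` ?E) = 1" using total_pos by simp
  moreover have "0 \<le> norm_length G c l i" for i
    using norm_length_pos[of i] norm_length_zero[of i] by fastforce
  ultimately show ?thesis using norm_length_zero by (simp add: bary_simplex_def)
qed

lemma triple_collapse_core: "core s (reduce G l)"
  using triple_core triple_zero by (intro core_collapse) (auto simp: zero_edges_def)

lemma reduced_colors:
  "code_colors (gcode s (reduce G l) c) = c ` (live G l)"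
  by (simp add: code_colors_gcode[OF triple_collapse_core])

lemma reduced_in_cells: "gcode s (reduce G l) c \<in> all_cells s"
  using triple_collapse_core triple_inj triple_colors
  by (intro gcode_in_all_cells) (auto intro: inj_on_subset)

lemma gcode_in_cells: "gcode s G c \<in> all_cells s"
  using triple_core triple_inj triple_colors by (intro gcode_in_all_cells)

text \<open>\<open>encode\<close> uses the uncontracted graph, whose code is constant on each
  simplex, which suits continuity. The contracted form proved here depends only on what
  \<open>mhg_rel\<close> preserves.\<close>

lemma encode_reduced:
  "encode (G, l, c) = pt (gcode s (reduce G l) c) (norm_length G c l)"
proof -
  have "gcode s (reduce G l) c =
      code_restrict (gcode s G c) (c ` (live G l))"
    using triple_core triple_inj by (intro gcode_collapse) (auto simp: zero_edges_def)
  moreover have "c ` (live G l) \<subseteq> code_colors (gcode s G c)"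
    by (auto simp: code_colors_gcode[OF triple_core])
  ultimately show ?thesis
    using C.point_restr[OF gcode_in_cells _ norm_length_simplex] by (simp add: encode_def)
qed

lemma encode_in: "encode (G, l, c) \<in> S"
  unfolding encode_reduced C.space_def
  by (rule UN_I[OF reduced_in_cells imageI]) (simp add: norm_length_simplex reduced_colors)

end

lemma norm_length_eq:
  assumes x: "(G, l, c) \<in> mhg_triples s" and x': "(G', l', c') \<in> mhg_triples s"
    and g: "bij_betw g (live G l) (live G' l')"
    and a: "0 < a" "\<forall>e\<in>live G l. l' (g e) = a * l e \<and> c' (g e) = c e"
  shows "norm_length G' c' l' = norm_length G c l"
proof
  let ?E = "live G l" and ?E' = "live G' l'"
  have E': "?E' = g ` ?E" using g by (simp add: bij_betw_def)
  have "(\<Sum>e\<in>edges G'. l' e) = (\<Sum>e\<in>?E'. l' e)"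
    using triple_finite[OF x'] by (intro sum.mono_neutral_right) (auto simp: zero_edges_def)
  also have "\<dots> = (\<Sum>e\<in>?E. l' (g e))" using sum.reindex_bij_betw[OF g, of l'] by simp
  also have "\<dots> = a * (\<Sum>e\<in>?E. l e)" using a(2) by (simp add: sum_distrib_left)
  also have "(\<Sum>e\<in>?E. l e) = (\<Sum>e\<in>edges G. l e)"
    using triple_finite[OF x] by (intro sum.mono_neutral_left) (auto simp: zero_edges_def)
  finally have total: "(\<Sum>e\<in>edges G'. l' e) = a * (\<Sum>e\<in>edges G. l e)" .
  fix i
  have cols: "c' ` ?E' = c ` ?E" unfolding E' image_image using a(2) by (intro image_cong) auto
  show "norm_length G' c' l' i = norm_length G c l i"
  proof (cases "i \<in> c ` ?E")
    case True
    then obtain e where e: "e \<in> ?E" "i = c e" by blast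
    then have "g e \<in> edges G'" using E' by blast
    then have "norm_length G' c' l' (c' (g e)) = l' (g e) / (a * (\<Sum>e\<in>edges G. l e))"
      using norm_length_color[OF x', of "g e"] by (simp add: total)
    then show ?thesis using norm_length_color[OF x, of e] a e by auto
  next
    case False
    then show ?thesis using norm_length_zero[OF x False] norm_length_zero[OF x', of i] cols by simp
  qed
qed

text \<open>After contraction all lengths are positive, so a point determines its open cell and its
  barycentric coordinates; equality of codes then means isomorphism, and equality of normalised
  lengths means proportionality.\<close>

lemma encode_eq_iff:
  assumes x: "(G, l, c) \<in> mhg_triples s" and x': "(G', l', c') \<in> mhg_triples s"
  shows "encode (G, l, c) = encode (G', l', c') \<longleftrightarrow> ((G, l, c), (G', l', c')) \<in> mhg_rel s"
proof
  let ?K = "reduce G l" and ?K' = "reduce G' l'"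
  let ?L = "\<Sum>e\<in>edges G. l e" and ?L' = "\<Sum>e\<in>edges G'. l' e"
  assume "encode (G, l, c) = encode (G', l', c')"
  then have "gcode s ?K c = gcode s ?K' c' \<and> norm_length G c l = norm_length G' c' l'"
    unfolding encode_reduced[OF x] encode_reduced[OF x']
    using norm_length_simplex[OF x] norm_length_simplex[OF x'] norm_length_pos[OF x] norm_length_pos[OF x']
    by (intro C.point_eq_imp_eq reduced_in_cells x x') (simp_all add: reduced_colors[OF x] reduced_colors[OF x'])
  then have eq: "gcode s ?K c = gcode s ?K' c'" "norm_length G c l = norm_length G' c' l'" by simp_all
  have "inj_on c (edges ?K)" "inj_on c' (edges ?K')"
    using triple_inj[OF x] triple_inj[OF x'] by (auto intro: inj_on_subset)
  then obtain f g where iso: "graph_iso s ?K ?K' f g" and g: "\<forall>e\<in>edges ?K. c' (g e) = c e"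
    using gcode_eq_imp_iso[OF triple_collapse_core[OF x] triple_collapse_core[OF x'] _ _ eq(1)] by blast
  \<comment> \<open>The scaling constant is the ratio of the total lengths.\<close>
  have "l' (g e) = ?L' / ?L * l e" if e: "e \<in> live G l" for e
  proof -
    have "g e \<in> edges ?K'" using iso e by (auto simp: graph_iso_def bij_betw_def)
    then have "l' (g e) / ?L' = norm_length G' c' l' (c' (g e))"
      using norm_length_color[OF x', of "g e"] by simp
    also have "c' (g e) = c e" using g e by simp
    also have "norm_length G' c' l' (c e) = l e / ?L"
      using norm_length_color[OF x, of e] e eq(2) by simp
    finally show ?thesis using total_pos[OF x] total_pos[OF x'] by (simp add: field_simps)
  qed
  moreover have "0 < ?L' / ?L" using total_pos[OF x] total_pos[OF x'] by simp
  ultimately have "\<exists>f g a. graph_iso s ?K ?K' f g \<and> 0 < a \<and>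
      (\<forall>e \<in> live G l. l' (g e) = a * l e \<and> c' (g e) = c e)"
    using iso g by (intro exI[of _ f] exI[of _ g] exI[of _ "?L' / ?L"]) simp
  then show "((G, l, c), (G', l', c')) \<in> mhg_rel s"
    using x x' by (simp add: mhg_rel_def)
next
  let ?K = "reduce G l" and ?K' = "reduce G' l'"
  assume "((G, l, c), (G', l', c')) \<in> mhg_rel s"
  then obtain f g a where iso: "graph_iso s ?K ?K' f g" and a: "0 < a"
    "\<forall>e \<in> live G l. l' (g e) = a * l e \<and> c' (g e) = c e"
    by (auto simp: mhg_rel_def)
  have "gcode s ?K' c' = gcode s ?K c"
    using a(2) by (intro gcode_iso[OF core_legged[OF triple_collapse_core[OF x]] iso]) auto
  moreover have "norm_length G' c' l' = norm_length G c l"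
    using x x' _ a by (rule norm_length_eq) (use iso in \<open>simp add: graph_iso_def\<close>)
  ultimately show "encode (G, l, c) = encode (G', l', c')"
    by (simp add: encode_reduced[OF x] encode_reduced[OF x'])
qed

text \<open>The classes are the fibres of \<open>encode\<close>; this takes the place of a separate
  proof that \<open>mhg_rel\<close> is an equivalence.\<close>

lemma mhg_class_eq:
  assumes "x \<in> mhg_triples s"
  shows "mhg_rel s ``{x} = {y \<in> mhg_triples s. encode y = encode x}"
proof -
  obtain G l c where x: "x = (G, l, c)" by (metis prod_cases3)
  have "(x, y) \<in> mhg_rel s \<longleftrightarrow> y \<in> mhg_triples s \<and> encode y = encode x" for y
  proof -
    obtain G' l' c' where y: "y = (G', l', c')" by (metis prod_cases3)
    show ?thesis
    proof (cases "y \<in> mhg_triples s")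
      case True
      then show ?thesis using encode_eq_iff[of G l c G' l' c'] assms unfolding x y by auto
    next
      case False
      then show ?thesis unfolding x y mhg_rel_def by simp
    qed
  qed
  then show ?thesis by auto
qed

definition class_coord :: "mhg_triple set \<Rightarrow> code \<Rightarrow> real" where
  "class_coord K = encode (SOME x. x \<in> K)"

lemma class_coord_class:
  assumes "x \<in> mhg_triples s"
  shows "class_coord (mhg_rel s ``{x}) = encode x"
proof -
  let ?K = "mhg_rel s ``{x}"
  have "x \<in> ?K" using mhg_class_eq[OF assms] assms by simp
  then have "(SOME y. y \<in> ?K) \<in> ?K" by (rule someI)
  then show ?thesis using mhg_class_eq[OF assms] by (simp add: class_coord_def)
qed

lemma mhg_points_obtain:
  assumes "K \<in> mhg_points s"
  obtains x where "x \<in> mhg_triples s" "K = mhg_rel s ``{x}"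
  using assms by (auto simp: mhg_points_def elim: quotientE)

lemma class_coord_inj:
  assumes "K \<in> mhg_points s" "K' \<in> mhg_points s" "class_coord K = class_coord K'"
  shows "K = K'"
proof -
  obtain x where x: "x \<in> mhg_triples s" "K = mhg_rel s ``{x}" using mhg_points_obtain[OF assms(1)] .
  obtain x' where x': "x' \<in> mhg_triples s" "K' = mhg_rel s ``{x'}" using mhg_points_obtain[OF assms(2)] .
  have "encode x = encode x'" using assms(3) x x' by (simp add: class_coord_class)
  then show ?thesis unfolding x(2) x'(2) mhg_class_eq[OF x(1)] mhg_class_eq[OF x'(1)] by simp
qed

section \<open>Continuity of the coordinates\<close>

lemma topspace_metric_simplex:
  "topspace (metric_simplex G) = {l \<in> regular_metrics G. (\<Sum>e\<in>edges G. l e) = 1}"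
  by (auto simp: metric_simplex_def regular_metrics_def PiE_def)

lemma topspace_mhg_simplices:
  "((G, c), l) \<in> topspace (mhg_simplices s) \<longleftrightarrow> (G, l, c) \<in> mhg_triples s \<and> (\<Sum>e\<in>edges G. l e) = 1"
  by (auto simp: mhg_simplices_def mhg_triples_def topspace_metric_simplex)

lemma mhg_proj_in: "z \<in> topspace (mhg_simplices s) \<Longrightarrow> mhg_proj s z \<in> mhg_points s"
  by (cases z) (auto simp: topspace_mhg_simplices mhg_proj_def mhg_points_def intro!: quotientI)

lemma topspace_MHG1: "topspace (MHG1 s) = mhg_points s"
proof -
  have "{z \<in> topspace (mhg_simplices s). mhg_proj s z \<in> mhg_points s} = topspace (mhg_simplices s)"
    using mhg_proj_in by blast
  then have "openin (MHG1 s) (mhg_points s)" by (simp add: MHG1_def openin_coinduced_topology)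
  moreover have "U \<subseteq> mhg_points s" if "openin (MHG1 s) U" for U
    using that by (simp add: MHG1_def openin_coinduced_topology)
  ultimately show ?thesis by (meson openin_subset openin_topspace subset_antisym)
qed

lemma continuous_map_proj: "continuous_map (mhg_simplices s) (MHG1 s) (mhg_proj s)"
  unfolding continuous_map topspace_MHG1
  using mhg_proj_in by (auto simp: MHG1_def openin_coinduced_topology)

lemma continuous_map_metric_coord:
  "e \<in> edges G \<Longrightarrow> continuous_map (metric_simplex G) euclideanreal (\<lambda>l. l e)"
  unfolding metric_simplex_def by (rule continuous_map_from_subtopology) (rule continuous_map_product_projection)

lemma continuous_map_encode:
  assumes G: "core s G" and c: "c \<in> holocolorings s G"
  shows "continuous_map (metric_simplex G) (top_of_set S) (\<lambda>l. encode (G, l, c))"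
proof -
  have fin: "finite (edges G)" using core_legged[OF G] by (simp add: legged_graph_def)
  have triple: "(G, l, c) \<in> mhg_triples s" if "l \<in> topspace (metric_simplex G)" for l
    using that G c by (auto simp: topspace_metric_simplex mhg_triples_def one_loop_graphs_eq)
  have len: "continuous_map (metric_simplex G) euclideanreal (\<lambda>l. norm_length G c l i)" for i
  proof -
    have "continuous_map (metric_simplex G) euclideanreal (\<lambda>l. color_length G c l i)"
      unfolding color_length_def using fin
      by (intro continuous_map_sum continuous_map_metric_coord) auto
    \<comment> \<open>The total length is 1 on this simplex, so normalising changes nothing
      there.\<close>
    then show ?thesis
      by (rule continuous_map_eq) (simp add: topspace_metric_simplex norm_length_def)
  qed
  have "continuous_map (metric_simplex G) euclideanreal (\<lambda>l. encode (G, l, c) \<tau>)" for \<tau>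
  proof (cases "C.face \<tau> (gcode s G c)")
    case True
    then have "\<tau> \<in> all_cells s" by (simp add: C.face_def)
    then have "continuous_map (metric_simplex G) euclideanreal
        (\<lambda>l. Min ((\<lambda>i. norm_length G c l i) ` code_colors \<tau>))"
      by (intro continuous_map_Min_image len C.fin_col C.col_ne)
    then show ?thesis using True by (simp add: encode_def C.point_def)
  qed (simp add: encode_def C.point_def)
  then have "continuous_map (metric_simplex G) euclidean (\<lambda>l. encode (G, l, c))"
    unfolding euclidean_product_topology[symmetric] continuous_map_componentwise_UNIV by blast
  moreover have "(\<lambda>l. encode (G, l, c)) \<in> topspace (metric_simplex G) \<rightarrow> S"
    using encode_in[OF triple] by blast
  ultimately show ?thesis by (simp add: continuous_map_in_subtopology image_subset_iff_funcset)
qed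

text \<open>The universal property of the quotient: pulled back to one simplex,
  \<open>class_coord\<close> becomes \<open>encode\<close>, which is continuous.\<close>

lemma continuous_map_class_coord: "continuous_map (MHG1 s) (top_of_set S) class_coord"
  unfolding continuous_map
proof (intro conjI allI impI)
  show "class_coord ` topspace (MHG1 s) \<subseteq> topspace (top_of_set S)"
  proof
    fix y assume "y \<in> class_coord ` topspace (MHG1 s)"
    then obtain K where K: "K \<in> mhg_points s" "y = class_coord K" unfolding topspace_MHG1 by blast
    obtain x where x: "x \<in> mhg_triples s" "K = mhg_rel s ``{x}" using mhg_points_obtain[OF K(1)] .
    obtain G l c where "x = (G, l, c)" by (metis prod_cases3)
    then show "y \<in> topspace (top_of_set S)" using K(2) x encode_in[of G l c] by (simp add: class_coord_class)
  qed
  fix U assume U: "openin (top_of_set S) U"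
  have "{l. ((G, c), l) \<in> topspace (mhg_simplices s) \<and>
        mhg_proj s ((G, c), l) \<in> {K \<in> topspace (MHG1 s). class_coord K \<in> U}} =
      {l \<in> topspace (metric_simplex G). encode (G, l, c) \<in> U}"
    if G: "core s G" "c \<in> holocolorings s G" for G c
  proof -
    have "class_coord (mhg_proj s ((G, c), l)) = encode (G, l, c)"
      if "((G, c), l) \<in> topspace (mhg_simplices s)" for l
      using that class_coord_class[of "(G, l, c)"] by (simp add: topspace_mhg_simplices mhg_proj_def)
    moreover have "((G, c), l) \<in> topspace (mhg_simplices s) \<longleftrightarrow> l \<in> topspace (metric_simplex G)" for l
      using G by (auto simp: mhg_simplices_def one_loop_graphs_eq)
    ultimately show ?thesis
      using mhg_proj_in[of "((G, c), _)"] unfolding topspace_MHG1 by auto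
  qed
  moreover have "openin (metric_simplex G) {l \<in> topspace (metric_simplex G). encode (G, l, c) \<in> U}"
    if "core s G" "c \<in> holocolorings s G" for G c
    using continuous_map_encode[OF that] U by (rule openin_continuous_map_preimage)
  ultimately have "openin (mhg_simplices s) {z \<in> topspace (mhg_simplices s).
      mhg_proj s z \<in> {K \<in> topspace (MHG1 s). class_coord K \<in> U}}"
    unfolding mhg_simplices_def openin_sum_topology by (auto simp: one_loop_graphs_eq)
  then show "openin (MHG1 s) {K \<in> topspace (MHG1 s). class_coord K \<in> U}"
    unfolding MHG1_def openin_coinduced_topology using topspace_MHG1 by (auto simp: MHG1_def)
qed

section \<open>The inverse of the coordinates, cell by cell\<close>

definition rep :: "code \<Rightarrow> ngraph \<times> (nat \<Rightarrow> nat)" where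
  "rep d = (SOME p. core s (fst p) \<and> snd p \<in> holocolorings s (fst p) \<and> gcode s (fst p) (snd p) = d)"

lemma rep:
  assumes "d \<in> all_cells s"
  shows "core s (fst (rep d))" "snd (rep d) \<in> holocolorings s (fst (rep d))"
    "gcode s (fst (rep d)) (snd (rep d)) = d"
proof -
  obtain G c where Gc: "core s G" "c \<in> holocolorings s G" "d = gcode s G c"
    using all_cells_obtain[OF assms] .
  let ?P = "\<lambda>p. core s (fst p) \<and> snd p \<in> holocolorings s (fst p) \<and> gcode s (fst p) (snd p) = d"
  have "?P (G, c)" using Gc by simp
  then have "?P (rep d)" unfolding rep_def by (rule someI[of ?P])
  then show "core s (fst (rep d))" "snd (rep d) \<in> holocolorings s (fst (rep d))"
    "gcode s (fst (rep d)) (snd (rep d)) = d" by simp_all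
qed

text \<open>The edge of a given colour gets as length the coordinate at the vertex of that colour,
  which is its barycentric coordinate by \<open>point_vertex\<close>. On a closed cell the inverse
  of \<open>encode\<close> is therefore a coordinate projection.\<close>

definition cell_metric :: "code \<Rightarrow> (code \<Rightarrow> real) \<Rightarrow> nat \<Rightarrow> real" where
  "cell_metric d y = (\<lambda>e\<in>edges (fst (rep d)). y (code_restrict d {snd (rep d) e}))"

definition cell_class :: "code \<Rightarrow> (code \<Rightarrow> real) \<Rightarrow> mhg_triple set" where
  "cell_class d y = mhg_proj s (rep d, cell_metric d y)"

lemma cell_metric:
  assumes d: "d \<in> all_cells s" and y: "y \<in> C.space (C.faces d)"
  shows "cell_metric d y \<in> topspace (metric_simplex (fst (rep d)))"
    and "(fst (rep d), cell_metric d y, snd (rep d)) \<in> mhg_triples s"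
    and "encode (fst (rep d), cell_metric d y, snd (rep d)) = y"
proof -
  obtain G c where r: "rep d = (G, c)" by fastforce
  have G: "core s G" "c \<in> holocolorings s G" "gcode s G c = d" using rep[OF d] by (simp_all add: r)
  have inj: "inj_on c (edges G)" using G(2) by (simp add: holocolorings_def)
  have cols: "code_colors d = c ` edges G" using code_colors_gcode[OF G(1)] G(3) by metis
  obtain t where t: "t \<in> bary_simplex (code_colors d)" "y = pt d t"
    using y C.space_faces[OF d] by auto
  let ?l = "cell_metric d y"
  have l: "?l e = t (c e)" if "e \<in> edges G" for e
    using that C.point_vertex[OF d, of "c e" t] t(2) by (simp add: cell_metric_def r cols)
  have "(\<Sum>e\<in>edges G. ?l e) = (\<Sum>e\<in>edges G. t (c e))" by (rule sum.cong[OF refl]) (rule l)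
  also have "\<dots> = sum t (c ` edges G)" using inj by (simp add: sum.reindex)
  also have "\<dots> = 1" using t(1) by (simp add: bary_simplex_def cols)
  finally have sum: "(\<Sum>e\<in>edges G. ?l e) = 1" .
  have PiE: "?l \<in> edges G \<rightarrow>\<^sub>E {0..}"
  proof (rule PiE_I)
    show "?l e \<in> {0..}" if "e \<in> edges G" for e using l[OF that] t(1) by (simp add: bary_simplex_def)
    show "?l e = undefined" if "e \<notin> edges G" for e using that by (simp add: cell_metric_def r)
  qed
  have "zero_edges G ?l \<noteq> edges G"
  proof
    assume "zero_edges G ?l = edges G"
    then have "(\<Sum>e\<in>edges G. ?l e) = 0" by (intro sum.neutral) (auto simp: zero_edges_def)
    then show False using sum by simp
  qed
  then have triple: "(G, ?l, c) \<in> mhg_triples s" using G PiE by (simp add: mhg_triples_iff)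
  then show "(fst (rep d), ?l, snd (rep d)) \<in> mhg_triples s" by (simp add: r)
  show "?l \<in> topspace (metric_simplex (fst (rep d)))"
    using triple sum by (simp add: topspace_metric_simplex r mhg_triples_def)
  have "norm_length G c ?l = t"
  proof
    fix i
    show "norm_length G c ?l i = t i"
    proof (cases "i \<in> c ` edges G")
      case True
      then show ?thesis using norm_length_color[OF triple] l sum by auto
    next
      case False
      then show ?thesis using t(1) cols by (simp add: norm_length_def color_length_other bary_simplex_def)
    qed
  qed
  then show "encode (fst (rep d), ?l, snd (rep d)) = y"
    using t(2) G(3) by (simp add: encode_def r)
qed

lemma cell_class:
  assumes "d \<in> all_cells s" "y \<in> C.space (C.faces d)"
  shows "cell_class d y \<in> mhg_points s" "class_coord (cell_class d y) = y"
proof -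
  have eq: "cell_class d y = mhg_rel s ``{(fst (rep d), cell_metric d y, snd (rep d))}"
    by (simp add: cell_class_def mhg_proj_def case_prod_beta)
  show "cell_class d y \<in> mhg_points s"
    unfolding eq mhg_points_def using cell_metric(2)[OF assms] by (rule quotientI)
  show "class_coord (cell_class d y) = y"
    unfolding eq class_coord_class[OF cell_metric(2)[OF assms]] by (rule cell_metric(3)[OF assms])
qed

lemma continuous_map_cell_class:
  assumes d: "d \<in> all_cells s"
  shows "continuous_map (top_of_set (C.space (C.faces d))) (MHG1 s) (cell_class d)"
proof -
  let ?Y = "top_of_set (C.space (C.faces d))"
  have "continuous_map ?Y (product_topology (\<lambda>_. euclideanreal) (edges (fst (rep d)))) (cell_metric d)"
    unfolding continuous_map_componentwise
  proof (intro conjI ballI)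
    show "cell_metric d ` topspace ?Y \<subseteq> extensional (edges (fst (rep d)))"
      by (auto simp: cell_metric_def)
    fix e assume e: "e \<in> edges (fst (rep d))"
    have "continuous_on (C.space (C.faces d)) (\<lambda>y. y (code_restrict d {snd (rep d) e}))"
      by (rule continuous_on_product_then_coordinatewise[OF continuous_on_id])
    then show "continuous_map ?Y euclideanreal (\<lambda>y. cell_metric d y e)"
      using e by (simp add: cell_metric_def)
  qed
  moreover have "cell_metric d y \<in> {l \<in> regular_metrics (fst (rep d)). (\<Sum>e\<in>edges (fst (rep d)). l e) = 1}"
    if "y \<in> C.space (C.faces d)" for y
    using cell_metric(1)[OF d that] by (simp add: topspace_metric_simplex)
  ultimately have "continuous_map ?Y (metric_simplex (fst (rep d))) (cell_metric d)"
    unfolding metric_simplex_def by (intro continuous_map_into_subtopology) auto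
  moreover have "continuous_map (metric_simplex (fst (rep d))) (mhg_simplices s) (\<lambda>l. (rep d, l))"
  proof -
    have "rep d \<in> {(G, c). G \<in> one_loop_graphs s \<and> c \<in> holocolorings s G}"
      using rep[OF d] by (simp add: case_prod_beta one_loop_graphs_eq)
    then show ?thesis
      using continuous_map_component_injection[of "rep d" _ "\<lambda>(G, c). metric_simplex G"]
      by (simp add: mhg_simplices_def case_prod_beta)
  qed
  ultimately have "continuous_map ?Y (MHG1 s) (mhg_proj s \<circ> ((\<lambda>l. (rep d, l)) \<circ> cell_metric d))"
    by (intro continuous_map_compose[OF _ continuous_map_proj] continuous_map_compose)
  moreover have "mhg_proj s \<circ> ((\<lambda>l. (rep d, l)) \<circ> cell_metric d) = cell_class d"
    by (auto simp: cell_class_def)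
  ultimately show ?thesis by simp
qed

definition decode :: "(code \<Rightarrow> real) \<Rightarrow> mhg_triple set" where
  "decode y = cell_class (SOME d. d \<in> all_cells s \<and> y \<in> C.space (C.faces d)) y"

lemma decode_cell:
  assumes "y \<in> S"
  obtains d where "d \<in> all_cells s" "y \<in> C.space (C.faces d)" "decode y = cell_class d y"
proof -
  let ?P = "\<lambda>d. d \<in> all_cells s \<and> y \<in> C.space (C.faces d)"
  obtain d where "d \<in> all_cells s" "y \<in> pt d ` bary_simplex (code_colors d)"
    using assms unfolding C.space_def by blast
  then have "?P d" using C.space_faces by simp
  then have "?P (SOME d. ?P d)" by (rule someI[of ?P])
  then show ?thesis using that[of "SOME d. ?P d"] by (simp add: decode_def)
qed

lemma faces_subset: "C.space (C.faces d) \<subseteq> S"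
  unfolding C.space_def C.faces_def C.face_def by blast

text \<open>Finitely many closed cells cover \<open>S\<close>. On overlaps the local inverses agree
  because \<open>class_coord\<close> is injective and sends both values to \<open>y\<close>, so the
  choice made in \<open>decode\<close> is harmless.\<close>

lemma continuous_map_decode: "continuous_map (top_of_set S) (MHG1 s) decode"
proof (rule pasting_lemma_closed)
  show "finite (all_cells s)" by (rule C.fin_P)
  show "closedin (top_of_set S) (C.space (C.faces d))" for d
    by (rule C.closedin_space[OF C.down_closed_faces down_closed_all]) (auto simp: C.faces_def C.face_def)
  show "continuous_map (subtopology (top_of_set S) (C.space (C.faces d))) (MHG1 s) (cell_class d)"
    if "d \<in> all_cells s" for d
  proof -
    have "S \<inter> C.space (C.faces d) = C.space (C.faces d)" using faces_subset by blast
    then show ?thesis using continuous_map_cell_class[OF that] by (simp add: subtopology_subtopology)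
  qed
  show "cell_class d y = cell_class d' y"
    if "d \<in> all_cells s" "d' \<in> all_cells s"
      "y \<in> topspace (top_of_set S) \<inter> C.space (C.faces d) \<inter> C.space (C.faces d')" for d d' y
    using that cell_class[of d y] cell_class[of d' y] by (intro class_coord_inj) simp_all
  show "\<exists>d. d \<in> all_cells s \<and> y \<in> C.space (C.faces d) \<and> decode y = cell_class d y"
    if y: "y \<in> topspace (top_of_set S)" for y
  proof -
    obtain d where "d \<in> all_cells s" "y \<in> C.space (C.faces d)" "decode y = cell_class d y"
      using decode_cell[of y] y by auto
    then show ?thesis by blast
  qed
qed

lemma homeomorphic_MHG1: "top_of_set S homeomorphic_space MHG1 s"
proof -
  have coord: "class_coord (decode y) = y" "decode y \<in> mhg_points s" if y: "y \<in> S" for y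
  proof -
    obtain d where d: "d \<in> all_cells s" "y \<in> C.space (C.faces d)" "decode y = cell_class d y"
      using decode_cell[OF y] .
    then show "class_coord (decode y) = y" "decode y \<in> mhg_points s" using cell_class[OF d(1,2)] by simp_all
  qed
  have "decode (class_coord K) = K" if K: "K \<in> mhg_points s" for K
  proof -
    have "class_coord K \<in> S"
      using continuous_map_class_coord K topspace_MHG1 by (auto simp: continuous_map_def)
    then show ?thesis using coord by (intro class_coord_inj K) simp_all
  qed
  then have "homeomorphic_maps (top_of_set S) (MHG1 s) decode class_coord"
    unfolding homeomorphic_maps_def topspace_MHG1
    using coord continuous_map_decode continuous_map_class_coord by simp
  then show ?thesis by (auto simp: homeomorphic_space_def)
qed

lemma euler_is_MHG1: "euler_is (MHG1 s) {} (\<Sum>d\<in>all_cells s. (-1) ^ (card (code_colors d) + 1))"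
  using C.euler_is_space[OF down_closed_all]
  by (rule euler_is_iso) (rule homeomorphic_space_imp_isomorphic_homology_groups[OF homeomorphic_MHG1])

end

section \<open>Counting the cells\<close>

lemma cycle_dataD:
  assumes "(L, e) \<in> cycle_data s k"
  shows "L \<in> {1..s} \<rightarrow>\<^sub>E {..<k}" "L ` {1..s} = {..<k}" "e \<in> {..<k} \<rightarrow>\<^sub>E {1..s}" "inj_on e {..<k}"
  using assms by (simp_all add: cycle_data_def)

lemma cycle_data_leg:
  assumes "(L, e) \<in> cycle_data s k" "x < k"
  obtains a where "a \<in> {1..s}" "L a = x"
proof -
  have "x \<in> L ` {1..s}" using cycle_dataD(2)[OF assms(1)] assms(2) by simp
  then show ?thesis using that by blast
qed

lemma code_colors_cycle:
  assumes "(L, e) \<in> cycle_data s k" "0 < k"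
  shows "code_colors (gcode s (std_cycle k L) e) = e ` {..<k}"
  using code_colors_gcode[OF core_std_cycle[OF assms(2) cycle_dataD(2)[OF assms(1)]]] by simp

lemma card_colors_cells:
  assumes "d \<in> cells s k" "0 < k"
  shows "card (code_colors d) = k"
proof -
  obtain L e where "(L, e) \<in> cycle_data s k" "d = gcode s (std_cycle k L) e"
    using assms(1) by (auto simp: cells_def)
  then show ?thesis using code_colors_cycle[OF _ assms(2)] cycle_dataD(4) by (simp add: card_image)
qed

lemma snd_gcode_cycle:
  assumes "(L, e) \<in> cycle_data s k" "j < k"
  shows "(a, b) \<in> snd (gcode s (std_cycle k L) e) (e j) \<longleftrightarrow>
    a \<in> {1..s} \<and> b \<in> {1..s} \<and> {#j, Suc j mod k#} = {#L a, L b#}"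
proof -
  have "e i = e j \<longleftrightarrow> i = j" if "i < k" for i
    using inj_on_eq_iff[OF cycle_dataD(4)[OF assms(1)]] that assms(2) by simp
  then show ?thesis using assms(2) by (auto simp: snd_gcode)
qed

text \<open>Together with the code, the edge and vertex in position 0 determine the cyclic labelling.\<close>

definition flag :: "nat \<Rightarrow> (nat \<Rightarrow> nat) \<times> (nat \<Rightarrow> nat) \<Rightarrow> nat \<times> nat set" where
  "flag s = (\<lambda>(L, e). (e 0, {a\<in>{1..s}. L a = 0}))"

text \<open>Walking around the cycle propagates the labelling: the other end of the edge in position
  \<open>j\<close> is vertex \<open>j + 1\<close>, and the next edge is the other one at that
  vertex.\<close>

lemma flag_inj:
  assumes k: "2 \<le> k" and w: "(L, e) \<in> cycle_data s k" and w': "(L', e') \<in> cycle_data s k"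
    and code: "gcode s (std_cycle k L) e = gcode s (std_cycle k L') e'"
    and flag: "flag s (L, e) = flag s (L', e')"
  shows "L = L' \<and> e = e'"
proof -
  have k0: "0 < k" using k by simp
  have col: "e ` {..<k} = e' ` {..<k}"
    using code_colors_cycle[OF w k0] code_colors_cycle[OF w' k0] code by simp
  have main: "e j = e' j \<and> (\<forall>a\<in>{1..s}. L a = j \<longleftrightarrow> L' a = j)" if "j < k" for j
    using that
  proof (induction j)
    case 0
    have "{a\<in>{1..s}. L a = 0} = {a\<in>{1..s}. L' a = 0}" "e 0 = e' 0" using flag by (simp_all add: flag_def)
    then show ?case by blast
  next
    case (Suc j)
    then have j: "j < k" "Suc j mod k = Suc j" and IH: "e j = e' j" "\<forall>a\<in>{1..s}. L a = j \<longleftrightarrow> L' a = j"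
      by simp_all
    obtain a where a: "a \<in> {1..s}" "L a = j" using cycle_data_leg[OF w j(1)] .
    then have a': "L' a = j" using IH(2) by blast
    have legs: "L b = Suc j \<longleftrightarrow> L' b = Suc j" if b: "b \<in> {1..s}" for b
    proof -
      have "L b = Suc j \<longleftrightarrow> (a, b) \<in> snd (gcode s (std_cycle k L) e) (e j)"
        unfolding snd_gcode_cycle[OF w j(1)] using a b j(2) by (auto simp: pair_mset_eq_iff)
      also have "\<dots> \<longleftrightarrow> (a, b) \<in> snd (gcode s (std_cycle k L') e') (e' j)" by (simp add: code IH(1))
      also have "\<dots> \<longleftrightarrow> L' b = Suc j"
        unfolding snd_gcode_cycle[OF w' j(1)] using a a' b j(2) by (auto simp: pair_mset_eq_iff)
      finally show ?thesis .
    qed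
    obtain b where b: "b \<in> {1..s}" "L' b = Suc j" using cycle_data_leg[OF w' Suc.prems] .
    then have Lb: "L b = Suc j" using legs by blast
    have "Suc (Suc j) mod k < k" using k0 by simp
    then obtain x where x: "x \<in> {1..s}" "L' x = Suc (Suc j) mod k" using cycle_data_leg[OF w'] by metis
    have bx: "(b, x) \<in> snd (gcode s (std_cycle k L') e') (e' (Suc j))"
      unfolding snd_gcode_cycle[OF w' Suc.prems] using b x by simp
    have "e' (Suc j) \<in> e ` {..<k}" unfolding col using Suc.prems by blast
    \<comment> \<open>\<open>m\<close> is the position in the first labelling of the next colour of
      the second. That edge touches vertex \<open>Suc j\<close>, so \<open>m\<close> is
      \<open>j\<close> or \<open>Suc j\<close>, and the colour at \<open>j\<close> is already
      taken.\<close>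
    then obtain m where m: "m < k" "e' (Suc j) = e m" by blast
    have "{#m, Suc m mod k#} = {#L b, L x#}"
      using bx snd_gcode_cycle[OF w m(1)] unfolding code[symmetric] m(2) by blast
    then have "m = Suc j \<or> Suc m mod k = Suc j" using Lb by (auto simp: pair_mset_eq_iff)
    moreover have "m = j" if "Suc m mod k = Suc j"
    proof -
      have "Suc m = k \<or> Suc m < k" using m(1) by linarith
      then show ?thesis using that by auto
    qed
    moreover have "m \<noteq> j"
    proof
      assume "m = j"
      then have "e' (Suc j) = e' j" using m(2) IH(1) by simp
      then show False using inj_onD[OF cycle_dataD(4)[OF w']] Suc.prems j(1) by fastforce
    qed
    ultimately have "m = Suc j" by blast
    then show ?case using m(2) legs by simp
  qed
  have "L = L'"
  proof (rule PiE_ext[OF cycle_dataD(1)[OF w] cycle_dataD(1)[OF w']])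
    fix a assume a: "a \<in> {1..s}"
    then have "L a < k" using cycle_dataD(1)[OF w] by auto
    then have "L' a = L a" using main[of "L a"] a by blast
    then show "L a = L' a" by simp
  qed
  moreover have "e = e'"
    by (rule PiE_ext[OF cycle_dataD(3)[OF w] cycle_dataD(3)[OF w']]) (use main in simp)
  ultimately show ?thesis ..
qed

text \<open>Automorphisms of the bare \<open>k\<close>-cycle, with \<open>\<rho>\<close> on vertices
  and \<open>\<sigma>\<close> on edges. Both are recorded since for \<open>k = 2\<close> neither
  determines the other.\<close>

definition dihedral :: "nat \<Rightarrow> (nat \<Rightarrow> nat) \<Rightarrow> (nat \<Rightarrow> nat) \<Rightarrow> bool" where
  "dihedral k \<rho> \<sigma> \<longleftrightarrow> bij_betw \<rho> {..<k} {..<k} \<and> bij_betw \<sigma> {..<k} {..<k} \<and>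
     (\<forall>i<k. {#\<sigma> i, Suc (\<sigma> i) mod k#} = {#\<rho> i, \<rho> (Suc i mod k)#})"

lemma dihedral_comp:
  assumes "dihedral k \<rho> \<sigma>" "dihedral k \<rho>' \<sigma>'"
  shows "dihedral k (\<rho>' \<circ> \<rho>) (\<sigma>' \<circ> \<sigma>)"
  unfolding dihedral_def
proof (intro conjI allI impI)
  show "bij_betw (\<rho>' \<circ> \<rho>) {..<k} {..<k}" "bij_betw (\<sigma>' \<circ> \<sigma>) {..<k} {..<k}"
    using assms by (auto simp: dihedral_def intro: bij_betw_trans)
  fix i assume i: "i < k"
  then have "\<sigma> i < k" using assms(1) by (auto simp: dihedral_def bij_betw_def)
  then have "{#\<sigma>' (\<sigma> i), Suc (\<sigma>' (\<sigma> i)) mod k#} = image_mset \<rho>' {#\<sigma> i, Suc (\<sigma> i) mod k#}"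
    using assms(2) by (simp add: dihedral_def)
  also have "{#\<sigma> i, Suc (\<sigma> i) mod k#} = {#\<rho> i, \<rho> (Suc i mod k)#}"
    using assms(1) i by (simp add: dihedral_def)
  finally show "{#(\<sigma>' \<circ> \<sigma>) i, Suc ((\<sigma>' \<circ> \<sigma>) i) mod k#} = {#(\<rho>' \<circ> \<rho>) i, (\<rho>' \<circ> \<rho>) (Suc i mod k)#}"
    by simp
qed

lemma bij_betw_lessThanI:
  assumes "inj_on f {..<k}" "\<And>x. x < k \<Longrightarrow> f x < (k::nat)"
  shows "bij_betw f {..<k} {..<k}"
  using assms endo_inj_surj[of "{..<k}" f] by (auto simp: bij_betw_def)

lemma dihedral_rotation:
  assumes "0 < k" "c \<le> k"
  shows "dihedral k (\<lambda>x. (x + c) mod k) (\<lambda>x. (x + c) mod k)"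
proof -
  have inj: "inj_on (\<lambda>x. (x + c) mod k) {..<k}"
  proof (rule inj_onI)
    fix x y assume xy: "x \<in> {..<k}" "y \<in> {..<k}" and eq: "(x + c) mod k = (y + c) mod k"
    have "((x + c) + (k - c)) mod k = ((y + c) + (k - c)) mod k"
      using eq by (metis mod_add_left_eq)
    then have "(x + k) mod k = (y + k) mod k" using assms(2) by simp
    then show "x = y" using xy by simp
  qed
  have "bij_betw (\<lambda>x. (x + c) mod k) {..<k} {..<k}"
    by (rule bij_betw_lessThanI[OF inj]) (use assms in simp)
  moreover have "Suc ((i + c) mod k) mod k = (Suc i mod k + c) mod k" for i
    by (simp add: mod_simps)
  ultimately show ?thesis by (simp add: dihedral_def)
qed

text \<open>The reflection that fixes edge 0 and exchanges its ends: \<open>1 - x\<close> on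
  vertices and \<open>- i\<close> on edges, modulo \<open>k\<close>.\<close>

lemma dihedral_reflection:
  assumes k: "2 \<le> k"
  shows "dihedral k (\<lambda>x. if x = 0 then 1 else if x = 1 then 0 else k + 1 - x) (\<lambda>i. if i = 0 then 0 else k - i)"
    (is "dihedral k ?\<rho> ?\<sigma>")
proof -
  have "bij_betw ?\<rho> {..<k} {..<k}"
    by (rule bij_betw_lessThanI) (use k in \<open>auto intro!: inj_onI split: if_splits\<close>)
  moreover have "bij_betw ?\<sigma> {..<k} {..<k}"
    by (rule bij_betw_lessThanI) (use k in \<open>auto intro!: inj_onI split: if_splits\<close>)
  moreover have "{#?\<sigma> i, Suc (?\<sigma> i) mod k#} = {#?\<rho> i, ?\<rho> (Suc i mod k)#}" if i: "i < k" for i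
  proof -
    consider "i = 0" | "i \<noteq> 0" "Suc i = k" | "i \<noteq> 0" "Suc i < k" using i by linarith
    then show ?thesis
    proof cases
      case 1
      then show ?thesis using k by (simp add: pair_mset_eq_iff)
    next
      case 2
      then show ?thesis using k by (cases "i = 1") (auto simp: pair_mset_eq_iff)
    next
      case 3
      then show ?thesis using k by (cases "i = 1") (auto simp: pair_mset_eq_iff Suc_diff_le)
    qed
  qed
  ultimately show ?thesis by (simp add: dihedral_def)
qed

text \<open>Renumbering moves edge \<open>j\<close> and vertex \<open>x\<close> to position 0
  without changing the code; this is how prescribed flags are realised in a fibre.\<close>

lemma dihedral_relabel:
  assumes k: "0 < k" and w: "(L, e) \<in> cycle_data s k" and dih: "dihedral k \<rho> \<sigma>"
    and j: "j < k" "\<sigma> j = 0" and x: "x < k" "\<rho> x = 0"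
  shows "\<exists>w'\<in>cycle_data s k. (case w' of (L', e') \<Rightarrow>
      gcode s (std_cycle k L') e' = gcode s (std_cycle k L) e) \<and>
      flag s w' = (e j, {a\<in>{1..s}. L a = x})"
proof -
  define L' where "L' = (\<lambda>a\<in>{1..s}. \<rho> (L a))"
  define e' where "e' = (\<lambda>i\<in>{..<k}. e (inv_into {..<k} \<sigma> i))"
  note D = cycle_dataD[OF w]
  have bij: "bij_betw \<rho> {..<k} {..<k}" "bij_betw \<sigma> {..<k} {..<k}" using dih by (simp_all add: dihedral_def)
  have inv: "bij_betw (inv_into {..<k} \<sigma>) {..<k} {..<k}" using bij(2) by (rule bij_betw_inv_into)
  have Lk: "L a < k" if "a \<in> {1..s}" for a using D(1) that by auto
  have img: "L' ` {1..s} = {..<k}"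
  proof -
    have "L' ` {1..s} = \<rho> ` L ` {1..s}" unfolding image_image by (intro image_cong) (auto simp: L'_def)
    then show ?thesis using bij(1) D(2) by (simp add: bij_betw_def)
  qed
  have inj: "inj_on e' {..<k}"
  proof -
    have "inj_on (e \<circ> inv_into {..<k} \<sigma>) {..<k}"
      using inv D(4) by (intro comp_inj_on) (simp_all add: bij_betw_def)
    then show ?thesis by (simp add: e'_def inj_on_def)
  qed
  have "e' \<in> {..<k} \<rightarrow>\<^sub>E {1..s}"
  proof (rule PiE_I)
    fix i assume i: "i \<in> {..<k}"
    then have "inv_into {..<k} \<sigma> i \<in> {..<k}" by (rule bij_betwE[OF inv, rule_format])
    then have "e (inv_into {..<k} \<sigma> i) \<in> {1..s}" by (rule PiE_mem[OF D(3)])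
    then show "e' i \<in> {1..s}" using i by (simp add: e'_def)
  qed (simp add: e'_def)
  moreover have "L' \<in> {1..s} \<rightarrow>\<^sub>E {..<k}" using img by (auto simp: L'_def)
  ultimately have data: "(L', e') \<in> cycle_data s k" using img inj by (simp add: cycle_data_def)
  have e'\<sigma>: "e' (\<sigma> i) = e i" if "i < k" for i
    using that bij(2) by (auto simp: e'_def bij_betw_def inv_into_f_f)
  have "gcode s (std_cycle k L') e' = gcode s (std_cycle k L) e"
  proof (rule gcode_iso)
    show "legged_graph s (std_cycle k L)" using core_std_cycle[OF k D(2)] by (rule core_legged)
    show "graph_iso s (std_cycle k L) (std_cycle k L') \<rho> \<sigma>"
      using dih by (simp add: graph_iso_def dihedral_def L'_def)
    show "e' (\<sigma> i) = e i" if "i \<in> edges (std_cycle k L)" for i using that e'\<sigma> by simp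
  qed
  moreover have "flag s (L', e') = (e j, {a\<in>{1..s}. L a = x})"
  proof -
    have "L' a = 0 \<longleftrightarrow> L a = x" if "a \<in> {1..s}" for a
      using that inj_on_eq_iff[of \<rho> "{..<k}" "L a" x] bij(1) x Lk[OF that] by (simp add: L'_def bij_betw_def)
    moreover have "e' 0 = e j" using e'\<sigma>[OF j(1)] j(2) by simp
    ultimately show ?thesis by (auto simp: flag_def)
  qed
  ultimately show ?thesis using data by (intro bexI[of _ "(L', e')"]) simp_all
qed

text \<open>In place of the orbit of a group action, flags are counted: on the fibre
  \<open>flag\<close> is injective, and its values are the \<open>2 * k\<close> pairs of an edge and
  one of its ends.\<close>

lemma fiber_card:
  assumes k: "2 \<le> k" and w: "(L, e) \<in> cycle_data s k"
  shows "card {w \<in> cycle_data s k. (case w of (L', e') \<Rightarrow> gcode s (std_cycle k L') e') =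
    gcode s (std_cycle k L) e} = 2 * k" (is "card ?F = _")
proof -
  have k0: "0 < k" using k by simp
  note D = cycle_dataD[OF w]
  define block where "block x = {a\<in>{1..s}. L a = x}" for x
  \<comment> \<open>The Boolean selects one of the two ends of edge \<open>j\<close>, each named by
    its legs.\<close>
  define \<Phi> where "\<Phi> = (\<lambda>(j, b). (e j, block (if b then Suc j mod k else j)))"
  have block_inj: "x = y" if "block x = block y" "x < k" for x y
  proof -
    obtain a where "a \<in> {1..s}" "L a = x" using cycle_data_leg[OF w \<open>x < k\<close>] .
    then show ?thesis using that(1) by (auto simp: block_def)
  qed
  have "inj_on \<Phi> ({..<k} \<times> UNIV)"
  proof (rule inj_onI)
    fix p q :: "nat \<times> bool" assume p: "p \<in> {..<k} \<times> UNIV" and q: "q \<in> {..<k} \<times> UNIV" and eq: "\<Phi> p = \<Phi> q"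
    obtain j b where pj: "p = (j, b)" "j < k" using p by auto
    obtain i b' where qi: "q = (i, b')" "i < k" using q by auto
    have "e j = e i" using eq pj qi by (simp add: \<Phi>_def)
    then have ij: "j = i" using inj_onD[OF D(4)] pj qi by simp
    \<comment> \<open>The two ends of an edge differ; for a loop they would coincide, which is why
      \<open>k = 1\<close> is counted separately.\<close>
    have ne: "Suc j mod k \<noteq> j" using k pj(2) by (cases "Suc j < k") (auto simp: not_less le_Suc_eq)
    have lt: "(if b then Suc j mod k else j) < k" using k0 pj(2) by simp
    have "block (if b then Suc j mod k else j) = block (if b' then Suc j mod k else j)"
      using eq unfolding pj qi ij by (simp add: \<Phi>_def split del: if_split)
    then have "(if b then Suc j mod k else j) = (if b' then Suc j mod k else j)"
      using lt by (rule block_inj)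
    then have "b = b'" using ne by (auto split: if_splits)
    then show "p = q" using pj qi ij by simp
  qed
  then have card: "card (\<Phi> ` ({..<k} \<times> UNIV)) = 2 * k"
    by (simp add: card_image card_cartesian_product)
  have image: "flag s ` ?F = \<Phi> ` ({..<k} \<times> UNIV)"
  proof (intro equalityI subsetI)
    fix z assume "z \<in> flag s ` ?F"
    then obtain L' e' where w': "(L', e') \<in> cycle_data s k"
      and code: "gcode s (std_cycle k L') e' = gcode s (std_cycle k L) e"
      and z: "z = flag s (L', e')" by auto
    have "e' 0 \<in> e ` {..<k}"
      using code_colors_cycle[OF w k0] code_colors_cycle[OF w' k0] code k0 by auto
    then obtain j where j: "j < k" "e' 0 = e j" by blast
    obtain a where a: "a \<in> {1..s}" "L' a = 0" using cycle_data_leg[OF w' k0] .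
    have "1 < k" using k by simp
    then obtain b where b: "b \<in> {1..s}" "L' b = 1" using cycle_data_leg[OF w'] by metis
    have "(a, b) \<in> snd (gcode s (std_cycle k L') e') (e' 0)"
      unfolding snd_gcode_cycle[OF w' k0] using a b k by simp
    then have "{#j, Suc j mod k#} = {#L a, L b#}"
      using snd_gcode_cycle[OF w j(1), of a b] unfolding code j(2) by simp
    then have La: "L a = j \<or> L a = Suc j mod k" by (auto simp: pair_mset_eq_iff)
    have "L' b = 0 \<longleftrightarrow> L b = L a" if "b \<in> {1..s}" for b
      using fst_gcode[of b a s "std_cycle k L'" e'] fst_gcode[of b a s "std_cycle k L" e] code a that by simp
    then have "{b\<in>{1..s}. L' b = 0} = block (L a)" by (auto simp: block_def)
    then have "z = (e j, block (L a))" by (simp add: z flag_def j(2))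
    then have "z = \<Phi> (j, False) \<or> z = \<Phi> (j, True)" using La by (auto simp: \<Phi>_def)
    then show "z \<in> \<Phi> ` ({..<k} \<times> UNIV)" using j(1) by blast
  next
    fix z assume "z \<in> \<Phi> ` ({..<k} \<times> UNIV)"
    then obtain j b where j: "j < k" "z = \<Phi> (j, b)" by auto
    let ?rot = "\<lambda>x. (x + (k - j)) mod k"
    have rot: "dihedral k ?rot ?rot" using k0 by (intro dihedral_rotation) simp_all
    have r0: "?rot j = 0" using j(1) by simp
    have "\<exists>w'\<in>cycle_data s k. (case w' of (L', e') \<Rightarrow>
      gcode s (std_cycle k L') e' = gcode s (std_cycle k L) e) \<and> flag s w' = z"
    proof (cases b)
      case False
      then show ?thesis
        using dihedral_relabel[OF k0 w rot j(1) r0 j(1) r0] j(2) by (simp add: \<Phi>_def block_def)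
    next
      case True
      let ?\<rho> = "\<lambda>x. if x = 0 then 1 else if x = 1 then 0 else k + 1 - x"
      let ?\<sigma> = "\<lambda>i. if i = 0 then 0 else k - i"
      \<comment> \<open>The rotation takes the other end of edge \<open>j\<close> to 1; the
        reflection then exchanges 1 with 0 while keeping edge 0.\<close>
      have "?rot (Suc j mod k) = Suc (j + (k - j)) mod k" by (simp add: mod_simps)
      also have "\<dots> = 1" using k j(1) by (simp add: mod_Suc)
      finally have r1: "(?\<rho> \<circ> ?rot) (Suc j mod k) = 0" by simp
      have s0: "(?\<sigma> \<circ> ?rot) j = 0" using r0 by simp
      have "Suc j mod k < k" using k0 by simp
      then show ?thesis
        using dihedral_relabel[OF k0 w dihedral_comp[OF rot dihedral_reflection[OF k]] j(1) s0 _ r1] j(2) True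
        by (simp add: \<Phi>_def block_def)
    qed
    then obtain L' e' where "(L', e') \<in> cycle_data s k"
      "gcode s (std_cycle k L') e' = gcode s (std_cycle k L) e" "flag s (L', e') = z" by auto
    then show "z \<in> flag s ` ?F" by (intro image_eqI[of _ _ "(L', e')"]) simp_all
  qed
  have "inj_on (flag s) ?F"
  proof (rule inj_onI)
    fix p q assume p: "p \<in> ?F" and q: "q \<in> ?F" and eq: "flag s p = flag s q"
    obtain L1 e1 where p': "p = (L1, e1)" by fastforce
    obtain L2 e2 where q': "q = (L2, e2)" by fastforce
    show "p = q" using flag_inj[OF k, of L1 e1 s L2 e2] p q eq unfolding p' q' by simp
  qed
  then show ?thesis using card_image[of "flag s" ?F] card image by simp
qed

text \<open>With one vertex and one edge there is nothing to renumber: all legs sit at 0, and the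
  colour can be read off the code.\<close>

lemma fiber_card_1:
  assumes w: "(L, e) \<in> cycle_data s 1"
  shows "{w \<in> cycle_data s 1. (case w of (L', e') \<Rightarrow> gcode s (std_cycle 1 L') e') =
    gcode s (std_cycle 1 L) e} = {(L, e)}"
proof -
  have "L' = L \<and> e' = e"
    if w': "(L', e') \<in> cycle_data s 1" and code: "gcode s (std_cycle 1 L') e' = gcode s (std_cycle 1 L) e" for L' e'
  proof
    have "e' 0 = e 0"
      using code_colors_cycle[OF w] code_colors_cycle[OF w'] code by (simp add: lessThan_Suc)
    then show "e' = e"
      using PiE_ext[OF cycle_dataD(3)[OF w'] cycle_dataD(3)[OF w]] by simp
    show "L' = L"
    proof (rule PiE_ext[OF cycle_dataD(1)[OF w'] cycle_dataD(1)[OF w]])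
      fix a assume "a \<in> {1..s}"
      then have "L' a \<in> {..<1}" "L a \<in> {..<1}"
        using cycle_dataD(1)[OF w'] cycle_dataD(1)[OF w] by blast+
      then show "L' a = L a" by simp
    qed
  qed
  then show ?thesis using w by auto
qed

lemma card_cells:
  assumes "0 < k"
  shows "card (cells s k) * (if k = 1 then 1 else 2 * k) = card (cycle_data s k)"
proof -
  let ?f = "\<lambda>(L, e). gcode s (std_cycle k L) e" and ?m = "if k = 1 then 1 else 2 * k"
  have fiber: "card {w \<in> cycle_data s k. ?f w = d} = ?m" if d: "d \<in> cells s k" for d
  proof -
    obtain L e where w: "(L, e) \<in> cycle_data s k" "d = gcode s (std_cycle k L) e"
      using d by (auto simp: cells_def)
    show ?thesis
    proof (cases "k = 1")
      case True
      then show ?thesis using fiber_card_1[of L e s] w by simp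
    next
      case False
      then have "2 \<le> k" using assms by simp
      then show ?thesis using fiber_card[OF _ w(1)] w(2) False by simp
    qed
  qed
  have "card (cycle_data s k) = (\<Sum>d\<in>cells s k. card {w \<in> cycle_data s k. ?f w = d})"
    using sum.image_gen[OF finite_cycle_data, where h = "\<lambda>_. 1::nat" and g = ?f] by (simp add: cells_def)
  also have "\<dots> = card (cells s k) * ?m" using fiber by simp
  finally show ?thesis by simp
qed

subsection \<open>Surjections and injections\<close>

lemma sum_Pow_by_card:
  fixes h :: "nat \<Rightarrow> int"
  assumes "finite S"
  shows "(\<Sum>T\<in>Pow S. h (card T)) = (\<Sum>j=0..card S. int (card S choose j) * h j)"
proof -
  have "(\<Sum>T\<in>Pow S. h (card T)) = (\<Sum>j\<in>{0..card S}. \<Sum>T | T \<in> Pow S \<and> card T = j. h (card T))"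
    using assms by (intro sum.group[symmetric]) (auto intro: card_mono)
  also have "\<dots> = (\<Sum>j=0..card S. int (card S choose j) * h j)"
  proof (rule sum.cong[OF refl])
    fix j
    have "card {T. T \<in> Pow S \<and> card T = j} = card S choose j" using n_subsets[OF assms] by simp
    then show "(\<Sum>T | T \<in> Pow S \<and> card T = j. h (card T)) = int (card S choose j) * h j" by simp
  qed
  finally show ?thesis .
qed

text \<open>Every map is onto its image, so the number of all maps is the sum of these numbers over
  the subsets of \<open>S\<close>; Moebius inversion on the subset lattice does the rest.\<close>

lemma card_surjections:
  assumes "finite A" "finite S"
  shows "int (card {f \<in> A \<rightarrow>\<^sub>E S. f ` A = S}) =
    (\<Sum>j=0..card S. (-1) ^ (card S - j) * int (card S choose j) * int (j ^ card A))"
proof -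
  let ?sur = "\<lambda>S. int (card {f \<in> A \<rightarrow>\<^sub>E S. f ` A = S})"
  have "?sur S = (\<Sum>T\<in>Pow S. (-1) ^ (card S - card T) * int (card T ^ card A))"
  proof (rule inclusion_exclusion_mobius[OF _ assms(2)])
    fix S :: "'b set" assume S: "finite S"
    have fin: "finite (A \<rightarrow>\<^sub>E S)" using assms(1) S by (intro finite_PiE)
    have "int (card S ^ card A) = (\<Sum>f\<in>A \<rightarrow>\<^sub>E S. 1)" using assms(1) by (simp add: card_funcsetE)
    also have "\<dots> = (\<Sum>T\<in>Pow S. \<Sum>f | f \<in> A \<rightarrow>\<^sub>E S \<and> f ` A = T. 1)"
      using fin S by (intro sum.group[symmetric]) auto
    also have "\<dots> = sum ?sur (Pow S)"
    proof (rule sum.cong[OF refl])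
      fix T assume "T \<in> Pow S"
      then have "{f. f \<in> A \<rightarrow>\<^sub>E S \<and> f ` A = T} = {f \<in> A \<rightarrow>\<^sub>E T. f ` A = T}"
        by (auto simp: PiE_iff)
      then show "(\<Sum>f | f \<in> A \<rightarrow>\<^sub>E S \<and> f ` A = T. 1) = ?sur T" by simp
    qed
    finally show "int (card S ^ card A) = sum ?sur (Pow S)" .
  qed
  also have "\<dots> = (\<Sum>j=0..card S. int (card S choose j) * ((-1) ^ (card S - j) * int (j ^ card A)))"
    by (rule sum_Pow_by_card[OF assms(2)])
  finally show ?thesis by (simp add: mult_ac)
qed

lemma card_injections:
  assumes "finite B"
  shows "card {f \<in> {..<k} \<rightarrow>\<^sub>E B. inj_on f {..<k}} = (card B choose k) * fact k" (is "card ?I = _")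
proof (cases "k \<le> card B")
  case True
  let ?L = "{xs. length xs = k \<and> distinct xs \<and> set xs \<subseteq> B}"
  have "bij_betw (\<lambda>f. map f [0..<k]) ?I ?L"
  proof (rule bij_betw_byWitness[where f' = "\<lambda>xs. \<lambda>i\<in>{..<k}. xs ! i"])
    show "\<forall>f\<in>?I. (\<lambda>i\<in>{..<k}. map f [0..<k] ! i) = f"
    proof
      fix f assume "f \<in> ?I"
      then have f: "f \<in> {..<k} \<rightarrow>\<^sub>E B" by simp
      show "(\<lambda>i\<in>{..<k}. map f [0..<k] ! i) = f"
      proof
        fix i show "(\<lambda>i\<in>{..<k}. map f [0..<k] ! i) i = f i"
          using PiE_arb[OF f, of i] by (cases "i < k") simp_all
      qed
    qed
    show "\<forall>xs\<in>?L. map (\<lambda>i\<in>{..<k}. xs ! i) [0..<k] = xs"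
      by (auto intro!: nth_equalityI)
    show "(\<lambda>f. map f [0..<k]) ` ?I \<subseteq> ?L"
    proof (rule image_subsetI)
      fix f assume "f \<in> ?I"
      then have "f ` {0..<k} \<subseteq> B" "inj_on f {0..<k}" by (auto simp: lessThan_atLeast0)
      then show "map f [0..<k] \<in> ?L"
        by (simp add: distinct_map)
    qed
    show "(\<lambda>xs. \<lambda>i\<in>{..<k}. xs ! i) ` ?L
        \<subseteq> ?I"
    proof (rule image_subsetI)
      fix xs assume "xs \<in> ?L"
      then have xs: "length xs = k" "distinct xs" "set xs \<subseteq> B" by simp_all
      have "(\<lambda>i\<in>{..<k}. xs ! i) \<in> {..<k} \<rightarrow>\<^sub>E B"
        using xs nth_mem[of _ xs] by (intro PiE_I) auto
      moreover have "inj_on (\<lambda>i\<in>{..<k}. xs ! i) {..<k}"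
        using xs by (intro inj_onI) (simp add: nth_eq_iff_index_eq)
      ultimately show "(\<lambda>i\<in>{..<k}. xs ! i) \<in> ?I" by simp
    qed
  qed
  then have "card ?I = card ?L"
    by (rule bij_betw_same_card)
  also have "\<dots> = \<Prod>{card B - k + 1..card B}"
    by (rule card_lists_distinct_length_eq[OF assms True])
  also have "\<dots> = fact (card B) div fact (card B - k)"
    using fact_div_fact[of "card B - k" "card B"] by simp
  also have "fact (card B) = (card B choose k) * fact k * fact (card B - k)"
    using binomial_fact_lemma[OF True] by (simp add: mult_ac)
  finally show ?thesis by simp
next
  case False
  have "\<not> inj_on f {..<k}" if "f \<in> {..<k} \<rightarrow>\<^sub>E B" for f
  proof
    assume "inj_on f {..<k}"
    then have "card {..<k} \<le> card B" using that assms by (intro card_inj_on_le[of f]) auto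
    then show False using False by simp
  qed
  then have empty: "?I = {}" by blast
  show ?thesis unfolding empty using False by simp
qed

lemma card_cycle_data:
  "int (card (cycle_data s k)) =
    (\<Sum>j=0..k. (-1) ^ (k - j) * int (k choose j) * int (j ^ s)) * int (s choose k) * fact k"
proof -
  have "cycle_data s k = {L \<in> {1..s} \<rightarrow>\<^sub>E {..<k}. L ` {1..s} = {..<k}} \<times> {e \<in> {..<k} \<rightarrow>\<^sub>E {1..s}. inj_on e {..<k}}"
    by (auto simp: cycle_data_def)
  then show ?thesis
    using card_surjections[of "{1..s}" "{..<k}"] card_injections[of "{1..s}" k]
    by (simp add: card_cartesian_product)
qed

lemma sum_all_cells:
  "(\<Sum>d\<in>all_cells s. (-1) ^ (card (code_colors d) + 1)) = (\<Sum>k=1..s. (-1) ^ (k + 1) * int (card (cells s k)))"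
proof -
  have "(\<Sum>d\<in>all_cells s. (-1::int) ^ (card (code_colors d) + 1)) =
      (\<Sum>k=1..s. \<Sum>d\<in>cells s k. (-1) ^ (card (code_colors d) + 1))"
    unfolding all_cells_def
  proof (rule sum.UNION_disjoint)
    show "\<forall>i\<in>{1..s}. \<forall>j\<in>{1..s}. i \<noteq> j \<longrightarrow> cells s i \<inter> cells s j = {}"
    proof (intro ballI impI equals0I)
      fix i j d assume "i \<in> {1..s}" "j \<in> {1..s}" "i \<noteq> j" "d \<in> cells s i \<inter> cells s j"
      then show False using card_colors_cells[of d s i] card_colors_cells[of d s j] by simp
    qed
  qed (simp_all add: finite_cells)
  also have "\<dots> = (\<Sum>k=1..s. (-1) ^ (k + 1) * int (card (cells s k)))"
    by (intro sum.cong refl) (simp add: card_colors_cells)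
  finally show ?thesis .
qed

text \<open>The factor \<open>k!\<close> from the injective colourings, divided by the fibre size
  \<open>2 * k\<close>, leaves \<open>(k - 1)! / 2\<close>; for \<open>k = 1\<close> the fibre size
  is 1, which the Kronecker delta corrects.\<close>

lemma signed_card_cells:
  assumes k: "0 < k"
  shows "(-1) ^ (k + 1) * real (card (cells s k)) =
    (\<Sum>j=0..k. (-1) ^ (j + 1) * (real j ^ s * fact (k - 1) / (2 - (if k = 1 then 1 else 0)))
       * real (s choose k) * real (k choose j))"
proof -
  define A where "A = (\<Sum>j=0..k. (-1) ^ (k - j) * real (k choose j) * real j ^ s)"
  \<comment> \<open>Chosen so that \<open>k * D\<close> is the fibre size in both cases.\<close>
  define D :: real where "D = 2 - (if k = 1 then 1 else 0)"
  have "real_of_int (int (card (cycle_data s k))) = A * real (s choose k) * fact k"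
    unfolding card_cycle_data A_def by simp
  also have "fact k = real k * fact (k - 1)" using k by (simp add: fact_reduce)
  finally have "real (card (cells s k)) * (real k * D) = A * real (s choose k) * (real k * fact (k - 1))"
    using card_cells[OF k, of s, symmetric] by (cases "k = 1") (simp_all add: D_def mult_ac)
  then have N: "real (card (cells s k)) = A * real (s choose k) * fact (k - 1) / D"
    using k by (simp add: D_def field_simps split: if_splits)
  have "(-1) ^ (k + 1) * real (card (cells s k)) = ((-1) ^ (k + 1) * A) * real (s choose k) * fact (k - 1) / D"
    unfolding N by simp
  also have "(-1) ^ (k + 1) * A = (\<Sum>j=0..k. (-1) ^ (k + 1) * ((-1) ^ (k - j) * real (k choose j) * real j ^ s))"
    unfolding A_def by (rule sum_distrib_left)
  also have "(\<Sum>j=0..k. (-1) ^ (k + 1) * ((-1) ^ (k - j) * real (k choose j) * real j ^ s)) =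
      (\<Sum>j=0..k. (-1) ^ (j + 1) * real (k choose j) * real j ^ s)"
  proof (rule sum.cong[OF refl])
    fix j assume "j \<in> {0..k}"
    \<comment> \<open>The exponents add up to \<open>2 * k + 1 - j\<close>, which has the parity of
      \<open>j + 1\<close>.\<close>
    then have "(-1::real) ^ (k + 1) * (-1) ^ (k - j) = (-1) ^ (j + 1)"
      by (simp add: minus_one_power_iff)
    then show "(-1) ^ (k + 1) * ((-1) ^ (k - j) * real (k choose j) * real j ^ s) =
        (-1) ^ (j + 1) * real (k choose j) * real j ^ s"
      by (metis mult.assoc)
  qed
  finally show ?thesis
    unfolding D_def[symmetric] sum_distrib_right sum_divide_distrib by (simp add: mult_ac)
qed

theorem mainTheorem6:
  fixes s :: nat
  assumes "s \<ge> 1"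
  shows "has_euler_characteristic (MHG1 s) \<and>
    real_of_int (euler_characteristic (MHG1 s)) =
      (\<Sum>k=1..s. \<Sum>j=0..k.
         (-1) ^ (j + 1) * (real j ^ s * fact (k - 1) / (2 - (if k = 1 then 1 else 0)))
           * real (s choose k) * real (k choose j))"
proof -
  have *: "has_euler_characteristic (MHG1 s) \<and>
      euler_characteristic (MHG1 s) = (\<Sum>k=1..s. (-1) ^ (k + 1) * int (card (cells s k)))"
    using euler_is_imp_euler_characteristic[OF euler_is_MHG1[of s]] by (simp only: sum_all_cells)
  then have "real_of_int (euler_characteristic (MHG1 s)) = (\<Sum>k=1..s. (-1) ^ (k + 1) * real (card (cells s k)))"
    by simp
  also have "\<dots> = (\<Sum>k=1..s. \<Sum>j=0..k.
         (-1) ^ (j + 1) * (real j ^ s * fact (k - 1) / (2 - (if k = 1 then 1 else 0)))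
           * real (s choose k) * real (k choose j))"
    by (rule sum.cong[OF refl], rule signed_card_cells) simp
  finally show ?thesis using * by blast
qed

end
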